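(* Let $A,B\in\mathbb{B}(\mathscr{H})_+$, $X\in\mathcal{I}$ and $\alpha\in[1/2,\infty)$. Then $$F(1/2)+\left(\frac{F(1/4)+F(1/2)}{2}-F\left(\frac{1/4+1/2}{2}\right)\right)+2\left(2\int_{1/4}^{3/4}F(\nu)\,d\nu-F(1/2)\right)\leq G(\alpha).$$
   Context: $\mathscr{H}$ is a separable complex Hilbert space, $\mathbb{B}(\mathscr{H})_+$ is the cone of positive (semidefinite) bounded operators on $\mathscr{H}$, and $\mathbb{K}(\mathscr{H})$ is the ideal of compact operators. A unitarily invariant norm $|||\cdot|||:\mathbb{K}(\mathscr{H})\to[0,\infty]$ is a map $|||A|||=g(s(A))$, where $g$ is a symmetric gauge function and $s(A)=(s_1(A),s_2(A),\dots)$ is the sequence of singular values of $A$ (eigenvalues of $|A|=(A^*A)^{1/2}$ in decreasing order with multiplicity). Fix such a norm and put $\mathcal{I}=\{A\in\mathbb{K}(\mathscr{H}):|||A|||<\infty\}$, a two-sided ideal of $\mathbb{B}(\mathscr{H})$. For given $A,B,X$ define $$F(\nu)=\tfrac12\,|||A^{\nu}XB^{1-\nu}+A^{1-\nu}XB^{\nu}|||\quad(\nu\in[0,1]),$$ $$G(\alpha)=\left|\left|\left|(1-\alpha)A^{1/2}XB^{1/2}+\alpha\,\frac{AX+XB}{2}\right|\right|\right|\quad(\alpha\ge 0).$$ *)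

theory Defs
  imports "HOL-Analysis.Analysis"
begin

section \<open>Complex Hilbert spaces\<close>

text \<open>The inner product is linear in the first argument. The real vector space and norm structure
  of the superclasses is the one induced by the complex structure.\<close>

class chilbert_space = real_normed_vector + complete_space +
  fixes scaleC :: "complex \<Rightarrow> 'a \<Rightarrow> 'a" (infixr \<open>*\<^sub>C\<close> 75)
    and cinner :: "'a \<Rightarrow> 'a \<Rightarrow> complex"
  assumes scaleC_add_right: "c *\<^sub>C (x + y) = c *\<^sub>C x + c *\<^sub>C y"
    and scaleC_add_left: "(c + d) *\<^sub>C x = c *\<^sub>C x + d *\<^sub>C x"
    and scaleC_scaleC: "c *\<^sub>C (d *\<^sub>C x) = (c * d) *\<^sub>C x"
    and scaleC_one: "1 *\<^sub>C x = x"
    and scaleR_scaleC: "scaleR r x = of_real r *\<^sub>C x"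
    and cinner_commute: "cinner x y = cnj (cinner y x)"
    and cinner_add_left: "cinner (x + y) z = cinner x z + cinner y z"
    and cinner_scaleC_left: "cinner (c *\<^sub>C x) y = c * cinner x y"
    and cinner_ge_zero: "0 \<le> Re (cinner x x)"
    and cinner_eq_zero_iff: "cinner x x = 0 \<longleftrightarrow> x = 0"
    and norm_eq_sqrt_cinner: "norm x = sqrt (Re (cinner x x))"

lemma vector_space_scaleC: "vector_space (scaleC :: complex \<Rightarrow> 'a \<Rightarrow> 'a::chilbert_space)"
  by unfold_locales
    (simp_all add: scaleC_add_right scaleC_add_left scaleC_scaleC scaleC_one)

section \<open>Bounded, positive and compact operators\<close>

definition bounded_clinear :: "('a::chilbert_space \<Rightarrow> 'a) \<Rightarrow> bool" where
  "bounded_clinear A \<longleftrightarrow> bounded_linear A \<and> (\<forall>c x. A (c *\<^sub>C x) = c *\<^sub>C A x)"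

definition cadjoint :: "('a::chilbert_space \<Rightarrow> 'a) \<Rightarrow> 'a \<Rightarrow> 'a" where
  "cadjoint A = (THE B. \<forall>x y. cinner (A x) y = cinner x (B y))"

definition positive_op :: "('a::chilbert_space \<Rightarrow> 'a) \<Rightarrow> bool" where
  "positive_op A \<longleftrightarrow> bounded_clinear A \<and> (\<forall>x y. cinner (A x) y = cinner x (A y)) \<and>
     (\<forall>x. 0 \<le> Re (cinner (A x) x))"

definition compact_op :: "('a::chilbert_space \<Rightarrow> 'a) \<Rightarrow> bool" where
  "compact_op A \<longleftrightarrow> bounded_clinear A \<and> compact (closure (A ` cball 0 1))"

section \<open>Continuous functional calculus and powers of positive operators\<close>

definition poly_op :: "real poly \<Rightarrow> ('a::chilbert_space \<Rightarrow> 'a) \<Rightarrow> 'a \<Rightarrow> 'a" where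
  "poly_op p A x = (\<Sum>i\<le>degree p. coeff p i *\<^sub>R (A ^^ i) x)"

text \<open>For positive \<open>A\<close> and \<open>f\<close> continuous on \<open>[0, \<parallel>A\<parallel>]\<close> (an interval containing the spectrum),
  \<open>f(A)\<close> is the operator-norm limit of \<open>p\<^sub>n(A)\<close> for polynomials \<open>p\<^sub>n\<close> converging uniformly to \<open>f\<close>
  on that interval. Such \<open>p\<^sub>n\<close> exist by the Weierstrass theorem, so \<open>T\<close> is unique.\<close>

definition fun_calc :: "(real \<Rightarrow> real) \<Rightarrow> ('a::chilbert_space \<Rightarrow> 'a) \<Rightarrow> 'a \<Rightarrow> 'a" where
  "fun_calc f A = (THE T. bounded_clinear T \<and>
     (\<forall>p. uniform_limit {0..onorm A} (\<lambda>n t. poly (p n) t) f sequentially \<longrightarrow>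
          (\<lambda>n. onorm (\<lambda>x. poly_op (p n) A x - T x)) \<longlonglongrightarrow> 0))"

text \<open>The case distinction is needed because \<open>0 powr 0 = 0\<close>, whereas \<open>A\<^sup>0\<close> is the identity.
  Meaningful for positive \<open>A\<close> and \<open>r \<ge> 0\<close>.\<close>

definition op_powr :: "('a::chilbert_space \<Rightarrow> 'a) \<Rightarrow> real \<Rightarrow> 'a \<Rightarrow> 'a" where
  "op_powr A r = (if r = 0 then id else fun_calc (\<lambda>t. t powr r) A)"

definition op_abs :: "('a::chilbert_space \<Rightarrow> 'a) \<Rightarrow> 'a \<Rightarrow> 'a" where
  "op_abs A = op_powr (cadjoint A \<circ> A) (1/2)"

section \<open>Singular values\<close>

text \<open>The decreasing enumeration, indexed from 0, of the positive eigenvalues of \<open>\<bar>A\<bar>\<close>, each repeated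
  according to the complex dimension of its eigenspace; padded with zeros if there are only finitely
  many. Meaningful for compact \<open>A\<close>.\<close>

definition singular_values :: "('a::chilbert_space \<Rightarrow> 'a) \<Rightarrow> nat \<Rightarrow> real" where
  "singular_values A = (THE s. antimono s \<and> (\<forall>n. 0 \<le> s n) \<and>
     (\<forall>t>0. finite {n. s n = t} \<and>
       card {n. s n = t} = vector_space.dim scaleC {x. op_abs A x = t *\<^sub>R x}))"

section \<open>Symmetric gauge functions and unitarily invariant norms\<close>

definition fin_supp :: "(nat \<Rightarrow> real) \<Rightarrow> bool" where
  "fin_supp a \<longleftrightarrow> finite {n. a n \<noteq> 0}"

text \<open>A norm on the finitely supported real sequences, invariant under permutations and changes of
  sign. The normalisation \<open>g(1,0,0,\<dots>) = 1\<close> is not imposed.\<close>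

definition symmetric_gauge :: "((nat \<Rightarrow> real) \<Rightarrow> real) \<Rightarrow> bool" where
  "symmetric_gauge g \<longleftrightarrow>
     (\<forall>a. fin_supp a \<longrightarrow> 0 \<le> g a \<and> (g a = 0 \<longleftrightarrow> a = (\<lambda>_. 0))) \<and>
     (\<forall>a c. fin_supp a \<longrightarrow> g (\<lambda>n. c * a n) = \<bar>c\<bar> * g a) \<and>
     (\<forall>a b. fin_supp a \<longrightarrow> fin_supp b \<longrightarrow> g (\<lambda>n. a n + b n) \<le> g a + g b) \<and>
     (\<forall>a \<pi>. fin_supp a \<longrightarrow> bij \<pi> \<longrightarrow> g (a \<circ> \<pi>) = g a) \<and>
     (\<forall>a \<epsilon>. fin_supp a \<longrightarrow> (\<forall>n. \<epsilon> n = 1 \<or> \<epsilon> n = -1) \<longrightarrow> g (\<lambda>n. \<epsilon> n * a n) = g a)"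

text \<open>The usual extension of \<open>g\<close> to all sequences, with values in \<open>[0,\<infinity>]\<close>.\<close>

definition gauge_ext :: "((nat \<Rightarrow> real) \<Rightarrow> real) \<Rightarrow> (nat \<Rightarrow> real) \<Rightarrow> ennreal" where
  "gauge_ext g a = (SUP n. ennreal (g (\<lambda>k. if k < n then a k else 0)))"

definition ui_norm :: "((nat \<Rightarrow> real) \<Rightarrow> real) \<Rightarrow> ('a::chilbert_space \<Rightarrow> 'a) \<Rightarrow> ennreal" where
  "ui_norm g A = gauge_ext g (singular_values A)"

definition norm_ideal :: "((nat \<Rightarrow> real) \<Rightarrow> real) \<Rightarrow> ('a::chilbert_space \<Rightarrow> 'a) set" where
  "norm_ideal g = {A. compact_op A \<and> ui_norm g A < \<infinity>}"

section \<open>The functions F and G\<close>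

text \<open>For \<open>X\<close> in the ideal the operators below also lie in it, so \<open>enn2real\<close> is
  applied to finite values only.\<close>

definition heinz_F ::
  "((nat \<Rightarrow> real) \<Rightarrow> real) \<Rightarrow> ('a::chilbert_space \<Rightarrow> 'a) \<Rightarrow> ('a \<Rightarrow> 'a) \<Rightarrow> ('a \<Rightarrow> 'a) \<Rightarrow> real \<Rightarrow> real"
  where
  "heinz_F g A B X \<nu> = 1/2 * enn2real (ui_norm g
     (\<lambda>x. op_powr A \<nu> (X (op_powr B (1 - \<nu>) x)) + op_powr A (1 - \<nu>) (X (op_powr B \<nu> x))))"

definition heron_G ::
  "((nat \<Rightarrow> real) \<Rightarrow> real) \<Rightarrow> ('a::chilbert_space \<Rightarrow> 'a) \<Rightarrow> ('a \<Rightarrow> 'a) \<Rightarrow> ('a \<Rightarrow> 'a) \<Rightarrow> real \<Rightarrow> real"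
  where
  "heron_G g A B X \<alpha> = enn2real (ui_norm g
     (\<lambda>x. (1 - \<alpha>) *\<^sub>R op_powr A (1/2) (X (op_powr B (1/2) x)) +
          \<alpha> *\<^sub>R ((1/2) *\<^sub>R (A (X x) + X (B x)))))"

end

theory Submission
  imports Defs "HOL-Computational_Algebra.Fundamental_Theorem_Algebra"
begin

text \<open>
  The proof separates into a statement about convex functions and a statement about operators. The
  function \<open>F\<close> is convex on \<open>[0, 1]\<close> and symmetric about \<open>1/2\<close>. Estimating its integral by the trapezium
  rule with step \<open>1/8\<close> makes the terms \<open>F (3/8)\<close> and \<open>F (1/2)\<close> cancel, and what remains of the left-hand
  side is \<open>F (1/4)\<close> (\<open>refined_hermite_hadamard\<close>). On the other side \<open>F (1/4) \<le> G (1/2) \<le> G \<alpha>\<close>.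

  Convexity of \<open>F\<close> and the comparison with \<open>G\<close> come from a single inequality, the arithmetic-geometric
  mean inequality \<open>2 |||A X B||| \<le> |||A\<^sup>2 X + X B\<^sup>2|||\<close> (\<open>arith_geo_mean\<close>), applied to fractional powers
  of \<open>A\<close> and \<open>B\<close>. With \<open>A\<^sup>d\<close>, \<open>B\<^sup>d\<close> and \<open>Z = A\<^sup>p X B\<^sup>q + A\<^sup>q X B\<^sup>p\<close> it says that \<open>F\<close> is midpoint convex; as
  \<open>F\<close> is bounded, it is convex. With \<open>A\<^bsup>1/4\<^esup>\<close>, \<open>B\<^bsup>1/4\<^esup>\<close> and \<open>W = A\<^bsup>1/2\<^esup> X + X B\<^bsup>1/2\<^esup>\<close> it says that
  \<open>F (1/4) \<le> G (1/2)\<close>. Finally \<open>G\<close> is convex with \<open>G 0 \<le> G (1/2)\<close>, hence at least \<open>G (1/2)\<close> on \<open>[1/2, \<infinity>)\<close>.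

  The arithmetic-geometric mean inequality is proved for the Ky Fan norms, the partial sums of the
  singular values. They have a variational description as maxima of \<open>\<Sum>\<^sub>i 2 Re (cinner (Y b\<^sub>i) a\<^sub>i)\<close> over
  Bessel systems \<open>(a\<^sub>i, b\<^sub>i)\<close> in the direct sum of two copies of the space (\<open>ky_fan_upper\<close>,
  \<open>ky_fan_attained\<close>). The nonzero singular values of \<open>A X B\<close> are eigenvalues of the operator
  \<open>(a, b) \<mapsto> (A\<^sup>2 X b, B\<^sup>2 X\<^sup>* a)\<close>. It is not normal in general, but by Schur triangularisation they appear as diagonal entries in an
  orthonormal system, and these entries are also values of the functional above for
  \<open>Y = A\<^sup>2 X + X B\<^sup>2\<close>. Ky Fan's dominance principle, in the form \<open>gauge_weak_majorisation\<close>, carries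
  inequalities between partial sums of singular values over to every symmetric gauge function.

  The underlying theory is developed in the elementary form that this argument uses: the Riesz
  representation theorem, a functional calculus for positive operators based on an estimate of
  \<open>\<parallel>p(A)\<parallel>\<close> by factorisation of polynomials, and the singular value decomposition of compact operators
  by successive maximisation.
\<close>

section \<open>Inner products\<close>

instance chilbert_space \<subseteq> banach ..

interpretation cvec: vector_space "scaleC :: complex \<Rightarrow> 'a \<Rightarrow> 'a::chilbert_space"
  by (rule vector_space_scaleC)

lemma cinner_add_right: "cinner x (y + z) = cinner x y + cinner x (z::'a::chilbert_space)"
  by (metis cinner_add_left cinner_commute complex_cnj_add)

lemma cinner_scaleC_right: "cinner x (c *\<^sub>C y) = cnj c * cinner x (y::'a::chilbert_space)"
  by (metis cinner_commute cinner_scaleC_left complex_cnj_mult)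

lemma cinner_scaleR_left: "cinner (r *\<^sub>R x) y = of_real r * cinner x (y::'a::chilbert_space)"
  by (simp add: scaleR_scaleC cinner_scaleC_left)

lemma cinner_scaleR_right: "cinner x (r *\<^sub>R y) = of_real r * cinner x (y::'a::chilbert_space)"
  by (simp add: scaleR_scaleC cinner_scaleC_right)

lemma cinner_zero [simp]: "cinner 0 x = 0" "cinner x 0 = 0" for x :: "'a::chilbert_space"
  using cinner_scaleR_left[of 0 x x] cinner_scaleR_right[of x 0 x] by simp_all

lemma Re_cinner_self: "Re (cinner x x) = (norm x)\<^sup>2" for x :: "'a::chilbert_space"
  by (simp add: norm_eq_sqrt_cinner cinner_ge_zero)

lemma cinner_self: "cinner x x = of_real ((norm x)\<^sup>2)" for x :: "'a::chilbert_space"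
proof -
  have "Im (cinner x x) = 0"
    using cinner_commute[of x x] by (metis cnj.simps(2) neg_equal_zero)
  then show ?thesis by (simp add: complex_eq_iff Re_cinner_self)
qed

lemma Re_cinner_commute: "Re (cinner x y) = Re (cinner y x)" for x y :: "'a::chilbert_space"
  by (metis cinner_commute cnj.simps(1))

lemma cmod_cinner_commute: "cmod (cinner x y) = cmod (cinner y x)" for x y :: "'a::chilbert_space"
  by (metis cinner_commute complex_mod_cnj)

lemma norm_add_sq: "(norm (x + y))\<^sup>2 = (norm x)\<^sup>2 + (norm y)\<^sup>2 + 2 * Re (cinner x y)"
  for x y :: "'a::chilbert_space"
  using Re_cinner_commute[of x y]
  by (simp add: Re_cinner_self[symmetric] cinner_add_left cinner_add_right)

lemma norm_scaleC: "norm (c *\<^sub>C x) = cmod c * norm x" for x :: "'a::chilbert_space"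
proof -
  have "of_real ((norm (c *\<^sub>C x))\<^sup>2) = (c * cnj c) * cinner x x"
    unfolding cinner_self[symmetric] by (simp add: cinner_scaleC_left cinner_scaleC_right)
  also have "\<dots> = of_real ((cmod c * norm x)\<^sup>2)"
    by (simp only: complex_norm_square[symmetric] cinner_self power_mult_distrib of_real_mult of_real_power)
  finally have "(norm (c *\<^sub>C x))\<^sup>2 = (cmod c * norm x)\<^sup>2"
    using of_real_eq_iff by blast
  then show ?thesis by (simp add: power2_eq_iff_nonneg)
qed

lemma norm_diff_sq: "(norm (x - y))\<^sup>2 = (norm x)\<^sup>2 + (norm y)\<^sup>2 - 2 * Re (cinner x y)"
  for x y :: "'a::chilbert_space"
  using norm_add_sq[of x "(-1) *\<^sub>R y"] by (simp only: cinner_scaleR_right) simp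

lemma cauchy_schwarz: "cmod (cinner x y) \<le> norm x * norm y" for x y :: "'a::chilbert_space"
proof (cases "y = 0")
  case False
  define c where "c = cinner x y / of_real ((norm y)\<^sup>2)"
  have "Re (cinner x (c *\<^sub>C y)) = (cmod (cinner x y))\<^sup>2 / (norm y)\<^sup>2"
    by (simp add: cinner_scaleC_right c_def complex_mult_cnj cmod_power2 mult.commute)
  moreover have "(norm (c *\<^sub>C y))\<^sup>2 = (cmod (cinner x y))\<^sup>2 / (norm y)\<^sup>2"
    using False by (simp add: norm_scaleC c_def norm_divide norm_mult power2_eq_square field_simps)
  ultimately have "(norm (x - c *\<^sub>C y))\<^sup>2 = (norm x)\<^sup>2 - (cmod (cinner x y))\<^sup>2 / (norm y)\<^sup>2"
    by (simp add: norm_diff_sq)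
  then have "(cmod (cinner x y))\<^sup>2 / (norm y)\<^sup>2 \<le> (norm x)\<^sup>2"
    by (metis diff_ge_0_iff_ge zero_le_power2)
  then have "(cmod (cinner x y))\<^sup>2 \<le> (norm x * norm y)\<^sup>2"
    using False by (simp add: field_simps)
  then show ?thesis by (rule power2_le_imp_le) simp
qed simp

interpretation cinner: bounded_bilinear "cinner :: 'a::chilbert_space \<Rightarrow> 'a \<Rightarrow> complex"
proof
  show "\<exists>K. \<forall>a b::'a. norm (cinner a b) \<le> norm a * norm b * K"
    using cauchy_schwarz by (intro exI[of _ 1]) auto
qed (simp_all add: cinner_add_left cinner_add_right cinner_scaleR_left cinner_scaleR_right scaleR_conv_of_real)

interpretation scaleC: bounded_bilinear "scaleC :: complex \<Rightarrow> 'a \<Rightarrow> 'a::chilbert_space"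
proof
  show "\<exists>K. \<forall>c (x::'a). norm (c *\<^sub>C x) \<le> norm c * norm x * K"
    by (intro exI[of _ 1]) (auto simp: norm_scaleC)
qed (simp_all add: scaleC_add_left scaleC_add_right scaleR_scaleC scaleC_scaleC scaleR_conv_of_real mult.commute)

lemma parallelogram: "(norm (x + y))\<^sup>2 + (norm (x - y))\<^sup>2 = 2 * (norm x)\<^sup>2 + 2 * (norm y)\<^sup>2"
  for x y :: "'a::chilbert_space"
  by (simp add: norm_add_sq norm_diff_sq)

lemma cinner_ext:
  fixes y z :: "'a::chilbert_space"
  assumes "\<And>x. cinner x y = cinner x z"
  shows "y = z"
proof -
  have "cinner (y - z) (y - z) = 0"
    using assms[of "y - z"] by (simp add: cinner.diff_right)
  then show ?thesis by (simp add: cinner_eq_zero_iff)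
qed

section \<open>Bounded operators and their adjoints\<close>

lemma bounded_clinearD:
  assumes "bounded_clinear A"
  shows "bounded_linear A" and "A (c *\<^sub>C x) = c *\<^sub>C A x" and "A (x + y) = A x + A y"
    and "A (x - y) = A x - A y" and "A (r *\<^sub>R x) = r *\<^sub>R A x" and "A 0 = 0"
    and "A (sum f I) = (\<Sum>i\<in>I. A (f i))" and "A (- x) = - A x"
    and "norm (A x) \<le> onorm A * norm x"
proof -
  show bl: "bounded_linear A" and "A (c *\<^sub>C x) = c *\<^sub>C A x"
    using assms by (auto simp: bounded_clinear_def)
  interpret bounded_linear A by (rule bl)
  show "A (x + y) = A x + A y" "A (x - y) = A x - A y" "A (r *\<^sub>R x) = r *\<^sub>R A x" "A 0 = 0"
    "A (sum f I) = (\<Sum>i\<in>I. A (f i))" "A (- x) = - A x"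
    by (rule add diff scaleR zero sum neg)+
  show "norm (A x) \<le> onorm A * norm x" by (rule onorm[OF bl])
qed

lemma bounded_clinearI:
  fixes A :: "'a::chilbert_space \<Rightarrow> 'a"
  assumes "\<And>x y. A (x + y) = A x + A y" "\<And>c x. A (c *\<^sub>C x) = c *\<^sub>C A x"
    and "\<And>x. norm (A x) \<le> K * norm x"
  shows "bounded_clinear A"
  unfolding bounded_clinear_def
  by (intro conjI bounded_linear_intro[of A K])
     (simp_all add: assms scaleR_scaleC mult.commute)

lemma bounded_clinear_id: "bounded_clinear (\<lambda>x. x)"
  by (rule bounded_clinearI[of _ 1]) auto

lemma bounded_clinear_comp:
  assumes "bounded_clinear A" "bounded_clinear B"
  shows "bounded_clinear (\<lambda>x. A (B x))"
  using assms bounded_linear_compose unfolding bounded_clinear_def by auto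

lemma bounded_clinear_add:
  assumes "bounded_clinear A" "bounded_clinear B"
  shows "bounded_clinear (\<lambda>x. A x + B x)"
  using assms bounded_linear_add unfolding bounded_clinear_def by (auto simp: scaleC_add_right)

lemma bounded_clinear_scaleC:
  assumes "bounded_clinear A"
  shows "bounded_clinear (\<lambda>x. c *\<^sub>C A x)"
  using assms bounded_linear_compose[OF scaleC.bounded_linear_right]
  unfolding bounded_clinear_def by (auto simp: scaleC_scaleC mult.commute)

lemma bounded_clinear_scaleR:
  assumes "bounded_clinear A"
  shows "bounded_clinear (\<lambda>x. r *\<^sub>R A x)"
  using bounded_clinear_scaleC[OF assms] by (simp add: scaleR_scaleC)

lemma bounded_clinear_sum:
  assumes "\<And>i. i \<in> I \<Longrightarrow> bounded_clinear (A i)"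
  shows "bounded_clinear (\<lambda>x. \<Sum>i\<in>I. A i x)"
  using assms by (auto simp: bounded_clinear_def scaleC.sum_right intro!: bounded_linear_sum)

lemma bounded_clinear_diff:
  assumes "bounded_clinear A" "bounded_clinear B"
  shows "bounded_clinear (\<lambda>x. A x - B x)"
  using bounded_clinear_add[OF assms(1) bounded_clinear_scaleR[OF assms(2), of "-1"]] by simp

lemma bounded_clinear_funpow:
  assumes "bounded_clinear A"
  shows "bounded_clinear (A ^^ n)"
  by (induction n) (use assms bounded_clinear_id bounded_clinear_comp[of A] in \<open>auto simp: id_def comp_def\<close>)

lemma linear_coeff_zero_if_nonneg:
  fixes a b :: real
  assumes "\<And>t. 0 \<le> a * t + b * t\<^sup>2"
  shows "a = 0"
proof (rule ccontr)
  assume "a \<noteq> 0"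
  define c where "c = \<bar>b\<bar> + 1"
  have c: "0 < c" "b \<le> c - 1" by (auto simp: c_def)
  define t where "t = - a / c"
  have "a * t + b * t\<^sup>2 \<le> a * t + (c - 1) * t\<^sup>2"
    by (intro add_left_mono mult_right_mono c) auto
  also have "\<dots> = - (a / c)\<^sup>2"
    using c by (simp add: t_def power2_eq_square field_simps)
  also have "\<dots> < 0" using \<open>a \<noteq> 0\<close> c by simp
  finally show False using assms[of t] by simp
qed

text \<open>The representing vector is the minimiser of \<open>\<parallel>x\<parallel>\<^sup>2 - 2 Re (f x)\<close>. By the parallelogram law a minimising
  sequence is Cauchy, and the minimum is stationary in every direction \<open>h\<close>, which says that
  \<open>Re (f h) = Re (cinner h y)\<close>. Replacing \<open>h\<close> by \<open>\<i> h\<close> gives the imaginary parts.\<close>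

theorem riesz_representation:
  fixes f :: "'a::chilbert_space \<Rightarrow> complex"
  assumes bl: "bounded_linear f" and sc: "\<And>c x. f (c *\<^sub>C x) = c * f x"
  shows "\<exists>y. \<forall>x. f x = cinner x y"
proof -
  interpret f: bounded_linear f by (rule bl)
  obtain K where K: "0 < K" "\<And>x. norm (f x) \<le> norm x * K" using f.pos_bounded by blast
  define \<phi> where "\<phi> x = (norm x)\<^sup>2 - 2 * Re (f x)" for x
  have lower: "- K\<^sup>2 \<le> \<phi> x" for x
  proof -
    have "Re (f x) \<le> norm x * K" using K(2)[of x] complex_Re_le_cmod[of "f x"] by linarith
    moreover have "0 \<le> (norm x - K)\<^sup>2" by simp
    ultimately show ?thesis unfolding \<phi>_def power2_diff by (simp add: mult.commute)
  qed
  have bdd: "bdd_below (range \<phi>)" by (rule bdd_belowI2[OF lower])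
  define m where "m = Inf (range \<phi>)"
  have m_le: "m \<le> \<phi> x" for x unfolding m_def by (rule cInf_lower[OF _ bdd]) auto
  have "\<exists>x. \<phi> x < m + 1 / real (Suc n)" for n
  proof -
    have "Inf (range \<phi>) < m + 1 / real (Suc n)" unfolding m_def by simp
    from cInf_lessD[OF _ this] show ?thesis by blast
  qed
  then obtain x where x: "\<And>n. \<phi> (x n) < m + 1 / real (Suc n)" by metis
  \<comment> \<open>By the parallelogram law, two vectors at which \<open>\<phi>\<close> is nearly minimal are close to each other.\<close>
  have near: "(norm (u - v))\<^sup>2 \<le> 2 * (\<phi> u - m) + 2 * (\<phi> v - m)" for u v
  proof -
    have h: "\<phi> ((1/2) *\<^sub>R (u + v)) = (norm (u + v))\<^sup>2 / 4 - Re (f u) - Re (f v)"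
      unfolding \<phi>_def norm_scaleR power_mult_distrib f.scaleR f.add
      by (simp add: power2_eq_square add_divide_distrib)
    show ?thesis
      using m_le[of "(1/2) *\<^sub>R (u + v)"] parallelogram[of u v] unfolding h
      by (simp add: \<phi>_def)
  qed
  have "Cauchy x"
  proof (rule metric_CauchyI)
    fix e :: real assume "0 < e"
    then have "0 < e\<^sup>2 / 4" by simp
    then obtain N where N: "1 / real (Suc N) < e\<^sup>2 / 4" by (rule nat_approx_posE)
    have "dist (x i) (x j) < e" if "N \<le> i" "N \<le> j" for i j
    proof -
      have "1 / real (Suc i) \<le> 1 / real (Suc N)" "1 / real (Suc j) \<le> 1 / real (Suc N)"
        using that by (auto simp: field_simps)
      then have "(norm (x i - x j))\<^sup>2 < e\<^sup>2"
        using near[of "x i" "x j"] x[of i] x[of j] N unfolding of_nat_Suc by argo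
      then show ?thesis unfolding dist_norm
        by (rule power2_less_imp_less) (use \<open>0 < e\<close> in simp)
    qed
    then show "\<exists>N. \<forall>i\<ge>N. \<forall>j\<ge>N. dist (x i) (x j) < e" by blast
  qed
  then obtain y where y: "x \<longlonglongrightarrow> y" using convergent_eq_Cauchy by blast
  have "(\<lambda>n. \<phi> (x n)) \<longlonglongrightarrow> \<phi> y" unfolding \<phi>_def by (intro tendsto_intros y f.tendsto)
  moreover have "(\<lambda>n. m + 1 / real (Suc n)) \<longlonglongrightarrow> m + 0"
    using LIMSEQ_inverse_real_of_nat by (intro tendsto_intros) (simp add: inverse_eq_divide)
  ultimately have "\<phi> y \<le> m + 0"
    using x by (meson LIMSEQ_le less_imp_le)
  then have ymin: "\<phi> y \<le> \<phi> z" for z using m_le[of z] by simp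
  have Re_eq: "Re (f h) = Re (cinner h y)" for h
  proof -
    have "0 \<le> (2 * Re (cinner h y) - 2 * Re (f h)) * t + (norm h)\<^sup>2 * t\<^sup>2" for t
      using ymin[of "y + t *\<^sub>R h"] Re_cinner_commute[of y h] unfolding \<phi>_def
      by (simp add: norm_add_sq f.add f.scaleR cinner_scaleR_right power_mult_distrib algebra_simps)
    from linear_coeff_zero_if_nonneg[OF this] show ?thesis by simp
  qed
  have "f h = cinner h y" for h
    using Re_eq[of h] Re_eq[of "\<i> *\<^sub>C h"]
    by (simp add: complex_eq_iff sc cinner_scaleC_left)
  then show ?thesis by blast
qed

lemma cadjoint_ex:
  assumes A: "bounded_clinear A"
  shows "\<exists>B. \<forall>x y. cinner (A x) y = cinner x (B y)"
proof -
  have "\<exists>z. \<forall>x. cinner (A x) y = cinner x z" for y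
  proof (rule riesz_representation)
    show "bounded_linear (\<lambda>x. cinner (A x) y)"
      using bounded_linear_compose[OF cinner.bounded_linear_left bounded_clinearD(1)[OF A]] .
  qed (simp add: bounded_clinearD[OF A] cinner_scaleC_left)
  then show ?thesis by metis
qed

lemma cadjoint_eqI:
  assumes "\<And>x y. cinner (A x) y = cinner x (B y)"
  shows "cadjoint A = B"
  unfolding cadjoint_def
proof (rule the_equality)
  fix C assume C: "\<forall>x y. cinner (A x) y = cinner x (C y)"
  show "C = B"
    by (rule ext, rule cinner_ext) (simp add: C[rule_format, symmetric] assms)
qed (use assms in blast)

lemma cinner_cadjoint: "bounded_clinear A \<Longrightarrow> cinner (A x) y = cinner x (cadjoint A y)"
  using cadjoint_ex[of A] cadjoint_eqI[of A] by force

lemma cinner_cadjoint': "bounded_clinear A \<Longrightarrow> cinner (cadjoint A x) y = cinner x (A y)"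
  by (metis cinner_cadjoint cinner_commute)

text \<open>Cancels the factor that an estimate of \<open>\<parallel>b\<parallel>\<^sup>2\<close> by the Cauchy-Schwarz inequality leaves on the right.\<close>

lemma norm_le_if_sq_le: "b\<^sup>2 \<le> K * b * c \<Longrightarrow> 0 \<le> K * c \<Longrightarrow> 0 \<le> b \<Longrightarrow> b \<le> K * c" for b K c :: real
  by (cases "b = 0") (auto simp: power2_eq_square mult.commute mult.left_commute)

lemma onorm_nonneg: "bounded_clinear A \<Longrightarrow> 0 \<le> onorm A"
  by (simp add: bounded_clinearD(1) onorm_pos_le)

lemma norm_cadjoint_le:
  assumes A: "bounded_clinear A" and K: "\<And>x. norm (A x) \<le> K * norm x" "0 \<le> K"
  shows "norm (cadjoint A y) \<le> K * norm y"
proof -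
  have "(norm (cadjoint A y))\<^sup>2 = Re (cinner (A (cadjoint A y)) y)"
    by (simp add: cinner_cadjoint[OF A] Re_cinner_self)
  also have "\<dots> \<le> norm (A (cadjoint A y)) * norm y"
    by (rule order_trans[OF complex_Re_le_cmod cauchy_schwarz])
  also have "\<dots> \<le> K * norm (cadjoint A y) * norm y"
    by (intro mult_right_mono K) auto
  finally show ?thesis by (rule norm_le_if_sq_le) (use K in auto)
qed

lemma bounded_clinear_cadjoint:
  assumes A: "bounded_clinear A"
  shows "bounded_clinear (cadjoint A)"
proof (rule bounded_clinearI)
  show "cadjoint A (x + y) = cadjoint A x + cadjoint A y" for x y
    by (rule cinner_ext) (simp add: cinner_cadjoint[OF A, symmetric] cinner_add_right)
  show "cadjoint A (c *\<^sub>C x) = c *\<^sub>C cadjoint A x" for c x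
    by (rule cinner_ext) (simp add: cinner_cadjoint[OF A, symmetric] cinner_scaleC_right)
  show "norm (cadjoint A x) \<le> onorm A * norm x" for x
    by (rule norm_cadjoint_le[OF A]) (auto simp: bounded_clinearD(9)[OF A] onorm_nonneg[OF A])
qed

lemma positive_op_bounded: "positive_op A \<Longrightarrow> bounded_clinear A"
  by (simp add: positive_op_def)

lemma positive_op_self_adjoint: "positive_op A \<Longrightarrow> cinner (A x) y = cinner x (A y)"
  by (simp add: positive_op_def)

lemma positive_op_cadjoint_comp:
  assumes A: "bounded_clinear A"
  shows "positive_op (cadjoint A \<circ> A)"
  unfolding positive_op_def comp_def
proof (intro conjI allI)
  show "bounded_clinear (\<lambda>x. cadjoint A (A x))"
    by (rule bounded_clinear_comp[OF bounded_clinear_cadjoint[OF A] A])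
  show "cinner (cadjoint A (A x)) y = cinner x (cadjoint A (A y))" for x y
    by (rule trans[OF cinner_cadjoint'[OF A] cinner_cadjoint[OF A]])
  show "0 \<le> Re (cinner (cadjoint A (A x)) x)" for x
    by (simp add: cinner_cadjoint'[OF A] cinner_ge_zero)
qed

section \<open>Polynomials in a positive operator\<close>

text \<open>Complex coefficients make it possible to split a real polynomial in \<open>A\<close> into linear factors \<open>A - z\<close>.\<close>

definition cpoly_op :: "complex poly \<Rightarrow> ('a::chilbert_space \<Rightarrow> 'a) \<Rightarrow> 'a \<Rightarrow> 'a" where
  "cpoly_op p A x = (\<Sum>i\<le>degree p. coeff p i *\<^sub>C (A ^^ i) x)"

lemma cpoly_op_eq_sum:
  assumes "degree p \<le> n"
  shows "cpoly_op p A x = (\<Sum>i\<le>n. coeff p i *\<^sub>C (A ^^ i) x)"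
  unfolding cpoly_op_def
  by (rule sum.mono_neutral_left) (use assms in \<open>auto simp: coeff_eq_0\<close>)

lemma cpoly_op_0 [simp]: "cpoly_op 0 A x = 0"
  by (simp add: cpoly_op_def)

lemma cpoly_op_pCons:
  assumes A: "bounded_clinear A"
  shows "cpoly_op (pCons a p) A x = a *\<^sub>C x + A (cpoly_op p A x)"
proof -
  have "degree (pCons a p) \<le> Suc (degree p)" by (simp add: degree_pCons_le)
  then have "cpoly_op (pCons a p) A x = (\<Sum>i\<le>Suc (degree p). coeff (pCons a p) i *\<^sub>C (A ^^ i) x)"
    by (rule cpoly_op_eq_sum)
  also have "\<dots> = a *\<^sub>C x + (\<Sum>i\<le>degree p. coeff p i *\<^sub>C A ((A ^^ i) x))"
    by (simp add: sum.atMost_Suc_shift del: sum.atMost_Suc)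
  also have "(\<Sum>i\<le>degree p. coeff p i *\<^sub>C A ((A ^^ i) x)) = A (cpoly_op p A x)"
    by (simp add: cpoly_op_def bounded_clinearD[OF A])
  finally show ?thesis .
qed

lemma bounded_clinear_cpoly_op: "bounded_clinear A \<Longrightarrow> bounded_clinear (cpoly_op p A)"
  unfolding cpoly_op_def
  by (intro bounded_clinear_sum bounded_clinear_scaleC bounded_clinear_funpow)

lemma cpoly_op_add: "cpoly_op (p + q) A x = cpoly_op p A x + cpoly_op q A x"
proof -
  define n where "n = max (degree p) (degree q)"
  have "degree p \<le> n" "degree q \<le> n" "degree (p + q) \<le> n"
    by (auto simp: n_def degree_add_le)
  then show ?thesis by (simp add: cpoly_op_eq_sum scaleC_add_left sum.distrib)
qed

lemma cpoly_op_smult: "cpoly_op (smult a p) A x = a *\<^sub>C cpoly_op p A x"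
proof -
  have "degree (smult a p) \<le> degree p" by (rule degree_smult_le)
  then have "cpoly_op (smult a p) A x = (\<Sum>i\<le>degree p. coeff (smult a p) i *\<^sub>C (A ^^ i) x)"
    by (rule cpoly_op_eq_sum)
  then show ?thesis by (simp add: cpoly_op_def scaleC.sum_right scaleC_scaleC)
qed

lemma cpoly_op_mult:
  assumes A: "bounded_clinear A"
  shows "cpoly_op (p * q) A x = cpoly_op p A (cpoly_op q A x)"
  by (induction p) (simp_all add: cpoly_op_pCons[OF A] cpoly_op_add cpoly_op_smult)

lemma poly_op_eq_cpoly_op: "poly_op p A = cpoly_op (map_poly of_real p) A"
  by (rule ext) (simp add: poly_op_def cpoly_op_def scaleR_scaleC coeff_map_poly degree_map_poly)

lemma map_poly_of_real_add:
  "map_poly of_real (p + q) = map_poly of_real p + (map_poly of_real q :: complex poly)"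
  by (rule poly_eqI) (simp add: coeff_map_poly)

lemma map_poly_of_real_smult:
  "map_poly of_real (smult a p) = smult (of_real a) (map_poly of_real p :: complex poly)"
  by (rule poly_eqI) (simp add: coeff_map_poly)

lemma map_poly_of_real_mult:
  "map_poly of_real (p * q) = map_poly of_real p * (map_poly of_real q :: complex poly)"
  by (induction p) (simp_all add: map_poly_pCons map_poly_of_real_add map_poly_of_real_smult)

lemma poly_map_poly_of_real: "poly (map_poly of_real p) (of_real t :: complex) = of_real (poly p t)"
  by (induction p) (simp_all add: map_poly_pCons)

lemma bounded_clinear_poly_op: "bounded_clinear A \<Longrightarrow> bounded_clinear (poly_op p A)"
  by (simp add: poly_op_eq_cpoly_op bounded_clinear_cpoly_op)

lemma poly_op_mult:
  "bounded_clinear A \<Longrightarrow> poly_op (p * q) A x = poly_op p A (poly_op q A x)"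
  by (simp add: poly_op_eq_cpoly_op map_poly_of_real_mult cpoly_op_mult)

lemma poly_op_add: "poly_op (p + q) A x = poly_op p A x + poly_op q A x"
  by (simp add: poly_op_eq_cpoly_op map_poly_of_real_add cpoly_op_add)

lemma poly_op_smult: "poly_op (smult a p) A x = a *\<^sub>R poly_op p A x"
  by (simp add: poly_op_eq_cpoly_op map_poly_of_real_smult cpoly_op_smult scaleR_scaleC)

lemma poly_op_diff: "poly_op (p - q) A x = poly_op p A x - poly_op q A x"
  using poly_op_add[of p "smult (-1) q" A x] unfolding poly_op_smult by simp

lemma poly_op_pCons:
  "bounded_clinear A \<Longrightarrow> poly_op (pCons a p) A x = a *\<^sub>R x + A (poly_op p A x)"
  by (simp add: poly_op_eq_cpoly_op map_poly_pCons cpoly_op_pCons scaleR_scaleC)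

lemma poly_op_0 [simp]: "poly_op 0 A x = 0"
  by (simp add: poly_op_def)

lemma poly_op_commute:
  assumes A: "bounded_clinear A"
  shows "poly_op p A (A x) = A (poly_op p A x)"
  by (induction p) (simp_all add: poly_op_pCons[OF A] bounded_clinearD[OF A])

lemma poly_op_self_adjoint:
  assumes A: "positive_op A"
  shows "cinner (poly_op p A x) y = cinner x (poly_op p A y)"
proof (induction p arbitrary: x y)
  case (pCons a p)
  note bA = positive_op_bounded[OF A]
  have "cinner (A (poly_op p A x)) y = cinner x (poly_op p A (A y))"
    by (simp add: positive_op_self_adjoint[OF A] pCons)
  then show ?case
    by (simp add: poly_op_pCons[OF bA] poly_op_commute[OF bA] cinner_add_left cinner_add_right
        cinner_scaleR_left cinner_scaleR_right)
qed simp

text \<open>The numerical range of \<open>A\<close> lies in \<open>[0, \<infinity>)\<close>, so for \<open>z\<close> outside this half-line the Cauchy-Schwarz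
  inequality bounds \<open>\<parallel>(A - z) x\<parallel>\<close> below by the distance of \<open>z\<close> from the real axis or from \<open>0\<close>. For
  \<open>z > \<parallel>A\<parallel>\<close> the triangle inequality does it.\<close>

lemma positive_op_shift_bounded_below:
  assumes A: "positive_op A" and z: "z \<notin> of_real ` {0..onorm A}"
  shows "\<exists>c>0. \<forall>x. c * norm x \<le> norm (A x - z *\<^sub>C x)"
proof -
  note bA = positive_op_bounded[OF A]
  have le: "cmod (cinner (A x - z *\<^sub>C x) x) \<le> norm (A x - z *\<^sub>C x) * norm x" for x
    by (rule cauchy_schwarz)
  have Im_A: "Im (cinner (A x) x) = 0" for x
    using positive_op_self_adjoint[OF A, of x x] cinner_commute[of "A x" x]
    by (metis cnj.simps(2) neg_equal_zero)
  have from_cinner: ?thesis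
    if c: "0 < c" and h: "\<And>x. c * (norm x)\<^sup>2 \<le> cmod (cinner (A x - z *\<^sub>C x) x)" for c
  proof (intro exI conjI allI)
    fix x
    have "c * norm x * norm x \<le> norm (A x - z *\<^sub>C x) * norm x"
      using h[of x] le[of x] by (simp add: power2_eq_square mult.assoc)
    then show "c * norm x \<le> norm (A x - z *\<^sub>C x)"
      by (cases "x = 0") auto
  qed (rule c)
  consider "Im z \<noteq> 0" | "Im z = 0" "Re z < 0" | "Im z = 0" "onorm A < Re z"
  proof -
    have "z = of_real (Re z)" if "Im z = 0" using that by (simp add: complex_eq_iff)
    then have "Re z \<notin> {0..onorm A}" if "Im z = 0" using z that by (metis imageI)
    then show ?thesis using that by fastforce
  qed
  then show ?thesis
  proof cases
    case 1
    show ?thesis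
    proof (rule from_cinner[of "\<bar>Im z\<bar>"])
      fix x
      have "\<bar>Im (cinner (A x - z *\<^sub>C x) x)\<bar> = \<bar>Im z\<bar> * (norm x)\<^sup>2"
        by (simp add: cinner.diff_left cinner_scaleC_left cinner_self Im_A abs_mult)
      then show "\<bar>Im z\<bar> * (norm x)\<^sup>2 \<le> cmod (cinner (A x - z *\<^sub>C x) x)"
        by (metis abs_Im_le_cmod)
    qed (use 1 in simp)
  next
    case 2
    show ?thesis
    proof (rule from_cinner[of "- Re z"])
      fix x
      have "- Re z * (norm x)\<^sup>2 \<le> Re (cinner (A x - z *\<^sub>C x) x)"
        using conjunct2[OF conjunct2[OF A[unfolded positive_op_def]]]
        by (simp add: cinner.diff_left cinner_scaleC_left cinner_self 2)
      then show "- Re z * (norm x)\<^sup>2 \<le> cmod (cinner (A x - z *\<^sub>C x) x)"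
        using complex_Re_le_cmod order_trans by metis
    qed (use 2 in simp)
  next
    case 3
    have "(Re z - onorm A) * norm x \<le> norm (A x - z *\<^sub>C x)" for x
    proof -
      have "z = of_real (Re z)" using 3 by (simp add: complex_eq_iff)
      moreover have "0 \<le> Re z" using 3 onorm_nonneg[OF bA] by simp
      ultimately have "norm (z *\<^sub>C x) = Re z * norm x"
        by (metis norm_scaleC norm_of_real abs_of_nonneg)
      then show ?thesis
        using norm_triangle_ineq2[of "z *\<^sub>C x" "A x"] bounded_clinearD(9)[OF bA, of x]
        by (simp add: norm_minus_commute left_diff_distrib)
    qed
    then show ?thesis using 3 by (intro exI[of _ "Re z - onorm A"]) auto
  qed
qed

text \<open>By the fundamental theorem of algebra \<open>q(A)\<close> is a product of factors \<open>A - z\<close> with \<open>z\<close> outside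
  \<open>[0, \<parallel>A\<parallel>]\<close>, and products of operators that are bounded below are bounded below.\<close>

lemma cpoly_op_bounded_below:
  assumes A: "positive_op A"
    and "\<And>t. t \<in> {0..onorm A} \<Longrightarrow> poly q (of_real t) \<noteq> 0"
  shows "\<exists>c>0. \<forall>x. c * norm x \<le> norm (cpoly_op q A x)"
  using assms(2)
proof (induction "degree q" arbitrary: q)
  case 0
  then obtain a where a: "q = [:a:]" by (metis degree_eq_zeroE)
  moreover have "poly q (of_real 0) \<noteq> 0"
    by (rule 0) (simp add: onorm_nonneg[OF positive_op_bounded[OF A]])
  ultimately have "a \<noteq> 0" by simp
  then show ?case
    by (intro exI[of _ "cmod a"])
      (simp add: a cpoly_op_pCons[OF positive_op_bounded[OF A]] norm_scaleC
        bounded_clinearD(6)[OF positive_op_bounded[OF A]])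
next
  case (Suc n)
  note bA = positive_op_bounded[OF A]
  have "\<not> constant (poly q)" using Suc.hyps(2) by (simp add: constant_degree)
  then obtain z where "poly q z = 0" using fundamental_theorem_of_algebra by blast
  then obtain r where r: "q = [:-z, 1:] * r" by (auto simp: poly_eq_0_iff_dvd elim: dvdE)
  have "r \<noteq> 0" using Suc.hyps(2) r by auto
  then have "degree q = Suc (degree r)" unfolding r by (subst degree_mult_eq) auto
  then have "n = degree r" using Suc.hyps(2) by simp
  then obtain c where c: "0 < c" "\<And>x. c * norm x \<le> norm (cpoly_op r A x)"
    using Suc.hyps(1)[of r] Suc.prems unfolding r by auto
  have "z \<notin> of_real ` {0..onorm A}"
  proof
    assume "z \<in> of_real ` {0..onorm A}"
    then obtain t where "t \<in> {0..onorm A}" "z = of_real t" by blast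
    then show False using Suc.prems[of t] unfolding r by simp
  qed
  from positive_op_shift_bounded_below[OF A this]
  obtain d where d: "0 < d" "\<And>x. d * norm x \<le> norm (A x - z *\<^sub>C x)" by auto
  have "cpoly_op q A x = A (cpoly_op r A x) - z *\<^sub>C cpoly_op r A x" for x
    unfolding r cpoly_op_mult[OF bA]
    by (simp add: cpoly_op_pCons[OF bA] bounded_clinearD[OF bA] scaleC_one scaleC.minus_left)
  then have "d * c * norm x \<le> norm (cpoly_op q A x)" for x
    using d(2)[of "cpoly_op r A x"] mult_left_mono[OF c(2)[of x] less_imp_le[OF d(1)]]
    by (simp only: mult.assoc)
  then show ?case using c(1) d(1) by (intro exI[of _ "d * c"]) auto
qed

text \<open>This estimate takes the place of spectral theory. Put \<open>S = p(A)\<close> and \<open>s = \<parallel>S\<parallel>\<close>. If \<open>p\<^sup>2 - s\<^sup>2\<close> had no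
  zero in \<open>[0, \<parallel>A\<parallel>]\<close>, then \<open>S\<^sup>2 - s\<^sup>2\<close> would be bounded below by some \<open>c > 0\<close>. Expanding
  \<open>\<parallel>S\<^sup>2 x - s\<^sup>2 x\<parallel>\<^sup>2\<close> and using \<open>\<parallel>S\<^sup>2 x\<parallel> \<le> s \<parallel>S x\<parallel>\<close> would then give \<open>\<parallel>S\<parallel>\<^sup>2 \<le> s\<^sup>2 - c\<^sup>2 / s\<^sup>2\<close>, which
  is less than \<open>s\<^sup>2\<close>. Hence \<open>\<bar>p\<bar>\<close> takes the value \<open>s\<close> somewhere on the interval.\<close>

lemma norm_poly_op_le:
  assumes A: "positive_op A" and K: "\<And>t. t \<in> {0..onorm A} \<Longrightarrow> \<bar>poly p t\<bar> \<le> K"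
  shows "norm (poly_op p A x) \<le> K * norm x"
proof -
  note bA = positive_op_bounded[OF A]
  define S where "S = poly_op p A"
  define s where "s = onorm S"
  have bS: "bounded_clinear S" unfolding S_def by (rule bounded_clinear_poly_op[OF bA])
  have s: "norm (S x) \<le> s * norm x" for x unfolding s_def by (rule bounded_clinearD[OF bS])
  have K0: "0 \<le> K" using K[of 0] onorm_nonneg[OF bA] by simp
  have "s \<le> K"
  proof (rule ccontr)
    assume "\<not> s \<le> K"
    then have sK: "K < s" and s0: "0 < s" using K0 by auto
    \<comment> \<open>A polynomial without zeros on \<open>[0, \<parallel>A\<parallel>]\<close>, since \<open>\<bar>p\<bar> \<le> K < s\<close> there.\<close>
    define q where "q = p * p - [:s\<^sup>2:]"
    have "poly q t \<noteq> 0" if "t \<in> {0..onorm A}" for t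
    proof -
      have "\<bar>poly p t\<bar> < s" using K[OF that] sK by simp
      then have "(poly p t)\<^sup>2 < s\<^sup>2" 
        using power_strict_mono[of "\<bar>poly p t\<bar>" s 2] by simp
      then show ?thesis by (simp add: q_def power2_eq_square)
    qed
    then obtain c where c: "0 < c" "\<And>x. c * norm x \<le> norm (poly_op q A x)"
      using cpoly_op_bounded_below[OF A, of "map_poly of_real q"]
      unfolding poly_op_eq_cpoly_op poly_map_poly_of_real by auto
    have q_eq: "poly_op q A x = S (S x) - s\<^sup>2 *\<^sub>R x" for x
      unfolding q_def S_def poly_op_diff poly_op_mult[OF bA]
      by (simp add: poly_op_pCons[OF bA] bounded_clinearD[OF bA])
    have *: "s\<^sup>2 * (norm (S x))\<^sup>2 \<le> (s^4 - c\<^sup>2) * (norm x)\<^sup>2" for x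
    proof -
      have "(c * norm x)\<^sup>2 \<le> (norm (S (S x) - s\<^sup>2 *\<^sub>R x))\<^sup>2"
        using c by (intro power_mono) (auto simp: q_eq[symmetric])
      also have "\<dots> = (norm (S (S x)))\<^sup>2 + s^4 * (norm x)\<^sup>2 - 2 * s\<^sup>2 * (norm (S x))\<^sup>2"
        using poly_op_self_adjoint[OF A, of p "S x" x]
        by (simp add: norm_diff_sq cinner_scaleR_right power_mult_distrib S_def[symmetric]
            cinner_self flip: power_mult)
      also have "(norm (S (S x)))\<^sup>2 \<le> (s * norm (S x))\<^sup>2"
        by (intro power_mono s) auto
      finally show ?thesis by (simp add: power_mult_distrib algebra_simps)
    qed
    \<comment> \<open>The maximum keeps the square root below meaningful.\<close>
    define d where "d = max 0 (s\<^sup>2 - c\<^sup>2 / s\<^sup>2)"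
    have "norm (S x) \<le> sqrt d * norm x" for x
    proof -
      have "(norm (S x))\<^sup>2 \<le> (s\<^sup>2 - c\<^sup>2 / s\<^sup>2) * (norm x)\<^sup>2"
        using *[of x] s0 by (simp add: field_simps power4_eq_xxxx power2_eq_square)
      also have "\<dots> \<le> d * (norm x)\<^sup>2"
        unfolding d_def by (intro mult_right_mono) auto
      also have "\<dots> = (sqrt d * norm x)\<^sup>2"
        by (simp add: power_mult_distrib d_def)
      finally show ?thesis by (rule power2_le_imp_le) (simp add: d_def)
    qed
    then have "s \<le> sqrt d" unfolding s_def by (intro onorm_bound) (auto simp: d_def)
    then have "s\<^sup>2 \<le> d" using s0 by (simp add: d_def real_le_rsqrt sqrt_ge_absD)
    moreover have "0 < c\<^sup>2 / s\<^sup>2" "0 < s\<^sup>2" using c s0 by auto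
    ultimately show False unfolding d_def by linarith
  qed
  then show ?thesis using s[of x] mult_right_mono[of s K "norm x"] by (simp add: S_def)
qed

section \<open>The continuous functional calculus and powers\<close>

lemma polynomial_approximation:
  fixes f :: "real \<Rightarrow> real"
  assumes "continuous_on {0..M} f"
  shows "\<exists>p. uniform_limit {0..M} (\<lambda>n t. poly (p n) t) f sequentially"
proof -
  have "\<exists>p. \<forall>t\<in>{0..M}. \<bar>f t - poly p t\<bar> < 1 / real (Suc n)" for n
  proof -
    obtain g where g: "real_polynomial_function g" "\<And>t. t \<in> {0..M} \<Longrightarrow> \<bar>f t - g t\<bar> < 1 / real (Suc n)"
      using Stone_Weierstrass_real_polynomial_function[of "{0..M}" f "1 / real (Suc n)"] assms by auto
    obtain a m where "g = (\<lambda>t. \<Sum>i\<le>m. a i * t ^ i)"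
      using g(1) real_polynomial_function_iff_sum by blast
    then have "g t = poly (\<Sum>i\<le>m. monom (a i) i) t" for t
      by (simp add: poly_sum poly_monom)
    then show ?thesis using g(2) by metis
  qed
  then obtain p where p: "\<And>n t. t \<in> {0..M} \<Longrightarrow> \<bar>f t - poly (p n) t\<bar> < 1 / real (Suc n)" by metis
  have "uniform_limit {0..M} (\<lambda>n t. poly (p n) t) f sequentially"
  proof (rule uniform_limitI)
    fix e :: real assume "0 < e"
    then obtain N where N: "1 / real (Suc N) < e" by (rule nat_approx_posE)
    have "dist (poly (p n) t) (f t) < e" if "N \<le> n" "t \<in> {0..M}" for n t
    proof -
      have "1 / real (Suc n) \<le> 1 / real (Suc N)" using that by (simp add: frac_le)
      then show ?thesis using p[OF that(2), of n] N by (simp add: dist_real_def abs_minus_commute)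
    qed
    then show "\<forall>\<^sub>F n in sequentially. \<forall>t\<in>{0..M}. dist (poly (p n) t) (f t) < e"
      unfolding eventually_sequentially by blast
  qed
  then show ?thesis by blast
qed

text \<open>By the norm estimate, polynomials that converge uniformly on \<open>[0, \<parallel>A\<parallel>]\<close> give a Cauchy sequence in the
  Banach space of bounded operators, and two sequences with the same limit function have the same
  limit operator.\<close>

lemma fun_calc_ex:
  fixes A :: "'a::chilbert_space \<Rightarrow> 'a"
  assumes A: "positive_op A" and f: "continuous_on {0..onorm A} f"
  shows "\<exists>T. bounded_clinear T \<and>
     (\<forall>p. uniform_limit {0..onorm A} (\<lambda>n t. poly (p n) t) f sequentially \<longrightarrow>
          (\<lambda>n. onorm (\<lambda>x. poly_op (p n) A x - T x)) \<longlonglongrightarrow> 0)"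
proof -
  note bA = positive_op_bounded[OF A]
  define I where "I = {0..onorm A}"
  define U where "U p = Blinfun (poly_op p A)" for p
  have U: "blinfun_apply (U p) = poly_op p A" for p
    unfolding U_def by (rule bounded_linear_Blinfun_apply[OF bounded_clinearD(1)[OF bounded_clinear_poly_op[OF bA]]])
  have I0: "0 \<in> I" using onorm_nonneg[OF bA] by (simp add: I_def)
  have norm_U: "norm (U p - U q) \<le> K" if "\<And>t. t \<in> I \<Longrightarrow> \<bar>poly p t - poly q t\<bar> \<le> K" for p q K
  proof (rule norm_blinfun_bound)
    show "0 \<le> K" using that[OF I0] by simp
    show "norm (blinfun_apply (U p - U q) x) \<le> K * norm x" for x
      using norm_poly_op_le[OF A, of "p - q" K x] that
      by (simp add: blinfun.diff_left U poly_op_diff I_def)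
  qed
  have close: "\<exists>N. \<forall>m\<ge>N. \<forall>n\<ge>N. norm (U (p m) - U (q n)) < e"
    if p: "uniform_limit I (\<lambda>n t. poly (p n) t) f sequentially"
      and q: "uniform_limit I (\<lambda>n t. poly (q n) t) f sequentially" and e: "0 < e" for p q e
  proof -
    have "0 < e / 4" using e by simp
    then obtain N1 N2 where N: "\<And>n t. n \<ge> N1 \<Longrightarrow> t \<in> I \<Longrightarrow> dist (poly (p n) t) (f t) < e / 4"
      "\<And>n t. n \<ge> N2 \<Longrightarrow> t \<in> I \<Longrightarrow> dist (poly (q n) t) (f t) < e / 4"
      using p q unfolding uniform_limit_sequentially_iff by metis
    have "norm (U (p m) - U (q n)) < e" if "max N1 N2 \<le> m" "max N1 N2 \<le> n" for m n
    proof -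
      have "norm (U (p m) - U (q n)) \<le> e / 2"
      proof (rule norm_U)
        fix t assume "t \<in> I"
        then have "dist (poly (p m) t) (f t) < e / 4" "dist (poly (q n) t) (f t) < e / 4"
          using N that by auto
        then show "\<bar>poly (p m) t - poly (q n) t\<bar> \<le> e / 2"
          unfolding dist_real_def by linarith
      qed
      then show ?thesis using e by simp
    qed
    then show ?thesis by blast
  qed
  obtain p where p: "uniform_limit I (\<lambda>n t. poly (p n) t) f sequentially"
    using polynomial_approximation[OF f] unfolding I_def by blast
  have "Cauchy (\<lambda>n. U (p n))"
    using close[OF p p] by (auto simp: Cauchy_def dist_norm)
  then obtain L where L: "(\<lambda>n. U (p n)) \<longlonglongrightarrow> L" using convergent_eq_Cauchy by blast
  have conv: "(\<lambda>n. U (q n)) \<longlonglongrightarrow> L"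
    if q: "uniform_limit I (\<lambda>n t. poly (q n) t) f sequentially" for q
  proof -
    have "(\<lambda>n. U (q n) - U (p n)) \<longlonglongrightarrow> 0"
      using close[OF q p] by (intro LIMSEQ_I) fastforce
    from tendsto_add[OF this L] show ?thesis by simp
  qed
  show ?thesis
  proof (intro exI conjI allI impI)
    have "blinfun_apply L (c *\<^sub>C x) = c *\<^sub>C blinfun_apply L x" for c x
    proof (rule LIMSEQ_unique)
      show "(\<lambda>n. blinfun_apply (U (p n)) (c *\<^sub>C x)) \<longlonglongrightarrow> blinfun_apply L (c *\<^sub>C x)"
        by (intro tendsto_intros L)
      have "(\<lambda>n. c *\<^sub>C blinfun_apply (U (p n)) x) \<longlonglongrightarrow> c *\<^sub>C blinfun_apply L x"
        by (intro tendsto_intros scaleC.tendsto L)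
      then show "(\<lambda>n. blinfun_apply (U (p n)) (c *\<^sub>C x)) \<longlonglongrightarrow> c *\<^sub>C blinfun_apply L x"
        by (simp add: U bounded_clinearD[OF bounded_clinear_poly_op[OF bA]])
    qed
    then show "bounded_clinear (blinfun_apply L)"
      by (simp add: bounded_clinear_def blinfun.bounded_linear_right)
    fix q assume "uniform_limit {0..onorm A} (\<lambda>n t. poly (q n) t) f sequentially"
    then have "(\<lambda>n. U (q n) - L) \<longlonglongrightarrow> 0" using conv I_def LIM_zero by blast
    then have "(\<lambda>n. norm (U (q n) - L)) \<longlonglongrightarrow> 0" by (rule tendsto_norm_zero)
    moreover have "norm (U (q n) - L) = onorm (\<lambda>x. poly_op (q n) A x - blinfun_apply L x)" for n
      by (simp add: norm_blinfun.rep_eq minus_blinfun.rep_eq U)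
    ultimately show "(\<lambda>n. onorm (\<lambda>x. poly_op (q n) A x - blinfun_apply L x)) \<longlonglongrightarrow> 0" by simp
  qed
qed

lemma tendsto_if_onorm_tendsto:
  assumes "\<And>n. bounded_clinear (U n)" "bounded_clinear T"
    and "(\<lambda>n. onorm (\<lambda>x. U n x - T x)) \<longlonglongrightarrow> 0"
  shows "(\<lambda>n. U n x) \<longlonglongrightarrow> T x"
proof -
  have "norm (U n x - T x) \<le> onorm (\<lambda>x. U n x - T x) * norm x" for n
    by (rule bounded_clinearD(9)[OF bounded_clinear_diff[OF assms(1,2)]])
  moreover have "(\<lambda>n. onorm (\<lambda>x. U n x - T x) * norm x) \<longlonglongrightarrow> 0"
    using tendsto_mult_left_zero[OF assms(3)] .
  ultimately have "(\<lambda>n. U n x - T x) \<longlonglongrightarrow> 0"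
    by (rule Lim_null_comparison[OF always_eventually[OF allI]])
  then show ?thesis by (simp add: LIM_zero_iff)
qed

lemma fun_calc:
  assumes A: "positive_op A" and f: "continuous_on {0..onorm A} f"
  shows bounded_clinear_fun_calc: "bounded_clinear (fun_calc f A)"
    and fun_calc_tendsto: "uniform_limit {0..onorm A} (\<lambda>n t. poly (p n) t) f sequentially
      \<Longrightarrow> (\<lambda>n. poly_op (p n) A x) \<longlonglongrightarrow> fun_calc f A x"
proof -
  note bp = bounded_clinear_poly_op[OF positive_op_bounded[OF A]]
  let ?P = "\<lambda>T. bounded_clinear T \<and>
     (\<forall>p. uniform_limit {0..onorm A} (\<lambda>n t. poly (p n) t) f sequentially \<longrightarrow>
          (\<lambda>n. onorm (\<lambda>x. poly_op (p n) A x - T x)) \<longlonglongrightarrow> 0)"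
  obtain T where T: "?P T" using fun_calc_ex[OF A f] by blast
  obtain q where q: "uniform_limit {0..onorm A} (\<lambda>n t. poly (q n) t) f sequentially"
    using polynomial_approximation[OF f] by blast
  have "fun_calc f A = T"
    unfolding fun_calc_def
  proof (rule the_equality[of ?P])
    fix T' assume T': "?P T'"
    show "T' = T"
    proof
      fix x
      have "(\<lambda>n. poly_op (q n) A x) \<longlonglongrightarrow> T x" "(\<lambda>n. poly_op (q n) A x) \<longlonglongrightarrow> T' x"
        using T T' q by (blast intro: tendsto_if_onorm_tendsto[OF bp])+
      then show "T' x = T x" using LIMSEQ_unique by blast
    qed
  qed (rule T)
  with T have "?P (fun_calc f A)" by simp
  then show "bounded_clinear (fun_calc f A)"
    and "uniform_limit {0..onorm A} (\<lambda>n t. poly (p n) t) f sequentially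
      \<Longrightarrow> (\<lambda>n. poly_op (p n) A x) \<longlonglongrightarrow> fun_calc f A x"
    by (blast intro: tendsto_if_onorm_tendsto[OF bp])+
qed

lemma fun_calc_cong:
  assumes "\<And>t. t \<in> {0..onorm A} \<Longrightarrow> f t = g t"
  shows "fun_calc f A = fun_calc g A"
proof -
  have "uniform_limit {0..onorm A} h f sequentially \<longleftrightarrow> uniform_limit {0..onorm A} h g sequentially" for h
    using assms by (simp add: uniform_limit_iff)
  then show ?thesis unfolding fun_calc_def by presburger
qed

lemma fun_calc_self_adjoint:
  assumes A: "positive_op A" and f: "continuous_on {0..onorm A} f"
  shows "cinner (fun_calc f A x) y = cinner x (fun_calc f A y)"
proof -
  obtain q where q: "uniform_limit {0..onorm A} (\<lambda>n t. poly (q n) t) f sequentially"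
    using polynomial_approximation[OF f] by blast
  note lim = fun_calc_tendsto[OF A f q]
  have "(\<lambda>n. cinner (poly_op (q n) A x) y) \<longlonglongrightarrow> cinner (fun_calc f A x) y"
    by (intro cinner.tendsto lim tendsto_const)
  moreover have "(\<lambda>n. cinner x (poly_op (q n) A y)) \<longlonglongrightarrow> cinner x (fun_calc f A y)"
    by (intro cinner.tendsto lim tendsto_const)
  ultimately show ?thesis
    unfolding poly_op_self_adjoint[OF A] using LIMSEQ_unique by blast
qed

text \<open>The identity is tested against a vector \<open>y\<close>: moving \<open>p\<^sub>n(A)\<close> to the other side by self-adjointness
  leaves the inner product of two convergent sequences of vectors.\<close>

lemma fun_calc_mult:
  assumes A: "positive_op A" and f: "continuous_on {0..onorm A} f" and g: "continuous_on {0..onorm A} g"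
  shows "fun_calc (\<lambda>t. f t * g t) A x = fun_calc f A (fun_calc g A x)"
proof (rule cinner_ext)
  fix y
  note bA = positive_op_bounded[OF A]
  have fg: "continuous_on {0..onorm A} (\<lambda>t. f t * g t)" by (intro continuous_intros f g)
  obtain p where p: "uniform_limit {0..onorm A} (\<lambda>n t. poly (p n) t) f sequentially"
    using polynomial_approximation[OF f] by blast
  obtain q where q: "uniform_limit {0..onorm A} (\<lambda>n t. poly (q n) t) g sequentially"
    using polynomial_approximation[OF g] by blast
  have "uniform_limit {0..onorm A} (\<lambda>n t. poly (p n) t * poly (q n) t) (\<lambda>t. f t * g t) sequentially"
    by (intro uniform_lim_mult p q compact_imp_bounded compact_continuous_image f g) auto
  then have pq: "uniform_limit {0..onorm A} (\<lambda>n t. poly (p n * q n) t) (\<lambda>t. f t * g t) sequentially"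
    by simp
  have "(\<lambda>n. cinner y (poly_op (p n * q n) A x)) \<longlonglongrightarrow> cinner y (fun_calc (\<lambda>t. f t * g t) A x)"
    by (intro cinner.tendsto fun_calc_tendsto[OF A fg pq] tendsto_const)
  moreover have "(\<lambda>n. cinner (poly_op (p n) A y) (poly_op (q n) A x))
      \<longlonglongrightarrow> cinner (fun_calc f A y) (fun_calc g A x)"
    by (intro cinner.tendsto fun_calc_tendsto[OF A f p] fun_calc_tendsto[OF A g q])
  ultimately show "cinner y (fun_calc (\<lambda>t. f t * g t) A x) = cinner y (fun_calc f A (fun_calc g A x))"
    unfolding poly_op_mult[OF bA] poly_op_self_adjoint[OF A] fun_calc_self_adjoint[OF A f]
    using LIMSEQ_unique by blast
qed

lemma fun_calc_ident:
  assumes A: "positive_op A"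
  shows "fun_calc (\<lambda>t. t) A = A"
proof
  fix x
  note bA = positive_op_bounded[OF A]
  have "(\<lambda>n::nat. poly_op [:0, 1:] A x) \<longlonglongrightarrow> fun_calc (\<lambda>t. t) A x"
    by (rule fun_calc_tendsto[OF A]) (auto intro!: uniform_limitI continuous_intros)
  then show "fun_calc (\<lambda>t. t) A x = A x"
    by (simp add: LIMSEQ_const_iff poly_op_pCons[OF bA] bounded_clinearD[OF bA])
qed

lemma norm_fun_calc_le:
  assumes A: "positive_op A" and f: "continuous_on {0..onorm A} f"
    and K: "\<And>t. t \<in> {0..onorm A} \<Longrightarrow> \<bar>f t\<bar> \<le> K"
  shows "norm (fun_calc f A x) \<le> K * norm x"
proof -
  obtain q where q: "uniform_limit {0..onorm A} (\<lambda>n t. poly (q n) t) f sequentially"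
    using polynomial_approximation[OF f] by blast
  have e: "norm (fun_calc f A x) \<le> (K + e) * norm x" if "0 < e" for e
  proof (rule Lim_norm_ubound[OF _ fun_calc_tendsto[OF A f q]])
    have "\<forall>\<^sub>F n in sequentially. \<forall>t\<in>{0..onorm A}. dist (poly (q n) t) (f t) < e"
      by (rule uniform_limitD[OF q that])
    then show "\<forall>\<^sub>F n in sequentially. norm (poly_op (q n) A x) \<le> (K + e) * norm x"
    proof eventually_elim
      case (elim n)
      show ?case
        by (rule norm_poly_op_le[OF A]) (use elim K in \<open>force simp: dist_real_def\<close>)
    qed
  qed simp
  have "((\<lambda>e. (K + e) * norm x) \<longlongrightarrow> (K + 0) * norm x) (at_right 0)"
    by (intro tendsto_intros)
  then have "norm (fun_calc f A x) \<le> (K + 0) * norm x"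
    by (rule tendsto_lowerbound) (use e in \<open>auto simp: eventually_at_filter\<close>)
  then show ?thesis by simp
qed

lemma continuous_on_powr_nonneg: "0 < r \<Longrightarrow> continuous_on {0..M} (\<lambda>t::real. t powr r)"
  by (intro continuous_on_powr' continuous_intros) auto

lemma op_powr_0 [simp]: "op_powr A 0 x = x"
  by (simp add: op_powr_def)

lemma op_powr_1: "positive_op A \<Longrightarrow> op_powr A 1 = A"
  using fun_calc_cong[of A "\<lambda>t. t powr 1" "\<lambda>t. t"] by (simp add: op_powr_def fun_calc_ident)

lemma op_powr_add:
  assumes A: "positive_op A" and "0 \<le> r" "0 \<le> s"
  shows "op_powr A (r + s) x = op_powr A r (op_powr A s x)"
proof (cases "r = 0 \<or> s = 0")
  case False
  then have "0 < r" "0 < s" using assms by auto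
  then show ?thesis
    using fun_calc_mult[OF A continuous_on_powr_nonneg[OF \<open>0 < r\<close>] continuous_on_powr_nonneg[OF \<open>0 < s\<close>]]
    by (simp add: op_powr_def powr_add)
qed auto

lemma positive_op_op_powr:
  assumes A: "positive_op A" and r: "0 \<le> r"
  shows "positive_op (op_powr A r)"
proof (cases "r = 0")
  case True
  then show ?thesis
    by (simp add: op_powr_def positive_op_def id_def bounded_clinear_id cinner_ge_zero)
next
  case False
  then have r: "0 < r" "0 < r / 2" using r by auto
  have sa: "cinner (op_powr A s x) y = cinner x (op_powr A s y)" if "0 < s" for s x y
    using that fun_calc_self_adjoint[OF A continuous_on_powr_nonneg] by (simp add: op_powr_def)
  have "0 \<le> Re (cinner (op_powr A r x) x)" for x
  proof -
    have "op_powr A r x = op_powr A (r/2) (op_powr A (r/2) x)"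
      using op_powr_add[OF A, of "r/2" "r/2" x] r by simp
    then have "cinner (op_powr A r x) x = cinner (op_powr A (r/2) x) (op_powr A (r/2) x)"
      using sa[OF r(2)] by simp
    then show ?thesis by (simp add: cinner_ge_zero)
  qed
  moreover have "bounded_clinear (op_powr A r)"
    using r bounded_clinear_fun_calc[OF A continuous_on_powr_nonneg] by (simp add: op_powr_def)
  ultimately show ?thesis by (simp add: positive_op_def sa[OF r(1)])
qed

lemma norm_op_powr_le:
  assumes A: "positive_op A" and r: "0 \<le> r" "r \<le> 1"
  shows "norm (op_powr A r x) \<le> max 1 (onorm A) * norm x"
proof (cases "r = 0")
  case True
  then show ?thesis using mult_right_mono[of 1 "max 1 (onorm A)" "norm x"] by simp
next
  case False
  have "\<bar>t powr r\<bar> \<le> max 1 (onorm A)" if t: "t \<in> {0..onorm A}" for t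
  proof (cases "t \<le> 1")
    case True
    then show ?thesis using t r powr_le_one_le powr_le1[of r t] by (simp add: le_max_iff_disj)
  next
    case False
    then have "t powr r \<le> t powr 1" using r by (intro powr_mono) auto
    then show ?thesis using t by auto
  qed
  then show ?thesis
    using False r norm_fun_calc_le[OF A continuous_on_powr_nonneg] by (simp add: op_powr_def)
qed

lemma op_abs:
  assumes A: "bounded_clinear A"
  shows positive_op_op_abs: "positive_op (op_abs A)"
    and op_abs_op_abs: "op_abs A (op_abs A x) = cadjoint A (A x)"
proof -
  note P = positive_op_cadjoint_comp[OF A]
  show "positive_op (op_abs A)"
    unfolding op_abs_def by (rule positive_op_op_powr[OF P]) simp
  show "op_abs A (op_abs A x) = cadjoint A (A x)"
    using op_powr_add[OF P, of "1/2" "1/2" x] by (simp add: op_abs_def op_powr_1[OF P])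
qed

section \<open>The direct sum of two Hilbert spaces\<close>

text \<open>On the direct sum the singular values of an operator \<open>Y\<close> become eigenvalues: if \<open>Y p = s q\<close> and
  \<open>Y\<^sup>* q = s p\<close>, then \<open>(q, p)\<close> is an eigenvector of \<open>(a, b) \<mapsto> (Y b, Y\<^sup>* a)\<close> for the eigenvalue \<open>s\<close>.
  This reduces statements about a general \<open>X\<close> and two operators \<open>A\<close>, \<open>B\<close> to eigenvalue arguments.\<close>

instantiation prod :: (chilbert_space, chilbert_space) chilbert_space
begin

definition scaleC_prod :: "complex \<Rightarrow> 'a \<times> 'b \<Rightarrow> 'a \<times> 'b" where
  "scaleC_prod c x = (c *\<^sub>C fst x, c *\<^sub>C snd x)"

definition cinner_prod :: "'a \<times> 'b \<Rightarrow> 'a \<times> 'b \<Rightarrow> complex" where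
  "cinner_prod x y = cinner (fst x) (fst y) + cinner (snd x) (snd y)"

instance
proof
  fix c d :: complex and r :: real and x y z :: "'a \<times> 'b"
  show "c *\<^sub>C (x + y) = c *\<^sub>C x + c *\<^sub>C y" by (simp add: scaleC_prod_def scaleC_add_right)
  show "(c + d) *\<^sub>C x = c *\<^sub>C x + d *\<^sub>C x" by (simp add: scaleC_prod_def scaleC_add_left)
  show "c *\<^sub>C d *\<^sub>C x = (c * d) *\<^sub>C x" by (simp add: scaleC_prod_def scaleC_scaleC)
  show "1 *\<^sub>C x = x" by (simp add: scaleC_prod_def scaleC_one)
  show "r *\<^sub>R x = complex_of_real r *\<^sub>C x"
    by (simp add: scaleC_prod_def scaleR_prod_def scaleR_scaleC)
  show "cinner x y = cnj (cinner y x)"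
    unfolding cinner_prod_def complex_cnj_add by (simp only: cinner_commute[symmetric])
  show "cinner (x + y) z = cinner x z + cinner y z" by (simp add: cinner_prod_def cinner_add_left)
  show "cinner (c *\<^sub>C x) y = c * cinner x y"
    by (simp add: cinner_prod_def scaleC_prod_def cinner_scaleC_left distrib_left)
  show "0 \<le> Re (cinner x x)" by (simp add: cinner_prod_def cinner_ge_zero)
  show "cinner x x = 0 \<longleftrightarrow> x = 0"
  proof
    assume "cinner x x = 0"
    then have "Re (cinner x x) = 0" by simp
    then have "(norm (fst x))\<^sup>2 + (norm (snd x))\<^sup>2 = 0" by (simp add: cinner_prod_def Re_cinner_self)
    then show "x = 0" by (simp add: sum_power2_eq_zero_iff prod_eq_iff)
  qed (simp add: cinner_prod_def)
  show "norm x = sqrt (Re (cinner x x))" by (simp add: cinner_prod_def Re_cinner_self norm_prod_def)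
qed

end

lemma norm_Pair_sq: "(norm (x, y))\<^sup>2 = (norm x)\<^sup>2 + (norm y)\<^sup>2"
  by (simp add: norm_Pair)

section \<open>Orthonormal and Bessel systems\<close>

text \<open>Zero vectors are admitted, so that the singular vectors of an operator of finite rank can be indexed
  by all natural numbers.\<close>

definition orthosys :: "(nat \<Rightarrow> 'a::chilbert_space) \<Rightarrow> bool" where
  "orthosys e \<longleftrightarrow> (\<forall>i j. cinner (e i) (e j) = of_bool (i = j \<and> e i \<noteq> 0))"

text \<open>Bessel's inequality, taken as a definition. In contrast to orthonormality it is preserved by contractions.\<close>

definition bessel :: "(nat \<Rightarrow> 'a::chilbert_space) \<Rightarrow> bool" where
  "bessel e \<longleftrightarrow> (\<forall>h k. (\<Sum>i<k. (cmod (cinner (e i) h))\<^sup>2) \<le> (norm h)\<^sup>2)"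

definition residual :: "(nat \<Rightarrow> 'a::chilbert_space) \<Rightarrow> nat \<Rightarrow> 'a \<Rightarrow> 'a" where
  "residual e k x = x - (\<Sum>i<k. cinner x (e i) *\<^sub>C e i)"

lemma orthosysD: "orthosys e \<Longrightarrow> cinner (e i) (e j) = of_bool (i = j \<and> e i \<noteq> 0)"
  by (simp add: orthosys_def)

lemma orthosys_norm_le_1: "orthosys e \<Longrightarrow> norm (e i) \<le> 1"
  using orthosysD[of e i i] Re_cinner_self[of "e i"] by (cases "e i = 0") (auto simp: power2_eq_1_iff)

lemma cinner_orthosys_sum:
  assumes "orthosys e" "j < k"
  shows "cinner (\<Sum>i<k. c i *\<^sub>C e i) (e j) = (if e j = 0 then 0 else c j)"
proof -
  have "cinner (\<Sum>i<k. c i *\<^sub>C e i) (e j) = (\<Sum>i<k. if i = j then (if e j = 0 then 0 else c j) else 0)"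
    unfolding cinner.sum_left
    by (rule sum.cong) (auto simp: cinner_scaleC_left orthosysD[OF assms(1)])
  then show ?thesis using assms(2) by simp
qed

lemma residual_orthogonal:
  assumes "orthosys e" "j < k"
  shows "cinner (residual e k x) (e j) = 0"
  by (simp add: residual_def cinner.diff_left cinner_orthosys_sum[OF assms])

lemma norm_orthosys_sum_le:
  assumes "orthosys e"
  shows "(norm (\<Sum>i<k. c i *\<^sub>C e i))\<^sup>2 \<le> (\<Sum>i<k. (cmod (c i))\<^sup>2)"
proof -
  have "(norm (\<Sum>i<k. c i *\<^sub>C e i))\<^sup>2 = (\<Sum>i<k. Re (cnj (c i) * (if e i = 0 then 0 else c i)))"
    unfolding Re_cinner_self[symmetric] cinner.sum_right Re_sum
    by (rule sum.cong) (simp_all add: cinner_scaleC_right cinner_orthosys_sum[OF assms])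
  also have "\<dots> \<le> (\<Sum>i<k. (cmod (c i))\<^sup>2)"
    by (rule sum_mono) (auto simp: cmod_power2 power2_eq_square[symmetric])
  finally show ?thesis .
qed

lemma norm_residual_sq:
  assumes "orthosys e"
  shows "(norm x)\<^sup>2 = (norm (residual e k x))\<^sup>2 + (\<Sum>i<k. (cmod (cinner x (e i)))\<^sup>2)"
proof -
  define s where "s = (\<Sum>i<k. cinner x (e i) *\<^sub>C e i)"
  have "cinner (residual e k x) s = 0"
    unfolding s_def cinner.sum_right
    by (rule sum.neutral) (simp add: cinner_scaleC_right residual_orthogonal[OF assms])
  then have "(norm (residual e k x + s))\<^sup>2 = (norm (residual e k x))\<^sup>2 + (norm s)\<^sup>2"
    by (simp add: norm_add_sq)
  moreover have "residual e k x + s = x" by (simp add: residual_def s_def)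
  moreover have "(norm s)\<^sup>2 = (\<Sum>i<k. (cmod (cinner x (e i)))\<^sup>2)"
    unfolding Re_cinner_self[symmetric]
    by (subst (2) s_def, unfold cinner.sum_right Re_sum, rule sum.cong)
      (auto simp: s_def cinner_scaleC_right cinner_orthosys_sum[OF assms] cmod_power2
        power2_eq_square[symmetric])
  ultimately show ?thesis by simp
qed

lemma bessel_if_orthosys: "orthosys e \<Longrightarrow> bessel e"
  unfolding bessel_def
  by (metis (no_types, lifting) cmod_cinner_commute norm_residual_sq sum.cong le_add_same_cancel2
      zero_le_power2)

lemma bessel_norm_le_1:
  assumes "bessel e"
  shows "norm (e i) \<le> 1"
proof -
  have "(cmod (cinner (e i) (e i)))\<^sup>2 \<le> (\<Sum>j<Suc i. (cmod (cinner (e j) (e i)))\<^sup>2)"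
    by (rule member_le_sum) auto
  also have "\<dots> \<le> (norm (e i))\<^sup>2" using assms by (simp add: bessel_def del: sum.lessThan_Suc)
  finally have "((norm (e i))\<^sup>2)\<^sup>2 \<le> (norm (e i))\<^sup>2 * 1" by (simp add: cinner_self norm_power)
  then have "e i \<noteq> 0 \<Longrightarrow> (norm (e i))\<^sup>2 \<le> 1"
    unfolding power2_eq_square[of "(norm (e i))\<^sup>2"]
    by (rule mult_left_le_imp_le) auto
  then show ?thesis by (cases "e i = 0") (auto simp: power_le_one_iff)
qed

text \<open>The Gram-Schmidt process applied to eigenvectors. The spans of the initial segments are invariant
  under \<open>T\<close>, so the matrix of \<open>T\<close> in the new basis is triangular, and its diagonal carries the
  eigenvalues although \<open>T\<close> need not be normal.\<close>

lemma orthonormal_triangularisation: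
  fixes T :: "'a::chilbert_space \<Rightarrow> 'a"
  assumes T: "bounded_clinear T" and w: "\<And>i. i < r \<Longrightarrow> T (w i) = \<sigma> i *\<^sub>R w i"
    and indep: "\<And>i. i < r \<Longrightarrow> w i \<notin> cvec.span (w ` {..<i})"
  shows "\<exists>e. orthosys e \<and> (\<forall>i\<ge>r. e i = 0) \<and> (\<forall>i<r. cinner (T (e i)) (e i) = of_real (\<sigma> i)) \<and>
    cvec.span (e ` {..<r}) = cvec.span (w ` {..<r})"
  using w indep
proof (induction r)
  case 0
  show ?case by (intro exI[of _ "\<lambda>_. 0"]) (simp add: orthosys_def)
next
  case (Suc r)
  then obtain e where e: "orthosys e" "\<And>i. i \<ge> r \<Longrightarrow> e i = 0"
    "\<And>i. i < r \<Longrightarrow> cinner (T (e i)) (e i) = of_real (\<sigma> i)"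
    "cvec.span (e ` {..<r}) = cvec.span (w ` {..<r})"
    by (metis less_Suc_eq)
  define u where "u = residual e r (w r)"
  define v where "v = (1 / norm u) *\<^sub>R u"
  define V where "V = cvec.span (e ` {..<r})"
  have e_V: "e j \<in> V" if "j < r" for j using that by (auto simp: V_def intro: cvec.span_base)
  have sum_V: "(\<Sum>i<r. c i *\<^sub>C e i) \<in> V" for c
    unfolding V_def by (intro cvec.span_sum cvec.span_scale cvec.span_base) auto
  have w_eq: "w r = u + (\<Sum>i<r. cinner (w r) (e i) *\<^sub>C e i)" by (simp add: u_def residual_def)
  have "u \<noteq> 0"
  proof
    assume "u = 0"
    then have "w r \<in> V" using sum_V w_eq by (metis add.left_neutral)
    then show False using Suc.prems(2)[of r] by (simp add: V_def e(4))
  qed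
  then have nu: "0 < norm u" by simp
  have v: "v \<noteq> 0" "cinner v v = 1" using nu by (auto simp: v_def cinner_self)
  have orth: "cinner x v = 0" if "x \<in> V" for x
  proof -
    have "cinner x u = 0"
      using that unfolding V_def
    proof (induction rule: cvec.span_induct_alt)
      case (step c x y)
      then obtain j where "j < r" "x = e j" by auto
      then have "cinner x u = 0"
        using residual_orthogonal[OF e(1), of j r "w r"] cinner_commute[of x u] by (simp add: u_def)
      then show ?case using step by (simp add: cinner_add_left cinner_scaleC_left)
    qed simp
    then show ?thesis by (simp add: v_def cinner_scaleR_right)
  qed
  have T_V: "T x \<in> V" if "x \<in> V" for x
    using that unfolding V_def e(4)
  proof (induction rule: cvec.span_induct_alt)
    case base
    show ?case by (simp add: bounded_clinearD(6)[OF T] cvec.span_zero)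
  next
    case (step c x y)
    then obtain j where j: "j < r" "x = w j" by auto
    have "T (c *\<^sub>C x + y) = (c * of_real (\<sigma> j)) *\<^sub>C x + T y"
      using j Suc.prems(1)[of j] by (simp add: bounded_clinearD[OF T] scaleR_scaleC scaleC_scaleC)
    then show ?case using step by (simp add: cvec.span_add cvec.span_scale cvec.span_base)
  qed
  define f where "f = e(r := v)"
  have f_e: "f i = e i" if "i < r" for i using that by (simp add: f_def)
  have "cinner (e i) v = 0 \<and> cinner v (e i) = 0" for i
    using orth[OF e_V] e(2)[of i] cinner_commute[of v "e i"] by (cases "i < r") auto
  then have "orthosys f"
    using e(1) v by (auto simp: orthosys_def f_def)
  moreover have "cinner (T (f i)) (f i) = of_real (\<sigma> i)" if i: "i < Suc r" for i
  proof (cases "i = r")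
    case False
    then show ?thesis using e(3)[of i] i by (simp add: f_def)
  next
    case True
    have "T u = \<sigma> r *\<^sub>R w r - T (\<Sum>i<r. cinner (w r) (e i) *\<^sub>C e i)"
      using Suc.prems(1)[of r] w_eq by (metis add_diff_cancel_right' bounded_clinearD(4)[OF T] lessI)
    moreover have "cinner (w r) v = norm u"
    proof -
      have "cinner (w r) v = cinner u v"
        by (subst w_eq) (simp only: cinner_add_left orth[OF sum_V] add_0_right)
      then show ?thesis
        using nu by (simp add: v_def cinner_scaleR_right cinner_self power2_eq_square)
    qed
    ultimately have "cinner (T u) v = of_real (\<sigma> r * norm u)"
      by (simp add: cinner.diff_left orth[OF T_V[OF sum_V]] cinner_scaleR_left)
    then show ?thesis
      using nu True by (simp add: f_def v_def bounded_clinearD[OF T] cinner_scaleR_left)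
  qed
  moreover have "cvec.span (f ` {..<Suc r}) = cvec.span (w ` {..<Suc r})"
  proof
    have u_w: "u \<in> cvec.span (w ` {..<Suc r})"
    proof -
      have "V \<subseteq> cvec.span (w ` {..<Suc r})"
        unfolding V_def e(4) by (intro cvec.span_mono) auto
      then show ?thesis unfolding u_def residual_def
        by (intro cvec.span_diff[OF cvec.span_base]) (use sum_V in auto)
    qed
    show "cvec.span (f ` {..<Suc r}) \<subseteq> cvec.span (w ` {..<Suc r})"
    proof (rule cvec.span_minimal)
      have "f i \<in> cvec.span (w ` {..<Suc r})" if "i < Suc r" for i
      proof (cases "i = r")
        case True
        then show ?thesis using u_w by (simp add: f_def v_def scaleR_scaleC cvec.span_scale)
      next
        case False
        then have "f i \<in> V" using that e_V by (simp add: f_def)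
        then show ?thesis unfolding V_def e(4)
          using cvec.span_mono[of "w ` {..<r}" "w ` {..<Suc r}"] by fastforce
      qed
      then show "f ` {..<Suc r} \<subseteq> cvec.span (w ` {..<Suc r})" by auto
    qed (rule cvec.subspace_span)
    have V_f: "V \<subseteq> cvec.span (f ` {..<Suc r})"
      unfolding V_def by (intro cvec.span_mono) (auto simp: f_def)
    show "cvec.span (w ` {..<Suc r}) \<subseteq> cvec.span (f ` {..<Suc r})"
    proof (rule cvec.span_minimal)
      have "w i \<in> cvec.span (f ` {..<Suc r})" if "i < Suc r" for i
      proof (cases "i = r")
        case True
        have "v \<in> f ` {..<Suc r}" by (auto simp: f_def)
        then have "of_real (norm u) *\<^sub>C v \<in> cvec.span (f ` {..<Suc r})"
          by (intro cvec.span_scale cvec.span_base)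
        moreover have "of_real (norm u) *\<^sub>C v = u" using nu by (simp add: v_def scaleR_scaleC[symmetric])
        ultimately have "u \<in> cvec.span (f ` {..<Suc r})" by simp
        then have "u + (\<Sum>i<r. cinner (w r) (e i) *\<^sub>C e i) \<in> cvec.span (f ` {..<Suc r})"
          by (intro cvec.span_add) (use sum_V V_f in auto)
        then show ?thesis using True w_eq by metis
      next
        case False
        then have "w i \<in> cvec.span (w ` {..<r})" using that by (intro cvec.span_base) auto
        then show ?thesis using V_f by (auto simp: V_def e(4))
      qed
      then show "w ` {..<Suc r} \<subseteq> cvec.span (f ` {..<Suc r})" by auto
    qed (rule cvec.subspace_span)
  qed
  moreover have "\<forall>i\<ge>Suc r. f i = 0" using e(2) by (simp add: f_def)
  ultimately show ?case by blast
qed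

section \<open>Compact operators\<close>

lemma compact_op_bounded: "compact_op Y \<Longrightarrow> bounded_clinear Y"
  by (simp add: compact_op_def)

lemma compact_opI:
  assumes "bounded_clinear Y" "compact K" "\<And>x. norm x \<le> 1 \<Longrightarrow> Y x \<in> K"
  shows "compact_op Y"
proof -
  have "closure (Y ` cball 0 1) \<subseteq> K"
    using assms by (intro closure_minimal compact_imp_closed) (auto simp: dist_norm)
  then show ?thesis
    using assms compact_Int_closed[OF assms(2) closed_closure, of "Y ` cball 0 1"]
    by (simp add: compact_op_def Int_absorb1)
qed

lemma compact_op_image: "compact_op Y \<Longrightarrow> norm x \<le> 1 \<Longrightarrow> Y x \<in> closure (Y ` cball 0 1)"
  using closure_subset[of "Y ` cball 0 1"] by (auto simp: dist_norm)

lemma compact_op_add: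
  assumes "compact_op Y" "compact_op Z"
  shows "compact_op (\<lambda>x. Y x + Z x)"
proof (rule compact_opI)
  show "compact {y + z | y z. y \<in> closure (Y ` cball 0 1) \<and> z \<in> closure (Z ` cball 0 1)}"
    using assms by (intro compact_sums) (auto simp: compact_op_def)
  show "bounded_clinear (\<lambda>x. Y x + Z x)"
    by (rule bounded_clinear_add[OF compact_op_bounded[OF assms(1)] compact_op_bounded[OF assms(2)]])
  show "Y x + Z x \<in> {y + z | y z. y \<in> closure (Y ` cball 0 1) \<and> z \<in> closure (Z ` cball 0 1)}"
    if "norm x \<le> 1" for x
    using compact_op_image[OF assms(1) that] compact_op_image[OF assms(2) that] by blast
qed

lemma compact_op_comp:
  assumes C: "bounded_clinear C" and Y: "compact_op Y" and D: "bounded_clinear D"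
  shows "compact_op (\<lambda>x. C (Y (D x)))"
proof (rule compact_opI)
  define d where "d = onorm D + 1"
  have d: "0 < d" using onorm_nonneg[OF D] by (simp add: d_def)
  show "bounded_clinear (\<lambda>x. C (Y (D x)))"
    by (rule bounded_clinear_comp[OF C bounded_clinear_comp[OF compact_op_bounded[OF Y] D]])
  have "continuous_on UNIV (\<lambda>y. C (d *\<^sub>R y))"
    using linear_continuous_on[OF bounded_clinearD(1)[OF bounded_clinear_comp[OF C bounded_clinear_scaleR[OF bounded_clinear_id]]]] .
  then show "compact ((\<lambda>y. C (d *\<^sub>R y)) ` closure (Y ` cball 0 1))"
    using Y by (intro compact_continuous_image) (auto simp: compact_op_def intro: continuous_on_subset)
  fix x :: 'a assume x: "norm x \<le> 1"
  have "norm (D x) \<le> onorm D * norm x" by (rule bounded_clinearD(9)[OF D])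
  also have "\<dots> \<le> d"
    using mult_left_mono[OF x onorm_nonneg[OF D]] by (simp add: d_def)
  finally have "norm ((1 / d) *\<^sub>R D x) \<le> 1" using d by (simp add: field_simps)
  from compact_op_image[OF Y this]
  have "C (d *\<^sub>R Y ((1 / d) *\<^sub>R D x)) \<in> (\<lambda>y. C (d *\<^sub>R y)) ` closure (Y ` cball 0 1)"
    by (rule imageI)
  then show "C (Y (D x)) \<in> (\<lambda>y. C (d *\<^sub>R y)) ` closure (Y ` cball 0 1)"
    using d by (simp add: bounded_clinearD(5)[OF compact_op_bounded[OF Y]])
qed

lemma compact_op_subseq:
  assumes "compact_op Y" "\<And>n. norm (x n) \<le> 1"
  shows "\<exists>r y. strict_mono (r :: nat \<Rightarrow> nat) \<and> (\<lambda>n. Y (x (r n))) \<longlonglongrightarrow> y"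
proof -
  have "seq_compact (closure (Y ` cball 0 1))"
    using assms(1) by (simp add: compact_op_def compact_eq_seq_compact_metric)
  moreover have "\<forall>n. Y (x n) \<in> closure (Y ` cball 0 1)"
    using compact_op_image[OF assms(1) assms(2)] by blast
  ultimately show ?thesis unfolding seq_compact_def by (force simp: comp_def)
qed

section \<open>Singular vectors and singular values\<close>

text \<open>The orthogonal complement \<open>M\<close> of the eigenvectors found so far is invariant under \<open>Y\<^sup>*Y\<close>. Let \<open>\<sigma>\<close> be
  the norm of \<open>Y\<close> on \<open>M\<close> and let \<open>x\<^sub>n\<close> in the unit ball of \<open>M\<close> satisfy \<open>\<parallel>Y x\<^sub>n\<parallel> \<rightarrow> \<sigma>\<close>. Then
  \<open>\<parallel>Y\<^sup>*Y x\<^sub>n - \<sigma>\<^sup>2 x\<^sub>n\<parallel>\<^sup>2 \<le> \<sigma>\<^sup>4 - \<sigma>\<^sup>2 \<parallel>Y x\<^sub>n\<parallel>\<^sup>2 \<rightarrow> 0\<close>. A subsequence of \<open>Y x\<^sub>n\<close> converges by compactness, so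
  the same subsequence of \<open>x\<^sub>n\<close> converges, and its limit is a unit vector that attains the norm. If
  \<open>\<sigma> = 0\<close> the zero vector is taken.\<close>

lemma maximising_eigenvector:
  fixes Y :: "'a::chilbert_space \<Rightarrow> 'a"
  assumes Y: "compact_op Y" and p: "\<And>j. j < n \<Longrightarrow> \<exists>c. cadjoint Y (Y (p j)) = c *\<^sub>R p j"
  defines "M \<equiv> {x. \<forall>j<n. cinner x (p j) = 0}"
  shows "\<exists>v\<in>M. (v = 0 \<or> norm v = 1) \<and> (v \<noteq> 0 \<longrightarrow> Y v \<noteq> 0) \<and>
    (\<forall>x\<in>M. norm (Y x) \<le> norm (Y v) * norm x) \<and> cadjoint Y (Y v) = (norm (Y v))\<^sup>2 *\<^sub>R v"
proof -
  note bY = compact_op_bounded[OF Y]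
  note bA = bounded_clinear_cadjoint[OF bY]
  define P where "P x = cadjoint Y (Y x)" for x
  have P_sa: "cinner (P x) y = cinner (Y x) (Y y)" "cinner x (P y) = cinner (Y x) (Y y)" for x y
    by (simp_all add: P_def cinner_cadjoint[OF bY] cinner_cadjoint'[OF bY])
  have M0: "0 \<in> M" by (simp add: M_def)
  have M_scale: "r *\<^sub>R x \<in> M" if "x \<in> M" for r x
    using that by (simp add: M_def cinner_scaleR_left)
  have M_P: "P x \<in> M" if "x \<in> M" for x
    unfolding M_def
  proof (intro CollectI allI impI)
    fix j assume j: "j < n"
    obtain c where c: "P (p j) = c *\<^sub>R p j" using p[OF j] by (auto simp: P_def)
    have "cinner (P x) (p j) = cinner x (P (p j))" unfolding P_sa ..
    then show "cinner (P x) (p j) = 0"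
      using that j unfolding c cinner_scaleR_right by (simp add: M_def)
  qed
  define S where "S = (\<lambda>x. norm (Y x)) ` (M \<inter> cball 0 1)"
  have S0: "0 \<in> S" unfolding S_def using M0 bounded_clinearD(6)[OF bY] by (force simp: image_iff)
  have bdd: "bdd_above S"
  proof (rule bdd_aboveI)
    fix s assume "s \<in> S"
    then obtain x where "s = norm (Y x)" "norm x \<le> 1" by (auto simp: S_def dist_norm)
    then show "s \<le> onorm Y"
      using bounded_clinearD(9)[OF bY, of x] mult_left_mono[OF _ onorm_nonneg[OF bY], of "norm x" 1] by simp
  qed
  define \<sigma> where "\<sigma> = Sup S"
  have \<sigma>0: "0 \<le> \<sigma>" unfolding \<sigma>_def by (rule cSup_upper[OF S0 bdd])
  have le: "norm (Y x) \<le> \<sigma> * norm x" if "x \<in> M" for x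
  proof (cases "x = 0")
    case False
    have "norm (Y ((1 / norm x) *\<^sub>R x)) \<in> S"
      unfolding S_def using M_scale[OF that] False by (intro imageI) (simp add: dist_norm)
    then have "norm (Y ((1 / norm x) *\<^sub>R x)) \<le> \<sigma>" unfolding \<sigma>_def by (rule cSup_upper[OF _ bdd])
    then show ?thesis using False by (simp add: bounded_clinearD[OF bY] field_simps)
  qed (simp add: bounded_clinearD[OF bY])
  show ?thesis
  proof (cases "\<sigma> = 0")
    case True
    then show ?thesis using le M0
      by (intro bexI[of _ 0]) (auto simp: bounded_clinearD[OF bY] bounded_clinearD[OF bA])
  next
    case False
    then have \<sigma>: "0 < \<sigma>" using \<sigma>0 by simp
    have "\<exists>x\<in>M. norm x \<le> 1 \<and> \<sigma> - 1 / real (Suc n) < norm (Y x)" for n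
    proof -
      have "\<sigma> - 1 / real (Suc n) < Sup S" by (simp add: \<sigma>_def)
      then obtain s where "s \<in> S" "\<sigma> - 1 / real (Suc n) < s"
        using less_cSupD[of S] S0 by blast
      then show ?thesis by (auto simp: S_def dist_norm)
    qed
    then obtain x where x: "\<And>n. x n \<in> M" "\<And>n. norm (x n) \<le> 1"
      "\<And>n. \<sigma> - 1 / real (Suc n) < norm (Y (x n))" by metis
    obtain r y where r: "strict_mono r" and y: "(\<lambda>n. Y (x (r n))) \<longlonglongrightarrow> y"
      using compact_op_subseq[OF Y, of x] x(2) by blast
    have le1: "norm (Y (x n)) \<le> \<sigma>" for n
      using le[OF x(1)[of n]] mult_left_mono[OF x(2)[of n] \<sigma>0] by simp
    have Yx: "(\<lambda>n. norm (Y (x n))) \<longlonglongrightarrow> \<sigma>"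
    proof (rule tendsto_sandwich[of "\<lambda>n. \<sigma> - 1 / real (Suc n)" _ _ "\<lambda>_. \<sigma>"])
      have "(\<lambda>n. \<sigma> - 1 / real (Suc n)) \<longlonglongrightarrow> \<sigma> - 0"
        using LIMSEQ_inverse_real_of_nat by (intro tendsto_intros) (simp add: inverse_eq_divide)
      then show "(\<lambda>n. \<sigma> - 1 / real (Suc n)) \<longlonglongrightarrow> \<sigma>" by simp
      show "\<forall>\<^sub>F n in sequentially. \<sigma> - 1 / real (Suc n) \<le> norm (Y (x n))"
        by (intro always_eventually allI less_imp_le x(3))
    qed (simp_all add: le1)
    have Yxr: "(\<lambda>n. norm (Y (x (r n)))) \<longlonglongrightarrow> \<sigma>"
      using LIMSEQ_subseq_LIMSEQ[OF Yx r] by (simp add: comp_def)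
    have norm_y: "norm y = \<sigma>" using LIMSEQ_unique[OF tendsto_norm[OF y] Yxr] .
    have diff: "(norm (P (x n) - \<sigma>\<^sup>2 *\<^sub>R x n))\<^sup>2 \<le> \<sigma>^4 - \<sigma>\<^sup>2 * (norm (Y (x n)))\<^sup>2" for n
    proof -
      have "(norm (P (x n)))\<^sup>2 = Re (cinner (Y (P (x n))) (Y (x n)))"
        by (simp add: P_sa(2)[symmetric] Re_cinner_self)
      also have "\<dots> \<le> norm (Y (P (x n))) * norm (Y (x n))"
        by (rule order_trans[OF complex_Re_le_cmod cauchy_schwarz])
      also have "\<dots> \<le> \<sigma> * norm (P (x n)) * norm (Y (x n))"
        by (intro mult_right_mono le M_P x) auto
      finally have "norm (P (x n)) \<le> \<sigma> * norm (Y (x n))"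
        by (rule norm_le_if_sq_le) (use \<sigma>0 in auto)
      then have "(norm (P (x n)))\<^sup>2 \<le> \<sigma>\<^sup>2 * (norm (Y (x n)))\<^sup>2"
        using power_mono[of "norm (P (x n))" "\<sigma> * norm (Y (x n))" 2] by (simp add: power_mult_distrib)
      moreover have "\<sigma>^4 * (norm (x n))\<^sup>2 \<le> \<sigma>^4"
        using x(2)[of n] by (intro mult_left_le) (auto simp: power_le_one)
      moreover have "(norm (P (x n) - \<sigma>\<^sup>2 *\<^sub>R x n))\<^sup>2 =
          (norm (P (x n)))\<^sup>2 + \<sigma>^4 * (norm (x n))\<^sup>2 - 2 * (\<sigma>\<^sup>2 * (norm (Y (x n)))\<^sup>2)"
        by (simp add: norm_diff_sq cinner_scaleR_right P_sa(1) Re_cinner_self power_mult_distrib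
            cinner_self flip: power_mult)
      ultimately show ?thesis by linarith
    qed
    have "(\<lambda>n. \<sigma>^4 - \<sigma>\<^sup>2 * (norm (Y (x n)))\<^sup>2) \<longlonglongrightarrow> \<sigma>^4 - \<sigma>\<^sup>2 * \<sigma>\<^sup>2"
      by (intro tendsto_intros Yx)
    then have "(\<lambda>n. \<sigma>^4 - \<sigma>\<^sup>2 * (norm (Y (x n)))\<^sup>2) \<longlonglongrightarrow> 0"
      by (simp add: power4_eq_xxxx power2_eq_square)
    then have "(\<lambda>n. (norm (P (x n) - \<sigma>\<^sup>2 *\<^sub>R x n))\<^sup>2) \<longlonglongrightarrow> 0"
      by (rule tendsto_sandwich[OF _ _ tendsto_const, rotated -1])
        (auto intro!: always_eventually diff)
    from tendsto_real_sqrt[OF this]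
    have "(\<lambda>n. P (x n) - \<sigma>\<^sup>2 *\<^sub>R x n) \<longlonglongrightarrow> 0" by (simp add: tendsto_norm_zero_iff)
    then have d0: "(\<lambda>n. P (x (r n)) - \<sigma>\<^sup>2 *\<^sub>R x (r n)) \<longlonglongrightarrow> 0"
      using LIMSEQ_subseq_LIMSEQ[OF _ r] by (force simp: comp_def)
    define v where "v = (1 / \<sigma>\<^sup>2) *\<^sub>R cadjoint Y y"
    have Py: "(\<lambda>n. P (x (r n))) \<longlonglongrightarrow> cadjoint Y y"
      unfolding P_def by (rule bounded_linear.tendsto[OF bounded_clinearD(1)[OF bA] y])
    have "(\<lambda>n. (1 / \<sigma>\<^sup>2) *\<^sub>R (P (x (r n)) - (P (x (r n)) - \<sigma>\<^sup>2 *\<^sub>R x (r n))))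
        \<longlonglongrightarrow> (1 / \<sigma>\<^sup>2) *\<^sub>R (cadjoint Y y - 0)"
      by (intro tendsto_intros Py d0)
    then have xv: "(\<lambda>n. x (r n)) \<longlonglongrightarrow> v" using \<sigma> by (simp add: v_def)
    have Yv: "Y v = y"
      using LIMSEQ_unique[OF bounded_linear.tendsto[OF bounded_clinearD(1)[OF bY] xv] y] .
    have "v \<in> M"
      unfolding M_def
    proof (intro CollectI allI impI)
      fix j assume "j < n"
      then have "cinner (x (r i)) (p j) = 0" for i using x(1)[of "r i"] by (simp add: M_def)
      moreover have "(\<lambda>i. cinner (x (r i)) (p j)) \<longlonglongrightarrow> cinner v (p j)"
        by (intro cinner.tendsto xv tendsto_const)
      ultimately show "cinner v (p j) = 0" by (simp add: LIMSEQ_const_iff)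
    qed
    moreover have "norm v = 1"
    proof (rule antisym)
      show "norm v \<le> 1"
        by (rule tendsto_upperbound[OF tendsto_norm[OF xv]]) (auto simp: x(2))
      have "\<sigma> * 1 \<le> \<sigma> * norm v" using le[OF \<open>v \<in> M\<close>] by (simp add: Yv norm_y)
      then show "1 \<le> norm v" using \<sigma> by (simp only: mult_le_cancel_left_pos)
    qed
    moreover have "cadjoint Y (Y v) = \<sigma>\<^sup>2 *\<^sub>R v" unfolding Yv using \<sigma> by (simp add: v_def)
    ultimately show ?thesis using le \<sigma> norm_y Yv by (intro bexI[of _ v]) auto
  qed
qed

text \<open>Uniqueness for the definite description of the singular values. At the first index where two such
  sequences differ, the larger of the two values occurs at least once more in its own sequence than in
  the other one, since the other sequence stays strictly below it from there on.\<close>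

lemma multiplicities_determine_antimono:
  fixes s s' :: "nat \<Rightarrow> real"
  assumes s: "antimono s" "\<And>n. 0 \<le> s n" "\<And>t. 0 < t \<Longrightarrow> finite {n. s n = t} \<and> card {n. s n = t} = c t"
    and s': "antimono s'" "\<And>n. 0 \<le> s' n" "\<And>t. 0 < t \<Longrightarrow> finite {n. s' n = t} \<and> card {n. s' n = t} = c t"
  shows "s = s'"
proof
  have main: "\<not> s' n < s n"
    if s: "antimono s" "\<And>t. 0 < t \<Longrightarrow> finite {n. s n = t} \<and> card {n. s n = t} = c t"
      and s': "antimono s'" "\<And>n. 0 \<le> s' n" "\<And>t. 0 < t \<Longrightarrow> finite {n. s' n = t} \<and> card {n. s' n = t} = c t"
      and eq: "\<And>k. k < n \<Longrightarrow> s k = s' k" for s s' :: "nat \<Rightarrow> real" and n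
  proof
    assume less: "s' n < s n"
    define t where "t = s n"
    have t: "0 < t" using less s'(2)[of n] by (simp add: t_def)
    have "{k. s' k = t} \<subseteq> {k. s k = t} - {n}"
    proof
      fix k assume k: "k \<in> {k. s' k = t}"
      then have "k < n" using antimonoD[OF s'(1), of n k] less by (cases "k < n") (auto simp: t_def)
      then show "k \<in> {k. s k = t} - {n}" using k eq by auto
    qed
    then have "card {k. s' k = t} \<le> card ({k. s k = t} - {n})"
      using s(2)[OF t] by (intro card_mono) auto
    also have "\<dots> < card {k. s k = t}"
      using s(2)[OF t] by (intro card_Diff1_less) (auto simp: t_def)
    finally show False
      using conjunct2[OF s(2)[OF t]] conjunct2[OF s'(3)[OF t]] by linarith
  qed
  fix n show "s n = s' n"
  proof (induction n rule: less_induct)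
    case (less n)
    have "\<not> s' n < s n" by (rule main[OF s(1) s(3) s'(1) s'(2) s'(3)]) (auto simp: less)
    moreover have "\<not> s n < s' n" by (rule main[OF s'(1) s'(3) s(1) s(2) s(3)]) (auto simp: less)
    ultimately show ?case by simp
  qed
qed

text \<open>The \<open>p\<^sub>n\<close> are the right and the \<open>q\<^sub>n\<close> the left singular vectors, both zero where \<open>s\<^sub>n = 0\<close>. The last
  clause is the part of the minimax principle that is needed later: off \<open>p\<^sub>0, \<dots>, p\<^bsub>n-1\<^esub>\<close> the norm of
  \<open>Y\<close> is at most \<open>s\<^sub>n\<close>.\<close>

definition singular_system ::
  "('a::chilbert_space \<Rightarrow> 'a) \<Rightarrow> (nat \<Rightarrow> real) \<Rightarrow> (nat \<Rightarrow> 'a) \<Rightarrow> (nat \<Rightarrow> 'a) \<Rightarrow> bool" where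
  "singular_system Y s p q \<longleftrightarrow> antimono s \<and> (\<forall>n. 0 \<le> s n) \<and> orthosys p \<and> orthosys q \<and>
     (\<forall>n. p n = 0 \<longleftrightarrow> s n = 0) \<and> (\<forall>n. q n = 0 \<longleftrightarrow> s n = 0) \<and>
     (\<forall>n. Y (p n) = s n *\<^sub>R q n) \<and> (\<forall>n. cadjoint Y (q n) = s n *\<^sub>R p n) \<and>
     (\<forall>n x. (\<forall>j<n. cinner x (p j) = 0) \<longrightarrow> norm (Y x) \<le> s n * norm x)"

lemma singular_systemD:
  assumes "singular_system Y s p q"
  shows "antimono s" "0 \<le> s n" "orthosys p" "orthosys q"
    "p n = 0 \<longleftrightarrow> s n = 0" "q n = 0 \<longleftrightarrow> s n = 0"
    "Y (p n) = s n *\<^sub>R q n" "cadjoint Y (q n) = s n *\<^sub>R p n"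
    "(\<And>j. j < n \<Longrightarrow> cinner x (p j) = 0) \<Longrightarrow> norm (Y x) \<le> s n * norm x"
  using assms by (simp_all add: singular_system_def)

text \<open>The \<open>p\<^sub>n\<close> are chosen one after the other as maximising eigenvectors. The norms \<open>s\<^sub>n = \<parallel>Y p\<^sub>n\<parallel>\<close> tend to
  \<open>0\<close>, because the vectors \<open>Y p\<^sub>n\<close> are orthogonal and lie in a compact set. For \<open>t > 0\<close> only finitely
  many \<open>s\<^sub>n\<close> equal \<open>t\<close>, and the corresponding \<open>p\<^sub>n\<close> span the eigenspace of \<open>\<bar>Y\<bar>\<close>: an eigenvector
  orthogonal to all \<open>p\<^sub>n\<close> with \<open>n < N\<close>, where \<open>s\<^sub>N < t\<close>, satisfies \<open>t \<parallel>y\<parallel> = \<parallel>Y y\<parallel> \<le> s\<^sub>N \<parallel>y\<parallel>\<close> and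
  vanishes. Hence \<open>s\<close> enumerates the positive eigenvalues of \<open>\<bar>Y\<bar>\<close> with their multiplicities.\<close>

theorem singular_value_decomposition:
  fixes Y :: "'a::chilbert_space \<Rightarrow> 'a"
  assumes Y: "compact_op Y"
  shows "\<exists>p q. singular_system Y (singular_values Y) p q"
proof -
  note bY = compact_op_bounded[OF Y]
  note bA = bounded_clinear_cadjoint[OF bY]
  define good where "good p n v \<longleftrightarrow> (\<forall>j<n. cinner v (p j) = 0) \<and>
    (v = 0 \<or> norm v = 1) \<and> (v \<noteq> 0 \<longrightarrow> Y v \<noteq> 0) \<and>
    (\<forall>x. (\<forall>j<n. cinner x (p j) = 0) \<longrightarrow> norm (Y x) \<le> norm (Y v) * norm x) \<and>
    cadjoint Y (Y v) = (norm (Y v))\<^sup>2 *\<^sub>R v" for p :: "nat \<Rightarrow> 'a" and n v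
  have "\<exists>p. \<forall>n. good p n (p n)"
  proof (rule dependent_wf_choice[OF wf_less_than])
    show "good p n v = good p' n v" if "\<And>j. (j, n) \<in> less_than \<Longrightarrow> p j = p' j" for p p' n v
      using that by (simp add: good_def)
    show "\<exists>v. good p n v" if "\<And>j. (j, n) \<in> less_than \<Longrightarrow> good p j (p j)" for n p
      using maximising_eigenvector[OF Y, of n p] that unfolding good_def by simp
  qed
  then obtain p where good: "\<And>n. good p n (p n)" by blast
  define s where "s n = norm (Y (p n))" for n
  have p_orth: "cinner (p i) (p j) = 0" if "i \<noteq> j" for i j
  proof -
    have less: "cinner (p n) (p m) = 0" if "m < n" for m n
      using good[of n] that by (simp add: good_def)
    show ?thesis using that less[of i j] less[of j i] cinner_commute[of "p i" "p j"]
      by (cases "i < j") simp_all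
  qed
  have p_norm: "p n \<noteq> 0 \<Longrightarrow> norm (p n) = 1" for n
    using good[of n] unfolding good_def by blast
  have p: "orthosys p"
    unfolding orthosys_def by (auto simp: p_orth p_norm cinner_self)
  have s0: "0 \<le> s n" for n by (simp add: s_def)
  have p0: "p n = 0 \<longleftrightarrow> s n = 0" for n
    using good[of n] bounded_clinearD(6)[OF bY] by (auto simp: good_def s_def)
  have max: "norm (Y x) \<le> s n * norm x" if "\<And>j. j < n \<Longrightarrow> cinner x (p j) = 0" for n x
    using good[of n] that unfolding good_def s_def by blast
  have eig: "cadjoint Y (Y (p n)) = (s n)\<^sup>2 *\<^sub>R p n" for n
    using good[of n] unfolding good_def s_def by blast
  have anti: "antimono s"
  proof (rule antimonoI)
    fix n m :: nat assume "n \<le> m"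
    then have "norm (Y (p m)) \<le> s n * norm (p m)" by (intro max p_orth) auto
    also have "\<dots> \<le> s n" using orthosys_norm_le_1[OF p, of m] s0[of n] by (intro mult_left_le)
    finally show "s m \<le> s n" by (simp add: s_def)
  qed
  have Y_orth: "cinner (Y (p i)) (Y (p j)) = of_real ((s j)\<^sup>2) * cinner (p i) (p j)" for i j
    by (simp add: cinner_cadjoint[OF bY] eig cinner_scaleR_right)
  \<comment> \<open>Otherwise the orthogonal vectors \<open>Y p\<^sub>n\<close> stay at distance at least \<open>\<epsilon>\<close> from each other.\<close>
  have small: "\<exists>n. s n < \<epsilon>" if "0 < \<epsilon>" for \<epsilon>
  proof (rule ccontr)
    assume "\<nexists>n. s n < \<epsilon>"
    then have ge: "\<epsilon> \<le> s n" for n by (simp add: not_less)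
    obtain r y where r: "strict_mono (r :: nat \<Rightarrow> nat)" and y: "(\<lambda>n. Y (p (r n))) \<longlonglongrightarrow> y"
      using compact_op_subseq[OF Y, of p] orthosys_norm_le_1[OF p] by blast
    obtain N where N: "\<And>m n. m \<ge> N \<Longrightarrow> n \<ge> N \<Longrightarrow> dist (Y (p (r m))) (Y (p (r n))) < \<epsilon>"
      using metric_CauchyD[OF LIMSEQ_imp_Cauchy[OF y] \<open>0 < \<epsilon>\<close>] by blast
    have "r N \<noteq> r (Suc N)" using r by (simp add: strict_mono_eq)
    then have "(norm (Y (p (r N)) - Y (p (r (Suc N)))))\<^sup>2 = (s (r N))\<^sup>2 + (s (r (Suc N)))\<^sup>2"
      by (simp add: norm_diff_sq Y_orth p_orth s_def)
    then have "\<epsilon>\<^sup>2 \<le> (norm (Y (p (r N)) - Y (p (r (Suc N)))))\<^sup>2"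
      using power_mono[OF ge[of "r N"], of 2] that by (simp add: add_increasing2)
    then have "\<epsilon> \<le> norm (Y (p (r N)) - Y (p (r (Suc N))))" by (rule power2_le_imp_le) simp
    then show False using N[of N "Suc N"] by (simp add: dist_norm)
  qed
  have mult: "finite {n. s n = t} \<and> card {n. s n = t} = cvec.dim {x. op_abs Y x = t *\<^sub>R x}"
    if t: "0 < t" for t
  proof
    obtain N where N: "s N < t" using small[OF t] by blast
    have "n < N" if "s n = t" for n
      using that N antimonoD[OF anti, of N n] by (cases "n < N") auto
    then have "{n. s n = t} \<subseteq> {..<N}" by auto
    then show "finite {n. s n = t}" by (rule finite_subset) simp
    have E: "op_abs Y x = t *\<^sub>R x \<longleftrightarrow> cadjoint Y (Y x) = t\<^sup>2 *\<^sub>R x" for x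
    proof
      note P = positive_op_op_abs[OF bY]
      note bP = positive_op_bounded[OF P]
      show "cadjoint Y (Y x) = t\<^sup>2 *\<^sub>R x" if "op_abs Y x = t *\<^sub>R x"
        using that by (simp add: op_abs_op_abs[OF bY, symmetric] bounded_clinearD[OF bP] power2_eq_square)
      show "op_abs Y x = t *\<^sub>R x" if a: "cadjoint Y (Y x) = t\<^sup>2 *\<^sub>R x"
      proof -
        \<comment> \<open>From \<open>(\<bar>Y\<bar> + t) z = 0\<close> and \<open>\<bar>Y\<bar> \<ge> 0\<close> it follows that \<open>z = 0\<close>.\<close>
        define z where "z = op_abs Y x - t *\<^sub>R x"
        have "op_abs Y z + t *\<^sub>R z = 0"
          using a by (simp add: z_def bounded_clinearD[OF bP] op_abs_op_abs[OF bY] power2_eq_square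
              algebra_simps)
        then have "Re (cinner (op_abs Y z + t *\<^sub>R z) z) = 0" by simp
        then have "Re (cinner (op_abs Y z) z) + t * (norm z)\<^sup>2 = 0"
          by (simp add: cinner_add_left cinner_scaleR_left cinner_self)
        moreover have "0 \<le> Re (cinner (op_abs Y z) z)"
          using conjunct2[OF conjunct2[OF P[unfolded positive_op_def]]] by blast
        ultimately have "t * (norm z)\<^sup>2 \<le> 0" by linarith
        then have "z = 0" using t by (simp add: mult_le_0_iff)
        then show ?thesis by (simp add: z_def)
      qed
    qed
    define B where "B = p ` {n. s n = t}"
    have inj: "inj_on p {n. s n = t}"
    proof (rule inj_onI)
      fix i j assume "i \<in> {n. s n = t}" "j \<in> {n. s n = t}" "p i = p j"
      then show "i = j" using orthosysD[OF p, of i j] p0[of i] t cinner_eq_zero_iff[of "p i"]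
        by (cases "i = j") auto
    qed
    have "cvec.dim {x. op_abs Y x = t *\<^sub>R x} = card B"
    proof (rule cvec.dim_unique[OF _ _ _ refl])
      show "B \<subseteq> {x. op_abs Y x = t *\<^sub>R x}" by (auto simp: B_def E eig)
      show "{x. op_abs Y x = t *\<^sub>R x} \<subseteq> cvec.span B"
      proof
        fix x assume "x \<in> {x. op_abs Y x = t *\<^sub>R x}"
        then have x: "cadjoint Y (Y x) = t\<^sup>2 *\<^sub>R x" by (simp add: E)
        have x_orth: "cinner x (p n) = 0" if "s n \<noteq> t" for n
        proof -
          have "of_real (t\<^sup>2) * cinner x (p n) = cinner (cadjoint Y (Y x)) (p n)"
            by (simp add: x cinner_scaleR_left)
          also have "\<dots> = of_real ((s n)\<^sup>2) * cinner x (p n)"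
            by (subst cinner_cadjoint'[OF bY]) (simp add: cinner_cadjoint[OF bY] eig cinner_scaleR_right)
          finally have "(of_real (t\<^sup>2) :: complex) = of_real ((s n)\<^sup>2) \<or> cinner x (p n) = 0"
            by (simp only: mult_cancel_right disj_commute)
          moreover have "t\<^sup>2 \<noteq> (s n)\<^sup>2" using that t s0[of n] by simp
          ultimately show ?thesis unfolding of_real_eq_iff by blast
        qed
        define y where "y = residual p N x"
        have "s N * norm y < t * norm y \<or> y = 0"
          using N by (cases "y = 0") simp_all
        have y_orth: "cinner y (p n) = 0" for n
        proof (cases "n < N")
          case True
          then show ?thesis unfolding y_def by (rule residual_orthogonal[OF p])
        next
          case False
          then have "s n \<noteq> t" using \<open>\<And>n. s n = t \<Longrightarrow> n < N\<close> by blast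
          moreover have "cinner (p i) (p n) = 0" if "i < N" for i using that False by (intro p_orth) auto
          ultimately show ?thesis
            by (simp add: y_def residual_def cinner.diff_left cinner.sum_left cinner_scaleC_left x_orth)
        qed
        have Py: "cadjoint Y (Y y) = t\<^sup>2 *\<^sub>R y"
        proof -
          have "cinner x (p i) *\<^sub>C ((s i)\<^sup>2 *\<^sub>R p i) = t\<^sup>2 *\<^sub>R (cinner x (p i) *\<^sub>C p i)" for i
            using x_orth[of i] by (cases "s i = t") (auto simp: scaleC.scaleR_right)
          then have "(\<Sum>i<N. cinner x (p i) *\<^sub>C ((s i)\<^sup>2 *\<^sub>R p i)) = t\<^sup>2 *\<^sub>R (\<Sum>i<N. cinner x (p i) *\<^sub>C p i)"
            by (simp only: scaleR_sum_right)
          then show ?thesis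
            by (simp add: y_def residual_def bounded_clinearD[OF bY] bounded_clinearD[OF bA] x eig
                scaleR_diff_right)
        qed
        have "(norm (Y y))\<^sup>2 = t\<^sup>2 * (norm y)\<^sup>2"
          using cinner_cadjoint[OF bY, of y "Y y"]
          by (simp add: Re_cinner_self[symmetric] Py cinner_scaleR_right)
        then have "norm (Y y) = t * norm y"
          using t by (simp add: power_mult_distrib[symmetric] power2_eq_iff_nonneg)
        moreover have "norm (Y y) \<le> s N * norm y" by (rule max) (rule y_orth)
        ultimately have "y = 0" using \<open>s N * norm y < t * norm y \<or> y = 0\<close> by linarith
        then have x_eq: "x = (\<Sum>i<N. cinner x (p i) *\<^sub>C p i)" by (simp add: y_def residual_def)
        have "cinner x (p i) *\<^sub>C p i \<in> cvec.span B" for i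
          using x_orth[of i]
          by (cases "s i = t") (auto simp: B_def cvec.span_zero intro!: cvec.span_scale[OF cvec.span_base])
        then have "(\<Sum>i<N. cinner x (p i) *\<^sub>C p i) \<in> cvec.span B" by (intro cvec.span_sum)
        then show "x \<in> cvec.span B" using x_eq by metis
      qed
      show "cvec.independent B"
        unfolding cvec.dependent_def
      proof
        assume "\<exists>a\<in>B. a \<in> cvec.span (B - {a})"
        then obtain i where i: "s i = t" "p i \<in> cvec.span (B - {p i})" by (auto simp: B_def)
        have "cinner x (p i) = 0" if "x \<in> cvec.span (B - {p i})" for x
          using that
        proof (induction rule: cvec.span_induct_alt)
          case (step c x y)
          then obtain j where "x = p j" "j \<noteq> i" by (auto simp: B_def)
          then show ?case using step p_orth[of j i] by (simp add: cinner_add_left cinner_scaleC_left)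
        qed simp
        then have "cinner (p i) (p i) = 0" using i by blast
        then show False using p0[of i] i t by (simp add: cinner_eq_zero_iff)
      qed
    qed
    then show "card {n. s n = t} = cvec.dim {x. op_abs Y x = t *\<^sub>R x}"
      by (simp add: B_def card_image[OF inj])
  qed
  have sv: "singular_values Y = s"
    unfolding singular_values_def
  proof (rule the_equality)
    show "antimono s \<and> (\<forall>n. 0 \<le> s n) \<and> (\<forall>t>0. finite {n. s n = t} \<and>
        card {n. s n = t} = cvec.dim {x. op_abs Y x = t *\<^sub>R x})"
      by (intro conjI allI impI anti s0 conjunct1[OF mult] conjunct2[OF mult])
  next
    fix s' :: "nat \<Rightarrow> real"
    assume s': "antimono s' \<and> (\<forall>n. 0 \<le> s' n) \<and> (\<forall>t>0. finite {n. s' n = t} \<and>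
        card {n. s' n = t} = cvec.dim {x. op_abs Y x = t *\<^sub>R x})"
    show "s' = s"
    proof (rule multiplicities_determine_antimono[OF _ _ _ anti s0 mult])
      show "antimono s'" "0 \<le> s' n" for n
        using s' by simp_all
      show "finite {n. s' n = t} \<and> card {n. s' n = t} = cvec.dim {x. op_abs Y x = t *\<^sub>R x}"
        if "0 < t" for t
        using conjunct2[OF conjunct2[OF s']] that by simp
    qed
  qed
  \<comment> \<open>Since \<open>1 / 0 = 0\<close>, this is zero where \<open>s n = 0\<close>.\<close>
  define q where "q n = (1 / s n) *\<^sub>R Y (p n)" for n
  have q0: "q n = 0 \<longleftrightarrow> s n = 0" for n by (auto simp: q_def s_def)
  have q: "orthosys q"
    unfolding orthosys_def
  proof (intro allI)
    fix i j
    have "cinner (q i) (q j) = of_real (1 / s i * (1 / s j) * (s j)\<^sup>2) * cinner (p i) (p j)"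
      by (simp add: q_def cinner_scaleR_left cinner_scaleR_right Y_orth)
    also have "\<dots> = of_bool (i = j \<and> q i \<noteq> 0)"
      using p0[of i] by (auto simp: orthosysD[OF p] q0 power2_eq_square)
    finally show "cinner (q i) (q j) = of_bool (i = j \<and> q i \<noteq> 0)" .
  qed
  have Yp: "Y (p n) = s n *\<^sub>R q n" for n
    by (cases "s n = 0") (auto simp: q_def s_def)
  have Yq: "cadjoint Y (q n) = s n *\<^sub>R p n" for n
    by (cases "s n = 0") (auto simp: q_def bounded_clinearD[OF bA] eig power2_eq_square)
  have "singular_system Y s p q"
    unfolding singular_system_def using anti s0 p q p0 q0 Yp Yq max by simp
  then show ?thesis unfolding sv by blast
qed

section \<open>Ky Fan norms\<close>

definition ky_fan :: "nat \<Rightarrow> ('a::chilbert_space \<Rightarrow> 'a) \<Rightarrow> real" where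
  "ky_fan k Y = (\<Sum>i<k. singular_values Y i)"

lemma cinner_Pair: "cinner (a, b) (c, d) = cinner a c + cinner b d"
  by (simp add: cinner_prod_def)

lemma besselD: "bessel e \<Longrightarrow> (\<Sum>i<k. (cmod (cinner (e i) h))\<^sup>2) \<le> (norm h)\<^sup>2"
  unfolding bessel_def by blast

lemma four_Re_mult_cnj_le: "4 * Re (v * cnj u) \<le> (cmod (u + v))\<^sup>2"
proof -
  have "(cmod (u + v))\<^sup>2 - 4 * Re (v * cnj u) = (cmod (u - v))\<^sup>2"
    unfolding cmod_power2 by (simp add: power2_eq_square algebra_simps)
  then show ?thesis by (metis diff_ge_0_iff_ge zero_le_power2)
qed

text \<open>Let \<open>R x = Y x - \<Sum>\<^sub>j (s\<^sub>j - s\<^sub>k) (cinner x p\<^sub>j) q\<^sub>j\<close>, summed over \<open>j < k\<close>. Then \<open>\<parallel>R\<parallel> \<le> s\<^sub>k\<close>, so each of the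
  \<open>k\<close> summands receives at most \<open>s\<^sub>k\<close> from \<open>R\<close>. The contribution of the index \<open>j\<close> to the finite-rank
  part is at most \<open>(s\<^sub>j - s\<^sub>k) \<bar>cinner (e i) (h j)\<bar>\<^sup>2\<close> with \<open>h j = (q\<^sub>j, p\<^sub>j) / \<surd>2\<close>, and by Bessel's
  inequality these squares add up to at most \<open>1\<close> over \<open>i\<close>. The total is
  \<open>\<Sum>\<^sub>j (s\<^sub>j - s\<^sub>k) + k s\<^sub>k\<close>.\<close>

lemma ky_fan_upper:
  fixes e :: "nat \<Rightarrow> 'a::chilbert_space \<times> 'a"
  assumes Y: "compact_op Y" and e: "bessel e"
  shows "(\<Sum>i<k. 2 * Re (cinner (Y (snd (e i))) (fst (e i)))) \<le> ky_fan k Y"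
proof -
  note bY = compact_op_bounded[OF Y]
  define s where "s = singular_values Y"
  obtain p q where svd: "singular_system Y s p q"
    using singular_value_decomposition[OF Y] unfolding s_def by blast
  note s = singular_systemD(1,2)[OF svd] and p = singular_systemD(3)[OF svd]
    and q = singular_systemD(4)[OF svd] and p0 = singular_systemD(5)[OF svd]
    and q0 = singular_systemD(6)[OF svd] and Yp = singular_systemD(7)[OF svd]
    and Yq = singular_systemD(8)[OF svd] and max = singular_systemD(9)[OF svd]
  define c where "c j = s j - s k" for j
  have c0: "0 \<le> c j" if "j < k" for j using antimonoD[OF s(1), of j k] that by (simp add: c_def)
  define R where "R x = Y x - (\<Sum>j<k. c j *\<^sub>R (cinner x (p j) *\<^sub>C q j))" for x
  have norm_R: "norm (R x) \<le> s k * norm x" for x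
  proof -
    define y where "y = residual p k x"
    define u where "u = (\<Sum>j<k. cinner x (p j) *\<^sub>C q j)"
    have "Y x = Y (y + (\<Sum>j<k. cinner x (p j) *\<^sub>C p j))" by (simp add: y_def residual_def)
    also have "\<dots> = Y y + (\<Sum>j<k. s j *\<^sub>R (cinner x (p j) *\<^sub>C q j))"
      by (simp add: bounded_clinearD[OF bY] Yp scaleC.scaleR_right)
    finally have R_eq: "R x = Y y + s k *\<^sub>R u"
      by (simp add: R_def u_def c_def scaleR_diff_left scaleR_sum_right sum_subtractf)
    have "cinner (Y y) (q j) = 0" if "j < k" for j
      using residual_orthogonal[OF p that]
      by (simp add: cinner_cadjoint[OF bY] Yq cinner_scaleR_right y_def)
    then have "cinner (Y y) u = 0"
      by (simp add: u_def cinner.sum_right cinner_scaleC_right)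
    then have "(norm (R x))\<^sup>2 = (norm (Y y))\<^sup>2 + (s k)\<^sup>2 * (norm u)\<^sup>2"
      by (simp add: R_eq norm_add_sq cinner_scaleR_right power_mult_distrib)
    also have "(norm (Y y))\<^sup>2 \<le> (s k * norm y)\<^sup>2"
      unfolding y_def by (intro power_mono max residual_orthogonal[OF p]) auto
    also have "(norm u)\<^sup>2 \<le> (\<Sum>j<k. (cmod (cinner x (p j)))\<^sup>2)"
      unfolding u_def by (rule norm_orthosys_sum_le[OF q])
    finally have "(norm (R x))\<^sup>2 \<le> (s k)\<^sup>2 * ((norm y)\<^sup>2 + (\<Sum>j<k. (cmod (cinner x (p j)))\<^sup>2))"
      by (simp add: power_mult_distrib distrib_left mult_left_mono)
    also have "\<dots> = (s k * norm x)\<^sup>2"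
      unfolding y_def norm_residual_sq[OF p, of x k, symmetric] by (simp add: power_mult_distrib)
    finally show ?thesis by (rule power2_le_imp_le) (simp add: s(2))
  qed
  define h where "h j = (1 / sqrt 2) *\<^sub>R (q j, p j)" for j
  have norm_h: "(norm (h j))\<^sup>2 \<le> 1" for j
  proof -
    have "(norm (h j))\<^sup>2 = 1/2 * ((norm (q j))\<^sup>2 + (norm (p j))\<^sup>2)"
      unfolding h_def norm_scaleR power_mult_distrib norm_Pair_sq by (simp add: power_divide)
    then show ?thesis
      using orthosys_norm_le_1[OF p, of j] orthosys_norm_le_1[OF q, of j]
        power_le_one[of "norm (p j)" 2] power_le_one[of "norm (q j)" 2] by simp
  qed
  have summand: "2 * Re (cinner (Y (snd (e i))) (fst (e i))) \<le>
      (\<Sum>j<k. c j * (cmod (cinner (e i) (h j)))\<^sup>2) + s k" for i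
  proof -
    obtain a b where ab: "e i = (a, b)" by (cases "e i")
    have "2 * Re (cinner b (p j) * cinner (q j) a) \<le> (cmod (cinner (e i) (h j)))\<^sup>2" for j
    proof -
      have "cinner (e i) (h j) = of_real (1 / sqrt 2) * (cinner a (q j) + cinner b (p j))"
        by (simp add: ab h_def cinner_scaleR_right cinner_Pair del: scaleR_Pair)
      then have "(cmod (cinner (e i) (h j)))\<^sup>2 = 1/2 * (cmod (cinner a (q j) + cinner b (p j)))\<^sup>2"
        by (simp add: norm_mult norm_divide power_mult_distrib power_divide)
      then show ?thesis
        using four_Re_mult_cnj_le[of "cinner b (p j)" "cinner a (q j)"] cinner_commute[of "q j" a]
        by simp
    qed
    then have "c j * (2 * Re (cinner b (p j) * cinner (q j) a)) \<le> c j * (cmod (cinner (e i) (h j)))\<^sup>2"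
      if "j < k" for j using c0[OF that] by (intro mult_left_mono)
    then have 1: "(\<Sum>j<k. c j * (2 * Re (cinner b (p j) * cinner (q j) a))) \<le>
        (\<Sum>j<k. c j * (cmod (cinner (e i) (h j)))\<^sup>2)"
      by (intro sum_mono) auto
    have "2 * Re (cinner (R b) a) \<le> 2 * (s k * norm b * norm a)"
      using cauchy_schwarz[of "R b" a] complex_Re_le_cmod[of "cinner (R b) a"]
        mult_right_mono[OF norm_R[of b], of "norm a"] by simp
    also have "\<dots> = s k * (2 * norm a * norm b)" by simp
    also have "\<dots> \<le> s k * ((norm a)\<^sup>2 + (norm b)\<^sup>2)"
      by (intro mult_left_mono sum_squares_bound s)
    also have "\<dots> = s k * (norm (e i))\<^sup>2" by (simp only: ab norm_Pair_sq)
    also have "\<dots> \<le> s k"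
      using bessel_norm_le_1[OF e, of i] by (intro mult_left_le s) (simp add: power_le_one)
    finally have 2: "2 * Re (cinner (R b) a) \<le> s k" .
    have "Y b = (\<Sum>j<k. c j *\<^sub>R (cinner b (p j) *\<^sub>C q j)) + R b" by (simp add: R_def)
    moreover have "Re (of_real r * z) = r * Re z" for r z by simp
    ultimately have "2 * Re (cinner (Y b) a) =
        (\<Sum>j<k. c j * (2 * Re (cinner b (p j) * cinner (q j) a))) + 2 * Re (cinner (R b) a)"
      by (simp add: cinner_add_left cinner.sum_left cinner_scaleR_left cinner_scaleC_left
          sum_distrib_left mult.left_commute del: times_complex.simps(1))
    then show ?thesis using 1 2 by (simp add: ab)
  qed
  have "(\<Sum>i<k. 2 * Re (cinner (Y (snd (e i))) (fst (e i)))) \<le>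
      (\<Sum>i<k. (\<Sum>j<k. c j * (cmod (cinner (e i) (h j)))\<^sup>2) + s k)"
    by (intro sum_mono summand)
  also have "\<dots> = (\<Sum>j<k. c j * (\<Sum>i<k. (cmod (cinner (e i) (h j)))\<^sup>2)) + k * s k"
    unfolding sum.distrib sum_distrib_left by (subst sum.swap) simp
  also have "(\<Sum>j<k. c j * (\<Sum>i<k. (cmod (cinner (e i) (h j)))\<^sup>2)) \<le> (\<Sum>j<k. c j * 1)"
    by (intro sum_mono mult_left_mono c0 order_trans[OF besselD[OF e] norm_h]) auto
  also have "(\<Sum>j<k. c j * 1) + k * s k = ky_fan k Y"
    by (simp add: ky_fan_def c_def s_def sum_subtractf)
  finally show ?thesis by simp
qed

text \<open>The bound of the preceding lemma is attained, simultaneously for all \<open>k\<close>, at the vectors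
  \<open>(q\<^sub>i, p\<^sub>i) / \<surd>2\<close>. So the Ky Fan norms are maxima of functionals that are linear in \<open>Y\<close>, which is how
  all their properties are derived.\<close>

lemma ky_fan_attained:
  fixes Y :: "'a::chilbert_space \<Rightarrow> 'a"
  assumes Y: "compact_op Y"
  shows "\<exists>e. bessel e \<and> (\<forall>k. ky_fan k Y = (\<Sum>i<k. 2 * Re (cinner (Y (snd (e i))) (fst (e i)))))"
proof -
  define s where "s = singular_values Y"
  obtain p q where svd: "singular_system Y s p q"
    using singular_value_decomposition[OF Y] unfolding s_def by blast
  note s = singular_systemD(1,2)[OF svd] and p = singular_systemD(3)[OF svd]
    and q = singular_systemD(4)[OF svd] and p0 = singular_systemD(5)[OF svd]
    and q0 = singular_systemD(6)[OF svd] and Yp = singular_systemD(7)[OF svd]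
    and Yq = singular_systemD(8)[OF svd] and max = singular_systemD(9)[OF svd]
  define e where "e j = (1 / sqrt 2) *\<^sub>R (q j, p j)" for j
  have "orthosys e"
    unfolding orthosys_def
  proof (intro allI)
    fix i j
    have "cinner (e i) (e j) = of_real (1 / sqrt 2 * (1 / sqrt 2)) * (cinner (q i) (q j) + cinner (p i) (p j))"
      by (simp only: e_def cinner_scaleR_left cinner_scaleR_right cinner_Pair of_real_mult mult.assoc)
    also have "1 / sqrt 2 * (1 / sqrt 2) = (1/2 :: real)" by simp
    also have "of_real (1/2) * (cinner (q i) (q j) + cinner (p i) (p j)) = of_bool (i = j \<and> s i \<noteq> 0)"
      by (simp add: orthosysD[OF p] orthosysD[OF q] p0 q0)
    also have "s i \<noteq> 0 \<longleftrightarrow> e i \<noteq> 0" by (simp add: e_def p0 q0 zero_prod_def)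
    finally show "cinner (e i) (e j) = of_bool (i = j \<and> e i \<noteq> 0)" .
  qed
  moreover have "2 * Re (cinner (Y (snd (e i))) (fst (e i))) = s i" for i
  proof -
    have "cinner (Y (snd (e i))) (fst (e i)) = of_real (1 / sqrt 2 * (1 / sqrt 2)) * (s i * cinner (q i) (q i))"
      by (simp only: e_def scaleR_Pair fst_conv snd_conv bounded_clinearD(5)[OF compact_op_bounded[OF Y]]
          Yp cinner_scaleR_left cinner_scaleR_right of_real_mult mult.assoc)
    also have "1 / sqrt 2 * (1 / sqrt 2) = (1/2 :: real)" by simp
    finally have eq: "cinner (Y (snd (e i))) (fst (e i)) = of_real (1/2) * (s i * cinner (q i) (q i))" .
    show ?thesis unfolding eq by (cases "s i = 0") (simp_all add: orthosysD[OF q] q0)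
  qed
  ultimately show ?thesis
    using bessel_if_orthosys by (intro exI[of _ e]) (simp add: ky_fan_def s_def)
qed

lemma ky_fan_add_le:
  assumes Y: "compact_op Y" and Z: "compact_op Z"
  shows "ky_fan k (\<lambda>x. Y x + Z x) \<le> ky_fan k Y + ky_fan k Z"
proof -
  obtain e where e: "bessel e"
    "ky_fan k (\<lambda>x. Y x + Z x) = (\<Sum>i<k. 2 * Re (cinner (Y (snd (e i)) + Z (snd (e i))) (fst (e i))))"
    using ky_fan_attained[OF compact_op_add[OF Y Z]] by blast
  show ?thesis
    unfolding e(2) using ky_fan_upper[OF Y e(1), of k] ky_fan_upper[OF Z e(1), of k]
    by (simp add: cinner_add_left distrib_left sum.distrib)
qed

lemma bessel_contraction:
  assumes e: "bessel e" and C: "bounded_clinear C" "\<And>x. norm (C x) \<le> norm x"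
    and D: "bounded_clinear D" "\<And>x. norm (D x) \<le> norm x"
  shows "bessel (\<lambda>i. (C (fst (e i)), D (snd (e i))))"
  unfolding bessel_def
proof (intro allI)
  fix h :: "'a \<times> 'b" and k
  define h' where "h' = (cadjoint C (fst h), cadjoint D (snd h))"
  have "cinner (C (fst (e i)), D (snd (e i))) h = cinner (e i) h'" for i
    by (simp add: cinner_prod_def h'_def cinner_cadjoint[OF C(1)] cinner_cadjoint[OF D(1)])
  then have "(\<Sum>i<k. (cmod (cinner (C (fst (e i)), D (snd (e i))) h))\<^sup>2) \<le> (norm h')\<^sup>2"
    by (simp add: besselD[OF e])
  also have "\<dots> \<le> (norm (fst h))\<^sup>2 + (norm (snd h))\<^sup>2"
    unfolding h'_def norm_Pair_sq
    using norm_cadjoint_le[OF C(1), of 1 "fst h"] norm_cadjoint_le[OF D(1), of 1 "snd h"] C(2) D(2)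
    by (intro add_mono power_mono) auto
  also have "\<dots> = (norm h)\<^sup>2" by (simp add: norm_Pair_sq[symmetric])
  finally show "(\<Sum>i<k. (cmod (cinner (C (fst (e i)), D (snd (e i))) h))\<^sup>2) \<le> (norm h)\<^sup>2" .
qed

text \<open>\<open>C\<close> and \<open>D\<close> are moved onto the test vectors; after division by \<open>c\<close> and \<open>d\<close> they are contractions and
  preserve Bessel systems.\<close>

lemma ky_fan_comp_le:
  assumes Y: "compact_op Y"
    and C: "bounded_clinear C" "\<And>x. norm (C x) \<le> c * norm x" "0 \<le> c"
    and D: "bounded_clinear D" "\<And>x. norm (D x) \<le> d * norm x" "0 \<le> d"
  shows "ky_fan k (\<lambda>x. C (Y (D x))) \<le> c * d * ky_fan k Y"
proof -
  note bY = compact_op_bounded[OF Y]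
  obtain e where e: "bessel e"
    "ky_fan k (\<lambda>x. C (Y (D x))) = (\<Sum>i<k. 2 * Re (cinner (C (Y (D (snd (e i))))) (fst (e i))))"
    using ky_fan_attained[OF compact_op_comp[OF C(1) Y D(1)]] by blast
  show ?thesis
  proof (cases "c = 0 \<or> d = 0")
    case True
    then have "C (Y (D x)) = 0" for x
      using C(2)[of "Y (D x)"] D(2)[of x] by (auto simp: bounded_clinearD[OF bY] bounded_clinearD[OF C(1)])
    then show ?thesis unfolding e(2) using True by auto
  next
    case False
    then have cd: "0 < c" "0 < d" using C(3) D(3) by auto
    define f where "f i = ((1 / c) *\<^sub>R cadjoint C (fst (e i)), (1 / d) *\<^sub>R D (snd (e i)))" for i
    have f: "bessel f"
      unfolding f_def
    proof (rule bessel_contraction[OF e(1)])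
      show "bounded_clinear (\<lambda>x. (1 / c) *\<^sub>R cadjoint C x)" "bounded_clinear (\<lambda>x. (1 / d) *\<^sub>R D x)"
        by (intro bounded_clinear_scaleR bounded_clinear_cadjoint C D)+
      show "norm ((1 / c) *\<^sub>R cadjoint C x) \<le> norm x" for x
        using norm_cadjoint_le[OF C(1-3), of x] cd by (simp add: field_simps)
      show "norm ((1 / d) *\<^sub>R D x) \<le> norm x" for x
        using D(2)[of x] cd by (simp add: field_simps)
    qed
    have "2 * Re (cinner (C (Y (D (snd (e i))))) (fst (e i))) =
        c * d * (2 * Re (cinner (Y (snd (f i))) (fst (f i))))" for i
      using cd by (simp add: f_def cinner_cadjoint[OF C(1)] bounded_clinearD[OF bY]
          cinner_scaleR_left cinner_scaleR_right)
    then have "ky_fan k (\<lambda>x. C (Y (D x))) =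
        c * d * (\<Sum>i<k. 2 * Re (cinner (Y (snd (f i))) (fst (f i))))"
      unfolding e(2) sum_distrib_left by (intro sum.cong) simp_all
    also have "\<dots> \<le> c * d * ky_fan k Y"
      using cd by (intro mult_left_mono ky_fan_upper[OF Y f]) auto
    finally show ?thesis .
  qed
qed

section \<open>The arithmetic-geometric mean inequality\<close>

lemma bounded_clinear_offdiagonal:
  assumes U: "bounded_clinear U" and V: "bounded_clinear V"
  shows "bounded_clinear (\<lambda>x. (U (snd x), V (fst x)))"
proof (rule bounded_clinearI)
  fix x y :: "'a \<times> 'a" and c
  show "(U (snd (x + y)), V (fst (x + y))) = (U (snd x), V (fst x)) + (U (snd y), V (fst y))"
    by (simp add: bounded_clinearD[OF U] bounded_clinearD[OF V])
  show "(U (snd (c *\<^sub>C x)), V (fst (c *\<^sub>C x))) = c *\<^sub>C (U (snd x), V (fst x))"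
    by (simp add: bounded_clinearD[OF U] bounded_clinearD[OF V] scaleC_prod_def)
  have "norm (U (snd x), V (fst x)) \<le> norm (U (snd x)) + norm (V (fst x))" by (rule norm_Pair_le)
  also have "\<dots> \<le> onorm U * norm (snd x) + onorm V * norm (fst x)"
    by (intro add_mono bounded_clinearD(9) U V)
  also have "\<dots> \<le> onorm U * norm x + onorm V * norm x"
    by (intro add_mono mult_left_mono onorm_nonneg U V) (metis norm_fst_le norm_snd_le prod.collapse)+
  finally show "norm (U (snd x), V (fst x)) \<le> (onorm U + onorm V) * norm x"
    by (simp add: distrib_right)
qed

text \<open>Let \<open>S = A X B\<close> with singular vectors \<open>p\<^sub>i\<close>, \<open>q\<^sub>i\<close> and singular values \<open>s\<^sub>i\<close>. The vectors
  \<open>w\<^sub>i = (A q\<^sub>i, B p\<^sub>i)\<close> satisfy \<open>T w\<^sub>i = s\<^sub>i w\<^sub>i\<close> for \<open>T (a, b) = (A\<^sup>2 X b, B\<^sup>2 X\<^sup>* a)\<close>. They are linearly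
  independent as long as \<open>s\<^sub>i > 0\<close>, since \<open>(a, b) \<mapsto> (A X b, B X\<^sup>* a)\<close> maps them to multiples of the
  orthogonal vectors \<open>(q\<^sub>i, p\<^sub>i)\<close>. Triangularising \<open>T\<close> on them gives an orthonormal system \<open>(a\<^sub>i, b\<^sub>i)\<close>
  with \<open>s\<^sub>i = Re (cinner (T (a\<^sub>i, b\<^sub>i)) (a\<^sub>i, b\<^sub>i)) = Re (cinner ((A\<^sup>2 X + X B\<^sup>2) b\<^sub>i) a\<^sub>i)\<close>. Twice the sum of the
  right-hand sides is bounded by the Ky Fan norm of \<open>A\<^sup>2 X + X B\<^sup>2\<close>.\<close>

theorem ky_fan_arith_geo_mean:
  fixes A B X :: "'a::chilbert_space \<Rightarrow> 'a"
  assumes A: "positive_op A" and B: "positive_op B" and X: "compact_op X"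
  shows "2 * ky_fan k (\<lambda>x. A (X (B x))) \<le> ky_fan k (\<lambda>x. A (A (X x)) + X (B (B x)))"
proof -
  note bA = positive_op_bounded[OF A] and bB = positive_op_bounded[OF B] and bX = compact_op_bounded[OF X]
  note bX' = bounded_clinear_cadjoint[OF bX]
  define S where "S = (\<lambda>x. A (X (B x)))"
  define Y where "Y = (\<lambda>x. A (A (X x)) + X (B (B x)))"
  have cS: "compact_op S" unfolding S_def by (rule compact_op_comp[OF bA X bB])
  have bAA: "bounded_clinear (\<lambda>x. A (A x))" and bBB: "bounded_clinear (\<lambda>x. B (B x))"
    by (rule bounded_clinear_comp[OF bA bA] bounded_clinear_comp[OF bB bB])+
  have cY: "compact_op Y"
    unfolding Y_def
    by (rule compact_op_add[OF compact_op_comp[OF bAA X bounded_clinear_id]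
          compact_op_comp[OF bounded_clinear_id X bBB]])
  have S': "cadjoint S = (\<lambda>x. B (cadjoint X (A x)))"
    by (rule cadjoint_eqI)
      (simp add: S_def positive_op_self_adjoint[OF A] cinner_cadjoint[OF bX] positive_op_self_adjoint[OF B])
  define s where "s = singular_values S"
  obtain p q where svd: "singular_system S s p q"
    using singular_value_decomposition[OF cS] unfolding s_def by blast
  note s = singular_systemD(1,2)[OF svd] and p = singular_systemD(3)[OF svd]
    and q = singular_systemD(4)[OF svd] and p0 = singular_systemD(5)[OF svd]
    and q0 = singular_systemD(6)[OF svd] and Yp = singular_systemD(7)[OF svd]
    and Yq = singular_systemD(8)[OF svd] and max = singular_systemD(9)[OF svd]
  \<comment> \<open>Only the nonzero singular values yield independent vectors; \<open>r\<close> counts those among the first \<open>k\<close>.\<close>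
  have "\<exists>r. (\<forall>i<r. 0 < s i) \<and> (\<forall>i<k. r \<le> i \<longrightarrow> s i = 0)"
  proof (induction k)
    case (Suc k)
    then obtain r where r: "\<forall>i<r. 0 < s i" "\<forall>i<k. r \<le> i \<longrightarrow> s i = 0" by blast
    show ?case
    proof (cases "s k = 0")
      case True
      then show ?thesis using r by (intro exI[of _ r]) (auto simp: less_Suc_eq)
    next
      case False
      then have "0 < s i" if "i < Suc k" for i
        using antimonoD[OF s(1), of i k] s(2)[of k] that by fastforce
      then show ?thesis by (intro exI[of _ "Suc k"]) auto
    qed
  qed auto
  then obtain r where r: "\<And>i. i < r \<Longrightarrow> 0 < s i" "\<And>i. i < k \<Longrightarrow> r \<le> i \<Longrightarrow> s i = 0" by blast
  define T where "T x = (A (A (X (snd x))), B (B (cadjoint X (fst x))))" for x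
  define M where "M x = (A (X (snd x)), B (cadjoint X (fst x)))" for x
  define w where "w i = (A (q i), B (p i))" for i
  have bT: "bounded_clinear T"
    unfolding T_def
    by (rule bounded_clinear_offdiagonal[OF bounded_clinear_comp[OF bAA bX] bounded_clinear_comp[OF bBB bX']])
  have bM: "bounded_clinear M"
    unfolding M_def
    by (rule bounded_clinear_offdiagonal[OF bounded_clinear_comp[OF bA bX] bounded_clinear_comp[OF bB bX']])
  have Mw: "M (w i) = s i *\<^sub>R (q i, p i)" for i
    using Yp[of i] Yq[of i] unfolding S' by (simp add: M_def w_def S_def)
  have Tw: "T (w i) = s i *\<^sub>R w i" for i
  proof -
    have T_M: "T x = (A (fst (M x)), B (snd (M x)))" for x by (simp add: T_def M_def)
    show ?thesis unfolding T_M Mw by (simp add: w_def bounded_clinearD[OF bA] bounded_clinearD[OF bB])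
  qed
  have indep: "w i \<notin> cvec.span (w ` {..<i})" if i: "i < r" for i
  proof
    assume w: "w i \<in> cvec.span (w ` {..<i})"
    have "cinner (M x) (q i, p i) = 0" if "x \<in> cvec.span (w ` {..<i})" for x
      using that
    proof (induction rule: cvec.span_induct_alt)
      case base
      show ?case by (simp add: bounded_clinearD[OF bM])
    next
      case (step c x y)
      then obtain j where "j < i" "x = w j" by auto
      then have "cinner (M x) (q i, p i) = 0"
        by (simp add: Mw cinner_Pair cinner_scaleR_left orthosysD[OF p] orthosysD[OF q])
      then show ?case using step by (simp add: bounded_clinearD[OF bM] cinner_add_left cinner_scaleC_left)
    qed
    from this[OF w] have "s i = 0"
      by (simp add: Mw cinner_Pair cinner_scaleR_left orthosysD[OF p] orthosysD[OF q] p0 q0)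
    then show False using r(1)[OF i] by simp
  qed
  obtain e where e: "orthosys e" "\<And>i. r \<le> i \<Longrightarrow> e i = 0"
    "\<And>i. i < r \<Longrightarrow> cinner (T (e i)) (e i) = of_real (s i)"
    using orthonormal_triangularisation[OF bT Tw indep, of r] by auto
  have ReT: "Re (cinner (T x) x) = Re (cinner (Y (snd x)) (fst x))" for x
  proof -
    have "cinner (B (B (cadjoint X (fst x)))) (snd x) = cinner (fst x) (X (B (B (snd x))))"
      by (simp add: positive_op_self_adjoint[OF B] cinner_cadjoint'[OF bX])
    then show ?thesis
      using Re_cinner_commute[of "fst x" "X (B (B (snd x)))"]
      by (simp add: T_def Y_def cinner_prod_def cinner_add_left)
  qed
  have "2 * s i = 2 * Re (cinner (Y (snd (e i))) (fst (e i)))" if "i < k" for i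
  proof (cases "i < r")
    case True
    then show ?thesis using e(3)[OF True] by (simp add: ReT[symmetric])
  next
    case False
    then show ?thesis using e(2)[of i] r(2)[OF that] by simp
  qed
  then have "2 * ky_fan k S = (\<Sum>i<k. 2 * Re (cinner (Y (snd (e i))) (fst (e i))))"
    unfolding ky_fan_def sum_distrib_left s_def[symmetric] by (intro sum.cong) auto
  also have "\<dots> \<le> ky_fan k Y"
    by (rule ky_fan_upper[OF cY bessel_if_orthosys[OF e(1)]])
  finally show ?thesis by (simp add: S_def Y_def)
qed

section \<open>Symmetric gauge functions and majorisation\<close>

lemma fin_supp_mult: "fin_supp a \<Longrightarrow> fin_supp (\<lambda>n. c n * a n)"
  unfolding fin_supp_def by (rule finite_subset[of _ "{n. a n \<noteq> 0}"]) auto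

lemma fin_supp_if_zero_from: "(\<And>i. i \<ge> n \<Longrightarrow> a i = 0) \<Longrightarrow> fin_supp a"
  unfolding fin_supp_def by (rule finite_subset[of _ "{..<n}"]) (auto simp: not_le[symmetric])

text \<open>The real number behind the extended-valued norm; the two agree on the ideal.\<close>

definition ideal_norm :: "((nat \<Rightarrow> real) \<Rightarrow> real) \<Rightarrow> ('a::chilbert_space \<Rightarrow> 'a) \<Rightarrow> real" where
  "ideal_norm g Y = enn2real (ui_norm g Y)"

context
  fixes g assumes g: "symmetric_gauge g"
begin

lemma gauge_nonneg: "fin_supp a \<Longrightarrow> 0 \<le> g a"
  using g by (simp add: symmetric_gauge_def)

lemma gauge_scale: "fin_supp a \<Longrightarrow> g (\<lambda>n. c * a n) = \<bar>c\<bar> * g a"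
  using g by (simp add: symmetric_gauge_def)

lemma gauge_add_le: "fin_supp a \<Longrightarrow> fin_supp b \<Longrightarrow> g (\<lambda>n. a n + b n) \<le> g a + g b"
  using g by (simp add: symmetric_gauge_def)

lemma gauge_permute: "fin_supp a \<Longrightarrow> bij \<pi> \<Longrightarrow> g (\<lambda>n. a (\<pi> n)) = g a"
  using g by (simp add: symmetric_gauge_def comp_def)

lemma gauge_signs: "fin_supp a \<Longrightarrow> (\<And>n. \<epsilon> n = 1 \<or> \<epsilon> n = -1) \<Longrightarrow> g (\<lambda>n. \<epsilon> n * a n) = g a"
  using g by (simp add: symmetric_gauge_def)

lemma gauge_convex_le:
  assumes "fin_supp a" "fin_supp b" "g b = g a" "0 \<le> u" "0 \<le> v" "u + v = 1"
  shows "g (\<lambda>n. u * a n + v * b n) \<le> g a"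
proof -
  have "g (\<lambda>n. u * a n + v * b n) \<le> g (\<lambda>n. u * a n) + g (\<lambda>n. v * b n)"
    by (intro gauge_add_le fin_supp_mult assms)
  also have "\<dots> = u * g a + v * g a" using assms by (simp add: gauge_scale)
  also have "\<dots> = (u + v) * g a" by (rule distrib_right[symmetric])
  finally show ?thesis using assms(6) by simp
qed

text \<open>Write \<open>a = t b\<close> with \<open>\<bar>t\<bar> \<le> 1\<close> and shrink one coordinate at a time: multiplying a coordinate by a number
  in \<open>[-1, 1]\<close> is a convex combination of leaving it alone and changing its sign.\<close>

lemma gauge_mono:
  assumes b: "fin_supp b" and le: "\<And>n. \<bar>a n\<bar> \<le> \<bar>b n\<bar>"
  shows "g a \<le> g b"
proof -
  have "\<exists>t. \<bar>t\<bar> \<le> 1 \<and> a n = t * b n" for n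
  proof (cases "b n = 0")
    case False
    then show ?thesis using le[of n] by (intro exI[of _ "a n / b n"]) simp
  next
    case True
    then show ?thesis using le[of n] by (intro exI[of _ 0]) simp
  qed
  then obtain t where t: "\<And>n. \<bar>t n\<bar> \<le> 1" "\<And>n. a n = t n * b n" by metis
  have "g (\<lambda>n. (if n \<in> S then t n else 1) * b n) \<le> g b" if "finite S" for S
    using that
  proof (induction S)
    case (insert m S)
    define c where "c = (\<lambda>n. (if n \<in> S then t n else 1) * b n)"
    have c: "fin_supp c" unfolding c_def by (rule fin_supp_mult[OF b])
    define d where "d = (\<lambda>n. (if n = m then -1 else 1) * c n)"
    have gd: "g d = g c" unfolding d_def by (rule gauge_signs[OF c]) auto
    have "fin_supp d" unfolding d_def by (rule fin_supp_mult[OF c])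
    then have "g (\<lambda>n. ((1 + t m) / 2) * c n + ((1 - t m) / 2) * d n) \<le> g c"
      using t(1)[of m] by (intro gauge_convex_le c gd) (auto simp: abs_le_iff field_simps)
    also have "(\<lambda>n. ((1 + t m) / 2) * c n + ((1 - t m) / 2) * d n) =
        (\<lambda>n. (if n \<in> insert m S then t n else 1) * b n)"
      using insert.hyps by (auto simp: c_def d_def fun_eq_iff field_simps)
    finally show ?case using insert.IH by (simp add: c_def)
  qed simp
  from this[of "{n. b n \<noteq> 0}"]
  have "g (\<lambda>n. (if b n \<noteq> 0 then t n else 1) * b n) \<le> g b" using b by (simp add: fin_supp_def)
  also have "(\<lambda>n. (if b n \<noteq> 0 then t n else 1) * b n) = a" by (auto simp: t(2))
  finally show ?thesis .
qed

text \<open>If \<open>x \<le> y\<close> fails pointwise, let \<open>k\<close> be the first index with \<open>y\<^sub>k < x\<^sub>k\<close> and \<open>i\<close> the last index before it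
  with \<open>x\<^sub>i < y\<^sub>i\<close>; it exists because the partial sums of \<open>x\<close> are dominated. Moving a mass \<open>\<delta>\<close> from
  \<open>y\<^sub>i\<close> to \<open>y\<^sub>k\<close> replaces \<open>y\<close> by a convex combination of \<open>y\<close> and a transposition of it, so the gauge
  does not grow. With \<open>\<delta>\<close> as large as \<open>x\<close> permits, the partial sums still dominate and one more
  coordinate agrees with \<open>x\<close>. The process ends with \<open>x \<le> y\<close>.\<close>

lemma gauge_weak_majorisation:
  fixes x y :: "nat \<Rightarrow> real"
  assumes x: "antimono x" "\<And>i. 0 \<le> x i" "\<And>i. i \<ge> n \<Longrightarrow> x i = 0"
    and y: "\<And>i. i \<ge> n \<Longrightarrow> y i = 0"
    and sums: "\<And>k. (\<Sum>i<k. x i) \<le> (\<Sum>i<k. y i)"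
  shows "g x \<le> g y"
  using y sums
proof (induction "card {i. x i \<noteq> y i}" arbitrary: y rule: less_induct)
  case (less y)
  note y = less.prems(1) and sums = less.prems(2)
  have fy: "fin_supp y" by (rule fin_supp_if_zero_from[OF y])
  show ?case
  proof (cases "\<forall>i. x i \<le> y i")
    case True
    have "\<bar>x i\<bar> \<le> \<bar>y i\<bar>" for i using True[rule_format, of i] x(2)[of i] by simp
    then show ?thesis by (rule gauge_mono[OF fy])
  next
    case False
    then obtain k0 where "y k0 < x k0" by (auto simp: not_le)
    define k where "k = (LEAST k. y k < x k)"
    have k: "y k < x k" unfolding k_def by (rule LeastI) fact
    have before_k: "x j \<le> y j" if "j < k" for j
      using not_less_Least[of j "\<lambda>k. y k < x k"] that by (simp add: k_def not_less)
    have "\<exists>i<k. x i < y i"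
    proof (rule ccontr)
      assume "\<not> ?thesis"
      then have "x j = y j" if "j < k" for j using before_k[OF that] that by force
      then have "(\<Sum>j<k. x j) = (\<Sum>j<k. y j)" by simp
      then show False using sums[of "Suc k"] k by simp
    qed
    define i where "i = Max {i. i < k \<and> x i < y i}"
    have i: "i < k" "x i < y i" and after_i: "j \<le> i" if "j < k" "x j < y j" for j
    proof -
      have fin: "finite {i. i < k \<and> x i < y i}" by simp
      have "i \<in> {i. i < k \<and> x i < y i}" unfolding i_def by (rule Max_in[OF fin]) (use that in auto)
      then show "i < k" "x i < y i" by auto
      show "j \<le> i" unfolding i_def using that by (intro Max_ge fin) auto
    qed
    from \<open>\<exists>i<k. x i < y i\<close> i have i: "i < k" "x i < y i" by blast+
    have between: "x j = y j" if "i < j" "j < k" for j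
      using before_k[OF that(2)] after_i[OF that(2)] that(1) by force
    have xki: "x k \<le> x i" using antimonoD[OF x(1), of i k] i by simp
    define \<delta> where "\<delta> = min (y i - x i) (x k - y k)"
    have \<delta>: "0 < \<delta>" "\<delta> \<le> y i - x i" "\<delta> \<le> x k - y k" using i k by (auto simp: \<delta>_def)
    define y' where "y' j = y j - (if j = i then \<delta> else 0) + (if j = k then \<delta> else 0)" for j
    have "k < n" using k x(3)[of k] y[of k] by (cases "k < n") auto
    have y': "y' j = 0" if "j \<ge> n" for j
      using that \<open>k < n\<close> i y[OF that] by (simp add: y'_def)
    have sum_y': "(\<Sum>j<m. y' j) = (\<Sum>j<m. y j) - (if i < m then \<delta> else 0) + (if k < m then \<delta> else 0)" for m
      unfolding y'_def sum.distrib sum_subtractf by (simp add: sum.delta)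
    have sums': "(\<Sum>j<m. x j) \<le> (\<Sum>j<m. y' j)" for m
    proof (cases "i < m \<and> m \<le> k")
      case True
      have "(\<Sum>j<m. y j - x j) = (\<Sum>j<Suc i. y j - x j)"
        using True between by (intro sum.mono_neutral_right) auto
      also have "\<dots> = ((\<Sum>j<i. y j) - (\<Sum>j<i. x j)) + (y i - x i)" by (simp add: sum_subtractf)
      finally have "(\<Sum>j<m. y j) - (\<Sum>j<m. x j) \<ge> \<delta>"
        using sums[of i] \<delta>(2) unfolding sum_subtractf by linarith
      then show ?thesis using True by (simp add: sum_y')
    next
      case False
      then show ?thesis using sums[of m] i by (auto simp: sum_y')
    qed
    define D where "D = {j. x j \<noteq> y j}"
    have "D \<subseteq> {..<n}"
    proof
      fix j assume "j \<in> D"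
      then show "j \<in> {..<n}" by (cases "j < n") (auto simp: D_def not_less x(3) y)
    qed
    then have "finite D" by (rule finite_subset) simp
    moreover have "{j. x j \<noteq> y' j} \<subset> D"
    proof -
      have "y' i = x i \<or> y' k = x k" using i \<delta>(1) by (auto simp: y'_def \<delta>_def min_def)
      moreover have D_ik: "i \<in> D" "k \<in> D" using i k by (auto simp: D_def)
      ultimately have "{j. x j \<noteq> y' j} \<noteq> D" by force
      moreover have "j \<in> D" if "x j \<noteq> y' j" for j
        using that D_ik by (cases "j = i \<or> j = k") (auto simp: y'_def D_def)
      ultimately show ?thesis by auto
    qed
    ultimately have "card {j. x j \<noteq> y' j} < card {j. x j \<noteq> y j}"
      unfolding D_def[symmetric] by (rule psubset_card_mono)
    then have "g x \<le> g y'" using y' sums' by (rule less.hyps)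
    also have "g y' \<le> g y"
    proof -
      define z where "z = (\<lambda>j. y (Transposition.transpose i k j))"
      have gz: "g z = g y" unfolding z_def by (rule gauge_permute[OF fy bij_transpose])
      have fz: "fin_supp z"
        by (rule fin_supp_if_zero_from[of n]) (use \<open>k < n\<close> i y in \<open>auto simp: z_def Transposition.transpose_def\<close>)
      \<comment> \<open>Both \<open>y i - x i\<close> and \<open>x k - y k\<close> are at least \<open>\<delta>\<close>, so the weight \<open>l\<close> lies in \<open>[0, 1]\<close>.\<close>
      define l where "l = \<delta> / (y i - y k)"
      have yik: "\<delta> \<le> y i - y k" using \<delta> xki by linarith
      then have l: "0 \<le> l" "l \<le> 1" using \<delta>(1) by (auto simp: l_def)
      have lm: "l * (y i - y k) = \<delta>" using yik \<delta>(1) by (simp add: l_def)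
      have "y' j = (1 - l) * y j + l * z j" for j
      proof -
        consider "j = i" | "j = k" | "j \<noteq> i" "j \<noteq> k" by blast
        then show ?thesis
        proof cases
          case 1
          then show ?thesis using lm i by (simp add: y'_def z_def algebra_simps)
        next
          case 2
          then show ?thesis using lm i by (simp add: y'_def z_def algebra_simps)
        next
          case 3
          then show ?thesis by (simp add: y'_def z_def Transposition.transpose_def algebra_simps)
        qed
      qed
      then have "y' = (\<lambda>j. (1 - l) * y j + l * z j)" by blast
      then show ?thesis using gauge_convex_le[OF fy fz gz, of "1 - l" l] l by simp
    qed
    finally show ?thesis .
  qed
qed

lemma gauge_ext_weak_majorisation:
  assumes x: "antimono x" "\<And>i. 0 \<le> x i" and sums: "\<And>k. (\<Sum>i<k. x i) \<le> (\<Sum>i<k. y i)"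
  shows "gauge_ext g x \<le> gauge_ext g y"
  unfolding gauge_ext_def
proof (rule SUP_mono)
  fix n
  let ?t = "\<lambda>(z :: nat \<Rightarrow> real) k. if k < n then z k else (0::real)"
  have sum_t: "(\<Sum>i<k. ?t z i) = (\<Sum>i<min k n. z i)" for z k
  proof -
    have "(\<Sum>i<k. ?t z i) = (\<Sum>i\<in>{..<k} \<inter> {i. i < n}. z i)" by (simp add: sum.inter_restrict)
    also have "{..<k} \<inter> {i. i < n} = {..<min k n}" by auto
    finally show ?thesis .
  qed
  have "g (?t x) \<le> g (?t y)"
  proof (rule gauge_weak_majorisation[of _ n])
    show "antimono (?t x)" by (rule antimonoI) (use antimonoD[OF x(1)] x(2) in auto)
  qed (use x sums sum_t in auto)
  then show "\<exists>m\<in>UNIV. ennreal (g (?t x)) \<le> ennreal (g (\<lambda>k. if k < m then y k else 0))"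
    by (intro bexI[of _ n] ennreal_leI) auto
qed

lemma gauge_ext_add_le: "gauge_ext g (\<lambda>n. a n + b n) \<le> gauge_ext g a + gauge_ext g b"
  unfolding gauge_ext_def
proof (rule SUP_least)
  fix n
  let ?t = "\<lambda>(z :: nat \<Rightarrow> real) k. if k < n then z k else (0::real)"
  have fin: "fin_supp (?t z)" for z by (rule fin_supp_if_zero_from[of n]) auto
  have "?t (\<lambda>n. a n + b n) = (\<lambda>k. ?t a k + ?t b k)" by auto
  then have "g (?t (\<lambda>n. a n + b n)) \<le> g (?t a) + g (?t b)" using gauge_add_le[OF fin fin] by simp
  then have "ennreal (g (?t (\<lambda>n. a n + b n))) \<le> ennreal (g (?t a)) + ennreal (g (?t b))"
    by (simp add: ennreal_plus[symmetric] gauge_nonneg fin ennreal_leI del: ennreal_plus)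
  also have "\<dots> \<le> (SUP n. ennreal (g (\<lambda>k. if k < n then a k else 0))) +
      (SUP n. ennreal (g (\<lambda>k. if k < n then b k else 0)))"
    by (intro add_mono SUP_upper) auto
  finally show "ennreal (g (?t (\<lambda>n. a n + b n))) \<le> (SUP n. ennreal (g (\<lambda>k. if k < n then a k else 0))) +
      (SUP n. ennreal (g (\<lambda>k. if k < n then b k else 0)))" .
qed

lemma gauge_ext_scale_le:
  assumes "0 \<le> c"
  shows "gauge_ext g (\<lambda>n. c * a n) \<le> ennreal c * gauge_ext g a"
  unfolding gauge_ext_def
proof (rule SUP_least)
  fix n
  let ?t = "\<lambda>(z :: nat \<Rightarrow> real) k. if k < n then z k else (0::real)"
  have fin: "fin_supp (?t z)" for z by (rule fin_supp_if_zero_from[of n]) auto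
  have "?t (\<lambda>n. c * a n) = (\<lambda>k. c * ?t a k)" by auto
  then have "ennreal (g (?t (\<lambda>n. c * a n))) = ennreal c * ennreal (g (?t a))"
    using assms by (simp add: gauge_scale[OF fin] ennreal_mult gauge_nonneg[OF fin])
  also have "\<dots> \<le> ennreal c * (SUP n. ennreal (g (\<lambda>k. if k < n then a k else 0)))"
    by (intro mult_left_mono SUP_upper) auto
  finally show "ennreal (g (?t (\<lambda>n. c * a n))) \<le> ennreal c * (SUP n. ennreal (g (\<lambda>k. if k < n then a k else 0)))" .
qed

section \<open>The norm ideal\<close>

lemma ideal_norm_nonneg: "0 \<le> ideal_norm g Y"
  by (simp add: ideal_norm_def)

text \<open>Ky Fan's dominance principle, with an arbitrary sequence in place of the singular values of a second
  operator, so that sums and multiples of singular value sequences are covered.\<close>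

lemma ui_norm_le_gauge_ext:
  assumes Y: "compact_op Y" and le: "\<And>k. ky_fan k Y \<le> (\<Sum>i<k. t i)"
  shows "ui_norm g Y \<le> gauge_ext g t"
  unfolding ui_norm_def
proof (rule gauge_ext_weak_majorisation)
  obtain p q where svd: "singular_system Y (singular_values Y) p q"
    using singular_value_decomposition[OF Y] by blast
  show "antimono (singular_values Y)" "0 \<le> singular_values Y i" for i
    by (rule singular_systemD[OF svd])+
qed (use le in \<open>simp add: ky_fan_def\<close>)

lemma ui_norm_finite: "Y \<in> norm_ideal g \<Longrightarrow> ui_norm g Y = ennreal (ideal_norm g Y)"
  by (simp add: norm_ideal_def ideal_norm_def)

lemma norm_ideal_compact: "Y \<in> norm_ideal g \<Longrightarrow> compact_op Y"
  by (simp add: norm_ideal_def)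

lemma norm_idealI:
  assumes "compact_op Y" "ui_norm g Y \<le> ennreal r" "0 \<le> r"
  shows "Y \<in> norm_ideal g" "ideal_norm g Y \<le> r"
proof -
  show "Y \<in> norm_ideal g"
    using assms by (simp add: norm_ideal_def order_le_less_trans[OF assms(2)])
  show "ideal_norm g Y \<le> r"
    unfolding ideal_norm_def using enn2real_mono[OF assms(2)] assms(3) by simp
qed

lemma norm_ideal_add:
  assumes Y: "Y \<in> norm_ideal g" and Z: "Z \<in> norm_ideal g"
  shows "(\<lambda>x. Y x + Z x) \<in> norm_ideal g"
    and "ideal_norm g (\<lambda>x. Y x + Z x) \<le> ideal_norm g Y + ideal_norm g Z"
proof -
  note cY = norm_ideal_compact[OF Y] and cZ = norm_ideal_compact[OF Z]
  have "ui_norm g (\<lambda>x. Y x + Z x) \<le> gauge_ext g (\<lambda>n. singular_values Y n + singular_values Z n)"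
    using ky_fan_add_le[OF cY cZ]
    by (intro ui_norm_le_gauge_ext compact_op_add cY cZ) (simp add: ky_fan_def sum.distrib)
  also have "\<dots> \<le> ui_norm g Y + ui_norm g Z" unfolding ui_norm_def by (rule gauge_ext_add_le)
  also have "\<dots> = ennreal (ideal_norm g Y + ideal_norm g Z)"
    by (simp add: ui_norm_finite[OF Y] ui_norm_finite[OF Z] ideal_norm_nonneg)
  finally have le: "ui_norm g (\<lambda>x. Y x + Z x) \<le> ennreal (ideal_norm g Y + ideal_norm g Z)" .
  show "(\<lambda>x. Y x + Z x) \<in> norm_ideal g"
    "ideal_norm g (\<lambda>x. Y x + Z x) \<le> ideal_norm g Y + ideal_norm g Z"
    by (rule norm_idealI[OF compact_op_add[OF cY cZ] le], simp add: ideal_norm_nonneg)+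
qed

lemma norm_ideal_comp:
  assumes Y: "Y \<in> norm_ideal g"
    and C: "bounded_clinear C" "\<And>x. norm (C x) \<le> c * norm x" "0 \<le> c"
    and D: "bounded_clinear D" "\<And>x. norm (D x) \<le> d * norm x" "0 \<le> d"
  shows "(\<lambda>x. C (Y (D x))) \<in> norm_ideal g"
    and "ideal_norm g (\<lambda>x. C (Y (D x))) \<le> c * d * ideal_norm g Y"
proof -
  note cY = norm_ideal_compact[OF Y]
  have "ui_norm g (\<lambda>x. C (Y (D x))) \<le> gauge_ext g (\<lambda>n. (c * d) * singular_values Y n)"
    using ky_fan_comp_le[OF cY C D]
    by (intro ui_norm_le_gauge_ext compact_op_comp[OF C(1) cY D(1)]) (simp add: ky_fan_def sum_distrib_left)
  also have "\<dots> \<le> ennreal (c * d) * ui_norm g Y"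
    unfolding ui_norm_def using C(3) D(3) by (intro gauge_ext_scale_le) simp
  also have "\<dots> = ennreal (c * d * ideal_norm g Y)"
    using C(3) D(3) by (simp add: ui_norm_finite[OF Y] ideal_norm_nonneg ennreal_mult)
  finally have le: "ui_norm g (\<lambda>x. C (Y (D x))) \<le> ennreal (c * d * ideal_norm g Y)" .
  show "(\<lambda>x. C (Y (D x))) \<in> norm_ideal g" "ideal_norm g (\<lambda>x. C (Y (D x))) \<le> c * d * ideal_norm g Y"
    by (rule norm_idealI[OF compact_op_comp[OF C(1) cY D(1)] le],
        simp add: C(3) D(3) ideal_norm_nonneg)+
qed

lemma norm_ideal_mult:
  assumes "Y \<in> norm_ideal g" "bounded_clinear C" "bounded_clinear D"
  shows "(\<lambda>x. C (Y (D x))) \<in> norm_ideal g"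
  using norm_ideal_comp(1)[OF assms(1,2) bounded_clinearD(9)[OF assms(2)] onorm_nonneg[OF assms(2)]
      assms(3) bounded_clinearD(9)[OF assms(3)] onorm_nonneg[OF assms(3)]] .

lemma norm_ideal_scaleR:
  fixes Y :: "'a::chilbert_space \<Rightarrow> 'a"
  assumes Y: "Y \<in> norm_ideal g"
  shows "(\<lambda>x. r *\<^sub>R Y x) \<in> norm_ideal g" and "ideal_norm g (\<lambda>x. r *\<^sub>R Y x) \<le> \<bar>r\<bar> * ideal_norm g Y"
proof -
  note bI = bounded_clinear_id
  have r: "norm (r *\<^sub>R x) \<le> \<bar>r\<bar> * norm x" "norm x \<le> 1 * norm x" for x :: 'a by simp_all
  show "(\<lambda>x. r *\<^sub>R Y x) \<in> norm_ideal g"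
    by (rule norm_ideal_comp(1)[OF Y bounded_clinear_scaleR[OF bI] r(1) _ bI r(2)]) auto
  have "ideal_norm g (\<lambda>x. r *\<^sub>R Y x) \<le> \<bar>r\<bar> * 1 * ideal_norm g Y"
    by (rule norm_ideal_comp(2)[OF Y bounded_clinear_scaleR[OF bI] r(1) _ bI r(2)]) auto
  then show "ideal_norm g (\<lambda>x. r *\<^sub>R Y x) \<le> \<bar>r\<bar> * ideal_norm g Y" by simp
qed

theorem arith_geo_mean:
  assumes A: "positive_op A" and B: "positive_op B" and X: "X \<in> norm_ideal g"
  shows "2 * ideal_norm g (\<lambda>x. A (X (B x))) \<le> ideal_norm g (\<lambda>x. A (A (X x)) + X (B (B x)))"
proof -
  note bA = positive_op_bounded[OF A] and bB = positive_op_bounded[OF B]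
  define Y where "Y = (\<lambda>x. A (A (X x)) + X (B (B x)))"
  define S where "S = (\<lambda>x. A (X (B x)))"
  have S: "compact_op S"
    unfolding S_def by (rule compact_op_comp[OF bA norm_ideal_compact[OF X] bB])
  have Y: "Y \<in> norm_ideal g"
    unfolding Y_def
    by (rule norm_ideal_add(1)[OF norm_ideal_mult[OF X bounded_clinear_comp[OF bA bA] bounded_clinear_id]
          norm_ideal_mult[OF X bounded_clinear_id bounded_clinear_comp[OF bB bB]]])
  have "ui_norm g S \<le> gauge_ext g (\<lambda>n. (1/2) * singular_values Y n)"
  proof (rule ui_norm_le_gauge_ext[OF S])
    show "ky_fan k S \<le> (\<Sum>i<k. (1/2) * singular_values Y i)" for k
      using ky_fan_arith_geo_mean[OF A B norm_ideal_compact[OF X], of k]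
      unfolding S_def[symmetric] Y_def[symmetric] sum_distrib_left[symmetric] ky_fan_def[symmetric]
      by simp
  qed
  also have "\<dots> \<le> ennreal (1/2) * ui_norm g Y"
    unfolding ui_norm_def by (intro gauge_ext_scale_le) simp
  also have "\<dots> = ennreal (1/2 * ideal_norm g Y)"
    unfolding ui_norm_finite[OF Y] by (rule ennreal_mult[symmetric]) (simp_all add: ideal_norm_nonneg)
  finally have "ideal_norm g S \<le> 1/2 * ideal_norm g Y"
    by (rule norm_idealI(2)[OF S]) (simp add: ideal_norm_nonneg)
  then show ?thesis by (simp add: S_def Y_def)
qed

end

section \<open>Convexity\<close>

text \<open>Let \<open>h\<close> be the difference of \<open>F\<close> and its chord, transported to \<open>[0, 1]\<close>, and \<open>S = sup h\<close>. Every \<open>t\<close> is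
  the midpoint of an end point, where \<open>h\<close> vanishes, and another point. Hence \<open>h \<le> S / 2\<close> and
  therefore \<open>S \<le> 0\<close>.\<close>

lemma below_chord_if_midpoint_convex_bounded:
  fixes F :: "real \<Rightarrow> real"
  assumes mid: "\<And>x y. x \<in> {a..b} \<Longrightarrow> y \<in> {a..b} \<Longrightarrow> 2 * F ((x + y) / 2) \<le> F x + F y"
    and K: "\<And>x. x \<in> {a..b} \<Longrightarrow> F x \<le> K" and ab: "a \<le> b" and t: "t \<in> {0..1}"
  shows "F ((1 - t) * a + t * b) \<le> (1 - t) * F a + t * F b"
proof -
  define c where "c t = (1 - t) * a + t * b" for t
  define l where "l t = (1 - t) * F a + t * F b" for t
  define h where "h t = F (c t) - l t" for t
  have pt: "c t \<in> {a..b}" if "t \<in> {0..1}" for t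
  proof -
    have "(1 - t) * a + t * a \<le> (1 - t) * a + t * b" "(1 - t) * a + t * b \<le> (1 - t) * b + t * b"
      using that ab by (auto intro!: add_left_mono add_right_mono mult_left_mono)
    then show ?thesis by (simp add: c_def algebra_simps)
  qed
  have h_mid: "h ((u + v) / 2) \<le> (h u + h v) / 2" if "u \<in> {0..1}" "v \<in> {0..1}" for u v
  proof -
    have cl: "c ((u + v) / 2) = (c u + c v) / 2" "l ((u + v) / 2) = (l u + l v) / 2"
      by (simp_all add: c_def l_def field_simps)
    define m where "m = F ((c u + c v) / 2)"
    have "2 * m \<le> F (c u) + F (c v)" unfolding m_def by (rule mid[OF pt[OF that(1)] pt[OF that(2)]])
    then show ?thesis unfolding h_def cl m_def[symmetric] by (simp add: field_simps)
  qed
  have h01: "h 0 = 0" "h 1 = 0" by (simp_all add: h_def c_def l_def)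
  have "bdd_above (h ` {0..1})"
  proof (rule bdd_aboveI2)
    fix t :: real assume t: "t \<in> {0..1}"
    have "- ((1 - t) * F a) \<le> \<bar>F a\<bar>" "- (t * F b) \<le> \<bar>F b\<bar>"
      using t mult_right_mono[of "1 - t" 1 "\<bar>F a\<bar>"] mult_right_mono[of t 1 "\<bar>F b\<bar>"]
        abs_ge_minus_self[of "(1 - t) * F a"] abs_ge_minus_self[of "t * F b"]
      by (auto simp: abs_mult)
    then show "h t \<le> K + \<bar>F a\<bar> + \<bar>F b\<bar>" using K[OF pt[OF t]] by (simp add: h_def l_def)
  qed
  then have le_S: "h t \<le> Sup (h ` {0..1})" if "t \<in> {0..1}" for t
    using that by (intro cSup_upper) auto
  have half: "h t \<le> Sup (h ` {0..1}) / 2" if t: "t \<in> {0..1}" for t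
  proof (cases "t \<le> 1/2")
    case True
    then show ?thesis using h_mid[of 0 "2 * t"] le_S[of "2 * t"] t h01 by simp
  next
    case False
    then show ?thesis using h_mid[of "2 * t - 1" 1] le_S[of "2 * t - 1"] t h01 by simp
  qed
  then have "Sup (h ` {0..1}) \<le> Sup (h ` {0..1}) / 2" by (intro cSup_least) auto
  then have "h t \<le> 0" using le_S[OF t] by simp
  then show ?thesis by (simp add: h_def c_def l_def)
qed

lemma convex_on_if_midpoint_convex_bounded:
  fixes F :: "real \<Rightarrow> real"
  assumes mid: "\<And>x y. x \<in> {a..b} \<Longrightarrow> y \<in> {a..b} \<Longrightarrow> 2 * F ((x + y) / 2) \<le> F x + F y"
    and K: "\<And>x. x \<in> {a..b} \<Longrightarrow> F x \<le> K"
  shows "convex_on {a..b} F"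
proof (rule convex_on_linorderI)
  fix t x y :: real
  assume "0 < t" "t < 1" "x \<in> {a..b}" "y \<in> {a..b}" "x < y"
  then show "F ((1 - t) *\<^sub>R x + t *\<^sub>R y) \<le> (1 - t) * F x + t * F y"
    using below_chord_if_midpoint_convex_bounded[of x y F K t] mid K by simp
qed simp

lemma integral_le_trapezium:
  fixes F :: "real \<Rightarrow> real"
  assumes F: "F integrable_on {a..b}" "convex_on {a..b} F" and ab: "a < b"
  shows "integral {a..b} F \<le> (b - a) / 2 * (F a + F b)"
proof -
  define k where "k = (F b - F a) / (b - a)"
  have k: "k * (b - a) = F b - F a" using ab by (simp add: k_def)
  define L where "L x = k * (x - a) + F a" for x
  define M where "M x = k * ((x - a)\<^sup>2 / 2) + F a * x" for x
  have "(M has_vector_derivative L x) (at x within {a..b})" for x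
    unfolding L_def M_def has_real_derivative_iff_has_vector_derivative[symmetric]
    by (auto intro!: derivative_eq_intros)
  then have "(L has_integral (M b - M a)) {a..b}"
    using ab by (intro fundamental_theorem_of_calculus) auto
  moreover have "M b - M a = k * (b - a) * ((b - a) / 2) + F a * (b - a)"
    by (simp add: M_def power2_eq_square algebra_simps)
  then have "M b - M a = (b - a) / 2 * (F a + F b)"
    unfolding k by (simp add: field_simps)
  ultimately have L: "(L has_integral (b - a) / 2 * (F a + F b)) {a..b}" by simp
  have "F x \<le> L x" if "x \<in> {a..b}" for x
    using convex_onD_Icc'[OF F(2) that] by (simp add: L_def k_def)
  then show ?thesis
    using integral_le[OF F(1), of L] L by (simp add: has_integral_integrable integral_unique)
qed

text \<open>The trapezium rule on the four intervals of length \<open>1/8\<close> that partition \<open>[1/4, 3/4]\<close> bounds the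
  integral of a convex function from above. By symmetry only the nodes \<open>1/4\<close>, \<open>3/8\<close> and \<open>1/2\<close> occur,
  and \<open>F (3/8)\<close> and \<open>F (1/2)\<close> cancel exactly against the other terms on the left.\<close>

lemma refined_hermite_hadamard:
  fixes F :: "real \<Rightarrow> real"
  assumes F: "convex_on {0..1} F" and sym: "\<And>\<nu>. F (1 - \<nu>) = F \<nu>"
  shows "F (1/2) + ((F (1/4) + F (1/2)) / 2 - F ((1/4 + 1/2) / 2))
           + 2 * (2 * integral {1/4..3/4} F - F (1/2)) \<le> F (1/4)"
proof -
  have "convex_on {0<..<1} F" by (rule convex_on_subset[OF F]) auto
  then have cont: "continuous_on {0<..<1} F"
    by (intro convex_on_continuous) auto
  have int: "F integrable_on {l..r}" if "1/4 \<le> l" "r \<le> 3/4" for l r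
    by (rule integrable_continuous_real, rule continuous_on_subset[of "{0<..<1}" F])
      (use cont that in auto)
  have le: "integral {l..l + 1/8} F \<le> 1/16 * (F l + F (l + 1/8))" if "1/4 \<le> l" "l \<le> 5/8" for l
    using integral_le_trapezium[OF int convex_on_subset[OF F], of l "l + 1/8"] that by simp
  have split: "integral {l..3/4} F = integral {l..l + 1/8} F + integral {l + 1/8..3/4} F"
    if "1/4 \<le> l" "l \<le> 5/8" for l
    using that by (intro Henstock_Kurzweil_Integration.integral_combine[symmetric] int) auto
  have "integral {1/4..3/4} F = integral {1/4..3/8} F + integral {3/8..1/2} F
      + integral {1/2..5/8} F + integral {5/8..3/4} F"
    using split[of "1/4"] split[of "3/8"] split[of "1/2"] by simp
  moreover have "\<dots> \<le> 1/16 * (2 * F (1/4) + 4 * F (3/8) + 2 * F (1/2))"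
    using le[of "1/4"] le[of "3/8"] le[of "1/2"] le[of "5/8"] sym[of "1/4"] sym[of "3/8"] by simp
  moreover have "(1/4 + 1/2) / 2 = (3/8 :: real)" by simp
  ultimately show ?thesis by argo
qed

section \<open>The Heinz and Heron means\<close>

definition heinz_op :: "('a::chilbert_space \<Rightarrow> 'a) \<Rightarrow> ('a \<Rightarrow> 'a) \<Rightarrow> ('a \<Rightarrow> 'a) \<Rightarrow> real \<Rightarrow> 'a \<Rightarrow> 'a" where
  "heinz_op A B X \<nu> x =
     op_powr A \<nu> (X (op_powr B (1 - \<nu>) x)) + op_powr A (1 - \<nu>) (X (op_powr B \<nu> x))"

lemma heinz_F_eq: "heinz_F g A B X \<nu> = 1/2 * ideal_norm g (heinz_op A B X \<nu>)"
  by (simp add: heinz_F_def ideal_norm_def heinz_op_def[abs_def])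

lemma heinz_F_sym: "heinz_F g A B X (1 - \<nu>) = heinz_F g A B X \<nu>"
  by (simp add: heinz_F_def add.commute)

context
  fixes g :: "(nat \<Rightarrow> real) \<Rightarrow> real" and A B X :: "'a::chilbert_space \<Rightarrow> 'a"
  assumes g: "symmetric_gauge g" and A: "positive_op A" and B: "positive_op B"
    and X: "X \<in> norm_ideal g"
begin

lemma bounded_powr: "0 \<le> r \<Longrightarrow> bounded_clinear (op_powr A r)" "0 \<le> r \<Longrightarrow> bounded_clinear (op_powr B r)"
  by (simp_all add: positive_op_bounded positive_op_op_powr A B)

lemma powr_powr:
  "0 \<le> r \<Longrightarrow> 0 \<le> s \<Longrightarrow> op_powr A r (op_powr A s x) = op_powr A (r + s) x"
  "0 \<le> r \<Longrightarrow> 0 \<le> s \<Longrightarrow> op_powr B r (op_powr B s x) = op_powr B (r + s) x"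
  by (simp_all add: op_powr_add A B)

lemma powr_term_in_ideal:
  assumes "0 \<le> r" "0 \<le> s"
  shows "(\<lambda>x. op_powr A r (X (op_powr B s x))) \<in> norm_ideal g"
  by (rule norm_ideal_mult[OF g X bounded_powr(1)[OF assms(1)] bounded_powr(2)[OF assms(2)]])

lemma heinz_op_in_ideal: "\<nu> \<in> {0..1} \<Longrightarrow> heinz_op A B X \<nu> \<in> norm_ideal g"
  unfolding heinz_op_def[abs_def]
  by (intro norm_ideal_add(1)[OF g] powr_term_in_ideal) auto

lemma heinz_F_bounded: "\<exists>K. \<forall>\<nu>\<in>{0..1}. heinz_F g A B X \<nu> \<le> K"
proof -
  define K where "K = max 1 (onorm A) * max 1 (onorm B) * ideal_norm g X"
  have K: "ideal_norm g (\<lambda>x. op_powr A r (X (op_powr B s x))) \<le> K" if "r \<in> {0..1}" "s \<in> {0..1}" for r s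
    unfolding K_def
    by (rule norm_ideal_comp(2)[OF g X]) (use that in \<open>auto intro!: bounded_powr norm_op_powr_le A B\<close>)
  have "heinz_F g A B X \<nu> \<le> K" if \<nu>: "\<nu> \<in> {0..1}" for \<nu>
  proof -
    have "ideal_norm g (heinz_op A B X \<nu>) \<le> K + K"
      unfolding heinz_op_def[abs_def]
      by (rule order_trans[OF norm_ideal_add(2)[OF g] add_mono[OF K K]])
        (use \<nu> in \<open>auto intro!: powr_term_in_ideal\<close>)
    then show ?thesis by (simp add: heinz_F_eq)
  qed
  then show ?thesis by blast
qed

text \<open>With \<open>Z = A\<^sup>p X B\<^sup>q + A\<^sup>q X B\<^sup>p\<close>, the Heinz operators at \<open>p + 2d\<close> and at \<open>p\<close> add up to
  \<open>A\<^bsup>2d\<^esup> Z + Z B\<^bsup>2d\<^esup>\<close>, while the one at the midpoint \<open>p + d\<close> is \<open>A\<^sup>d Z B\<^sup>d\<close>. So midpoint convexity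
  is the arithmetic-geometric mean inequality for \<open>A\<^sup>d\<close>, \<open>B\<^sup>d\<close> and \<open>Z\<close>.\<close>

lemma heinz_F_midpoint:
  assumes d: "0 \<le> d" "0 \<le> p" "0 \<le> q" "p + q + 2 * d = 1"
  shows "2 * heinz_F g A B X (p + d) \<le> heinz_F g A B X (p + 2 * d) + heinz_F g A B X p"
proof -
  define Z where "Z = (\<lambda>x. op_powr A p (X (op_powr B q x)) + op_powr A q (X (op_powr B p x)))"
  have Z: "Z \<in> norm_ideal g"
    unfolding Z_def by (intro norm_ideal_add(1)[OF g] powr_term_in_ideal d)
  have e: "1 - (p + d) = q + d" "1 - (p + 2 * d) = q" "1 - p = q + 2 * d" using d by auto
  have H: "heinz_op A B X (p + d) x =
        op_powr A (p + d) (X (op_powr B (q + d) x)) + op_powr A (q + d) (X (op_powr B (p + d) x))"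
      "heinz_op A B X (p + 2 * d) x =
        op_powr A (p + 2 * d) (X (op_powr B q x)) + op_powr A q (X (op_powr B (p + 2 * d) x))"
      "heinz_op A B X p x =
        op_powr A p (X (op_powr B (q + 2 * d) x)) + op_powr A (q + 2 * d) (X (op_powr B p x))" for x
    by (simp_all only: heinz_op_def e)
  have m: "(\<lambda>x. op_powr A d (Z (op_powr B d x))) = heinz_op A B X (p + d)"
    unfolding fun_eq_iff H
    using d by (simp add: Z_def bounded_clinearD(3)[OF bounded_powr(1)] powr_powr add.commute)
  have AA: "op_powr A d (op_powr A d x) = op_powr A (2 * d) x"
    and BB: "op_powr B d (op_powr B d x) = op_powr B (2 * d) x" for x
    using d powr_powr[of d d x] by simp_all
  have lr: "(\<lambda>x. op_powr A d (op_powr A d (Z x)) + Z (op_powr B d (op_powr B d x))) =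
      (\<lambda>x. heinz_op A B X (p + 2 * d) x + heinz_op A B X p x)"
    unfolding AA BB fun_eq_iff H
    using d by (simp add: Z_def bounded_clinearD(3)[OF bounded_powr(1)] powr_powr ac_simps)
  have "2 * ideal_norm g (heinz_op A B X (p + d)) \<le>
      ideal_norm g (\<lambda>x. heinz_op A B X (p + 2 * d) x + heinz_op A B X p x)"
    using arith_geo_mean[OF g positive_op_op_powr[OF A d(1)] positive_op_op_powr[OF B d(1)] Z]
    unfolding m lr .
  also have "\<dots> \<le> ideal_norm g (heinz_op A B X (p + 2 * d)) + ideal_norm g (heinz_op A B X p)"
    using d by (intro norm_ideal_add(2)[OF g] heinz_op_in_ideal) auto
  finally show ?thesis by (simp add: heinz_F_eq)
qed

lemma convex_on_heinz_F: "convex_on {0..1} (heinz_F g A B X)"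
proof -
  obtain K where K: "\<And>\<nu>. \<nu> \<in> {0..1} \<Longrightarrow> heinz_F g A B X \<nu> \<le> K" using heinz_F_bounded by blast
  have less: "2 * heinz_F g A B X ((x + y) / 2) \<le> heinz_F g A B X x + heinz_F g A B X y"
    if "x \<in> {0..1}" "y \<in> {0..1}" "x \<le> y" for x y
  proof -
    have "2 * heinz_F g A B X (x + (y - x) / 2) \<le> heinz_F g A B X (x + 2 * ((y - x) / 2)) + heinz_F g A B X x"
      by (rule heinz_F_midpoint[of _ x "1 - y"]) (use that in \<open>auto simp: field_simps\<close>)
    moreover have "x + (y - x) / 2 = (x + y) / 2" "x + 2 * ((y - x) / 2) = y" by (simp_all add: field_simps)
    ultimately show ?thesis by (simp only: add.commute)
  qed
  show ?thesis
  proof (rule convex_on_if_midpoint_convex_bounded[OF _ K])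
    fix x y :: real assume "x \<in> {0..1}" "y \<in> {0..1}"
    then show "2 * heinz_F g A B X ((x + y) / 2) \<le> heinz_F g A B X x + heinz_F g A B X y"
      using less[of x y] less[of y x] by (cases "x \<le> y") (simp_all add: add.commute)
  qed
qed

text \<open>With \<open>W = A\<^bsup>1/2\<^esup> X + X B\<^bsup>1/2\<^esup>\<close>, the operator \<open>A\<^bsup>1/2\<^esup> W + W B\<^bsup>1/2\<^esup>\<close> is four times the Heron mean at
  \<open>1/2\<close>, while \<open>A\<^bsup>1/4\<^esup> W B\<^bsup>1/4\<^esup>\<close> is the Heinz operator at \<open>1/4\<close>.\<close>

lemma heinz_F_le_heron_G_half: "heinz_F g A B X (1/4) \<le> heron_G g A B X (1/2)"
proof -
  \<comment> \<open>The zeroth powers are identities; they bring \<open>W\<close> into the form of the terms already known to lie in the ideal.\<close>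
  define W where "W = (\<lambda>x. op_powr A (1/2) (X (op_powr B 0 x)) + op_powr A 0 (X (op_powr B (1/2) x)))"
  have W: "W \<in> norm_ideal g"
    unfolding W_def by (intro norm_ideal_add(1)[OF g] powr_term_in_ideal) auto
  define V where "V = (\<lambda>x. (1/2) *\<^sub>R op_powr A (1/2) (X (op_powr B (1/2) x)) +
      (1/2) *\<^sub>R ((1/2) *\<^sub>R (A (X x) + X (B x))))"
  have V: "V \<in> norm_ideal g"
    unfolding V_def
    using powr_term_in_ideal[of 1 0] powr_term_in_ideal[of 0 1] powr_term_in_ideal[of "1/2" "1/2"]
    by (intro norm_ideal_add(1)[OF g] norm_ideal_scaleR(1)[OF g]) (simp_all add: op_powr_1 A B)
  have m: "(\<lambda>x. op_powr A (1/4) (W (op_powr B (1/4) x))) = heinz_op A B X (1/4)"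
    by (simp add: fun_eq_iff W_def heinz_op_def bounded_clinearD(3)[OF bounded_powr(1)] powr_powr)
  have half: "op_powr A (1/2) (op_powr A (1/2) x) = A x" "op_powr B (1/2) (op_powr B (1/2) x) = B x" for x
    by (simp_all add: powr_powr op_powr_1 A B)
  have quarter: "op_powr A (1/4) (op_powr A (1/4) x) = op_powr A (1/2) x"
    "op_powr B (1/4) (op_powr B (1/4) x) = op_powr B (1/2) x" for x
    by (simp_all add: powr_powr)
  have lr: "(\<lambda>x. op_powr A (1/4) (op_powr A (1/4) (W x)) + W (op_powr B (1/4) (op_powr B (1/4) x))) =
      (\<lambda>x. 4 *\<^sub>R V x)"
    unfolding quarter
    by (simp add: fun_eq_iff W_def V_def half bounded_clinearD(3)[OF bounded_powr(1)] scaleR_add_right)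
      (simp add: scaleR_2)
  have "0 \<le> (1/4 :: real)" by simp
  from arith_geo_mean[OF g positive_op_op_powr[OF A this] positive_op_op_powr[OF B this] W]
  have "2 * ideal_norm g (heinz_op A B X (1/4)) \<le> ideal_norm g (\<lambda>x. 4 *\<^sub>R V x)" unfolding m lr .
  also have "\<dots> \<le> 4 * ideal_norm g V" using norm_ideal_scaleR(2)[OF g V, of 4] by simp
  also have "ideal_norm g V = heron_G g A B X (1/2)" by (simp add: V_def heron_G_def ideal_norm_def)
  finally show ?thesis by (simp add: heinz_F_eq)
qed

text \<open>As the norm of an affine function of \<open>\<alpha>\<close>, the Heron function \<open>G\<close> is convex, and
  \<open>G 0 \<le> F (1/2) \<le> F (1/4) \<le> G (1/2)\<close>. A convex function that does not decrease from \<open>0\<close> to \<open>1/2\<close> lies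
  above \<open>G (1/2)\<close> from there on: \<open>1/2\<close> is a convex combination of \<open>0\<close> and \<open>\<alpha>\<close>.\<close>

lemma heron_G_half_le:
  assumes \<alpha>: "1/2 \<le> \<alpha>"
  shows "heron_G g A B X (1/2) \<le> heron_G g A B X \<alpha>"
proof -
  define P where "P = (\<lambda>x. op_powr A (1/2) (X (op_powr B (1/2) x)))"
  define Q where "Q = (\<lambda>x. (1/2) *\<^sub>R (A (X x) + X (B x)))"
  define G where "G \<beta> = (\<lambda>x. (1 - \<beta>) *\<^sub>R P x + \<beta> *\<^sub>R Q x)" for \<beta> :: real
  have G_eq: "heron_G g A B X \<beta> = ideal_norm g (G \<beta>)" for \<beta>
    by (simp add: G_def P_def Q_def heron_G_def ideal_norm_def)
  have P: "P \<in> norm_ideal g" unfolding P_def by (rule powr_term_in_ideal) auto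
  have Q: "Q \<in> norm_ideal g"
    unfolding Q_def
    using powr_term_in_ideal[of 1 0] powr_term_in_ideal[of 0 1]
    by (intro norm_ideal_add(1)[OF g] norm_ideal_scaleR(1)[OF g]) (simp_all add: op_powr_1 A B)
  have G: "G \<beta> \<in> norm_ideal g" for \<beta>
    unfolding G_def by (intro norm_ideal_add(1)[OF g] norm_ideal_scaleR(1)[OF g] P Q)
  have "ideal_norm g P \<le> heinz_F g A B X (1/2)"
  proof -
    have "P = (\<lambda>x. (1/2) *\<^sub>R heinz_op A B X (1/2) x)"
      by (simp add: P_def heinz_op_def fun_eq_iff scaleR_2[symmetric])
    then show ?thesis
      using norm_ideal_scaleR(2)[OF g heinz_op_in_ideal[of "1/2"], of "1/2"] by (simp add: heinz_F_eq)
  qed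
  also have "\<dots> \<le> heinz_F g A B X (1/4)"
    using heinz_F_midpoint[of "1/4" "1/4" "1/4"] heinz_F_sym[of g A B X "1/4"] by simp
  also have "\<dots> \<le> ideal_norm g (G (1/2))"
    using heinz_F_le_heron_G_half by (simp add: G_eq)
  finally have P_le: "ideal_norm g P \<le> ideal_norm g (G (1/2))" .
  define l where "l = 1 / (2 * \<alpha>)"
  have l: "0 < l" "l \<le> 1" "l * \<alpha> = 1/2" using \<alpha> by (auto simp: l_def)
  have "G (1/2) = (\<lambda>x. (1 - l) *\<^sub>R P x + l *\<^sub>R G \<alpha> x)"
  proof
    fix x
    have "(1 - l) *\<^sub>R P x + l *\<^sub>R G \<alpha> x = ((1 - l) + l * (1 - \<alpha>)) *\<^sub>R P x + (l * \<alpha>) *\<^sub>R Q x"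
      unfolding G_def scaleR_add_left scaleR_add_right scaleR_scaleR by (simp only: add.assoc)
    also have "(1 - l) + l * (1 - \<alpha>) = 1 - l * \<alpha>" by (simp add: right_diff_distrib)
    finally show "G (1/2) x = (1 - l) *\<^sub>R P x + l *\<^sub>R G \<alpha> x" unfolding l(3) by (simp add: G_def)
  qed
  then have "ideal_norm g (G (1/2)) \<le> ideal_norm g (\<lambda>x. (1 - l) *\<^sub>R P x) + ideal_norm g (\<lambda>x. l *\<^sub>R G \<alpha> x)"
    using norm_ideal_add(2)[OF g norm_ideal_scaleR(1)[OF g P] norm_ideal_scaleR(1)[OF g G]] by simp
  also have "\<dots> \<le> (1 - l) * ideal_norm g P + l * ideal_norm g (G \<alpha>)"
    using norm_ideal_scaleR(2)[OF g P, of "1 - l"] norm_ideal_scaleR(2)[OF g G, of l \<alpha>] l by simp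
  also have "\<dots> \<le> (1 - l) * ideal_norm g (G (1/2)) + l * ideal_norm g (G \<alpha>)"
    using l P_le by (intro add_right_mono mult_left_mono) auto
  finally have "l * ideal_norm g (G (1/2)) \<le> l * ideal_norm g (G \<alpha>)" by (simp add: left_diff_distrib)
  then show ?thesis using l(1) by (simp add: G_eq)
qed

end

section \<open>The refined Heinz-Heron inequality\<close>

theorem theorem5p2:
  fixes A B X :: "'a::chilbert_space \<Rightarrow> 'a"
    and g :: "(nat \<Rightarrow> real) \<Rightarrow> real"
    and \<alpha> :: real
  assumes separable: "\<exists>D::'a set. countable D \<and> closure D = UNIV"
    and gauge: "symmetric_gauge g"
    and A: "positive_op A"
    and B: "positive_op B"
    and X: "X \<in> norm_ideal g"
    and \<alpha>: "1/2 \<le> \<alpha>"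
  defines "F \<equiv> heinz_F g A B X"
    and "G \<equiv> heron_G g A B X"
  shows "F (1/2) + ((F (1/4) + F (1/2)) / 2 - F ((1/4 + 1/2) / 2))
           + 2 * (2 * integral {1/4..3/4} F - F (1/2)) \<le> G \<alpha>"
proof -
  have "F (1/2) + ((F (1/4) + F (1/2)) / 2 - F ((1/4 + 1/2) / 2))
      + 2 * (2 * integral {1/4..3/4} F - F (1/2)) \<le> F (1/4)"
    unfolding F_def
    by (rule refined_hermite_hadamard[OF convex_on_heinz_F[OF gauge A B X] heinz_F_sym])
  also have "\<dots> \<le> G (1/2)"
    unfolding F_def G_def by (rule heinz_F_le_heron_G_half[OF gauge A B X])
  also have "\<dots> \<le> G \<alpha>"
    unfolding G_def by (rule heron_G_half_le[OF gauge A B X \<alpha>])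
  finally show ?thesis .
qed

end
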